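(* There exist absolute constants $c,C,c'>0$ with the following property. Let $n,m\geq2$ and put $Q_n=[-1/2,1/2]^n$ and $\Lambda_{m,n}=\min\{n,\ln(e+m)\}$. Let $K_1,\ldots,K_m\subseteq\mathbb{R}^n$ be unconditional isotropic convex bodies, and let $U_1,\ldots,U_m\in O(n)$ be arbitrary. Then $$ \left|\bigcap_{i=1}^mU_iK_i\right|^{1/n}\geq\frac{c}{\sqrt{\Lambda_{m,n}}}. $$ On the other hand, if $U_1=I_n$ and $U_2,\ldots,U_m$ are independent Haar-distributed orthogonal transformations, then $$ \mathbb{E}\left|\bigcap_{i=1}^mU_iQ_n\right|\leq\left(\frac{C}{\sqrt{\Lambda_{m,n}}}\right)^n. $$ Consequently, $$ \mathbb{P}\left\{\frac{c}{\sqrt{\Lambda_{m,n}}}\leq\left|\bigcap_{i=1}^mU_iQ_n\right|^{1/n}\leq\frac{C}{\sqrt{\Lambda_{m,n}}}\right\}\geq1-e^{-c'n}. $$ In particular, the volume-one cube is extremal, up to absolute constants, for the median volume radius of intersections of $m$ independent rotations in the unconditional isotropic class: with $U_1=I_n$ and $U_2,\ldots,U_m$ independent and Haar-distributed, any median of $\mathrm{vrad}\left(\bigcap_{i=1}^mU_iK_i\right)$ is at least $c$ times any median of $\mathrm{vrad}\left(\bigcap_{i=1}^mU_iQ_n\right)$, for all unconditional isotropic convex bodies $K_1,\ldots,K_m\subseteq\mathbb{R}^n$.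
   Context: $|\cdot|$ denotes Lebesgue measure. A convex body $K\subseteq\mathbb{R}^n$ (compact convex set with nonempty interior) is isotropic if $|K|=1$, its barycenter is the origin and there is $L_K>0$ with $\int_K\langle x,\theta\rangle^2\,dx=L_K^2$ for all $\theta\in S^{n-1}$. It is unconditional if $(x_1,\ldots,x_n)\in K$ implies $(\varepsilon_1x_1,\ldots,\varepsilon_nx_n)\in K$ for all signs $\varepsilon_i\in\{-1,1\}$. $O(n)$ is the orthogonal group with its Haar probability measure, $I_n$ is the identity, and $\mathrm{vrad}(K)=(|K|/|B_2^n|)^{1/n}$ is the volume radius, where $B_2^n$ is the Euclidean unit ball. *)

theory Defs
  imports "HOL-Probability.Probability"
begin

text \<open>
  The dimension \<open>n\<close> is quantified inside the statement, below absolute constants, so \<open>\<real>\<^sup>n\<close> cannot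
  be a type. Points are the elements of the library's topological space \<^const>\<open>Euclidean_space\<close>:
  functions \<open>nat \<Rightarrow> real\<close> that vanish outside \<open>{..<n}\<close>. Likewise \<open>n \<times> n\<close> matrices are functions
  \<open>nat \<Rightarrow> nat \<Rightarrow> real\<close> that vanish outside \<open>{..<n} \<times> {..<n}\<close>.
\<close>

type_synonym rvec = "nat \<Rightarrow> real"
type_synonym rmat = "nat \<Rightarrow> nat \<Rightarrow> real"

abbreviation Rn :: "nat \<Rightarrow> rvec set" where
  "Rn n \<equiv> topspace (Euclidean_space n)"

definition ip :: "nat \<Rightarrow> rvec \<Rightarrow> rvec \<Rightarrow> real" where
  "ip n x y = (\<Sum>i<n. x i * y i)"

definition unit_sphere :: "nat \<Rightarrow> rvec set" where
  "unit_sphere n = {x \<in> Rn n. ip n x x = 1}"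

definition unit_ball :: "nat \<Rightarrow> rvec set" where
  "unit_ball n = {x \<in> Rn n. ip n x x \<le> 1}"

definition cube :: "nat \<Rightarrow> rvec set" where
  "cube n = {x \<in> Rn n. \<forall>i<n. x i \<in> {-1/2..1/2}}"

text \<open>
  The product measure lives on functions that are \<open>undefined\<close> outside \<open>{..<n}\<close>; it is transported to
  \<open>\<real>\<^sup>n\<close> along extension by zero, as a Borel measure on \<open>nat \<Rightarrow> real\<close>.
\<close>

definition zero_ext :: "nat \<Rightarrow> rvec \<Rightarrow> rvec" where
  "zero_ext n x = (\<lambda>i. if i < n then x i else 0)"

definition leb :: "nat \<Rightarrow> rvec measure" where
  "leb n = distr (Pi\<^sub>M {..<n} (\<lambda>_. lborel)) borel (zero_ext n)"

lemma measurable_zero_ext [measurable]: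
  "zero_ext n \<in> measurable (Pi\<^sub>M {..<n} (\<lambda>_. lborel)) borel"
proof (rule measurable_coordinatewise_then_product)
  fix i
  show "(\<lambda>x. zero_ext n x i) \<in> borel_measurable (Pi\<^sub>M {..<n} (\<lambda>_. lborel))"
    by (cases "i < n") (auto simp: zero_ext_def)
qed

abbreviation vol :: "nat \<Rightarrow> rvec set \<Rightarrow> real" where
  "vol n K \<equiv> measure (leb n) K"

definition vrad :: "nat \<Rightarrow> rvec set \<Rightarrow> real" where
  "vrad n K = (vol n K / vol n (unit_ball n)) powr (1 / real n)"

text \<open>
  Function types carry no real vector space structure in the library, so \<^const>\<open>convex\<close> does not
  apply and convexity is spelled out. The interior is taken relative to \<open>\<real>\<^sup>n\<close>.
\<close>

definition convex_body :: "nat \<Rightarrow> rvec set \<Rightarrow> bool" where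
  "convex_body n K \<longleftrightarrow>
     compactin (Euclidean_space n) K \<and>
     (\<forall>x\<in>K. \<forall>y\<in>K. \<forall>t\<in>{0..1}. (\<lambda>i. (1 - t) * x i + t * y i) \<in> K) \<and>
     Euclidean_space n interior_of K \<noteq> {}"

definition isotropic :: "nat \<Rightarrow> rvec set \<Rightarrow> bool" where
  "isotropic n K \<longleftrightarrow>
     vol n K = 1 \<and>
     (\<forall>i<n. (LINT x:K|leb n. x i) = 0) \<and>
     (\<exists>L>0. \<forall>\<theta>\<in>unit_sphere n. (LINT x:K|leb n. (ip n x \<theta>)\<^sup>2) = L\<^sup>2)"

definition unconditional :: "nat \<Rightarrow> rvec set \<Rightarrow> bool" where
  "unconditional n K \<longleftrightarrow>
     (\<forall>x\<in>K. \<forall>\<epsilon>::rvec. (\<forall>i. \<epsilon> i \<in> {-1, 1}) \<longrightarrow> (\<lambda>i. \<epsilon> i * x i) \<in> K)"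

definition mat_mult :: "nat \<Rightarrow> rmat \<Rightarrow> rmat \<Rightarrow> rmat" where
  "mat_mult n A B = (\<lambda>i j. \<Sum>k<n. A i k * B k j)"

definition mat_act :: "nat \<Rightarrow> rmat \<Rightarrow> rvec \<Rightarrow> rvec" where
  "mat_act n A x = (\<lambda>i. \<Sum>j<n. A i j * x j)"

definition id_mat :: "nat \<Rightarrow> rmat" where
  "id_mat n = (\<lambda>i j. if i = j \<and> i < n then 1 else 0)"

definition orth_group :: "nat \<Rightarrow> rmat set" where
  "orth_group n = {A. (\<forall>i j. \<not> (i < n \<and> j < n) \<longrightarrow> A i j = 0) \<and>
                      mat_mult n (\<lambda>i j. A j i) A = id_mat n}"

text \<open>
  The Haar probability measure of the compact group \<open>O(n)\<close>, given by its defining property: a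
  Borel probability measure on \<open>O(n)\<close> invariant under left translations.
\<close>

definition haar_prob :: "nat \<Rightarrow> rmat measure \<Rightarrow> bool" where
  "haar_prob n \<mu> \<longleftrightarrow>
     sets \<mu> = sets (restrict_space borel (orth_group n)) \<and>
     prob_space \<mu> \<and>
     (\<forall>A\<in>orth_group n. distr \<mu> \<mu> (mat_mult n A) = \<mu>)"

definition body_inter :: "nat \<Rightarrow> nat \<Rightarrow> (nat \<Rightarrow> rmat) \<Rightarrow> (nat \<Rightarrow> rvec set) \<Rightarrow> rvec set" where
  "body_inter n m U K = (\<Inter>i\<in>{1..m}. mat_act n (U i) ` K i)"

text \<open>
  Independent \<open>U\<^sub>2, \<dots>, U\<^sub>m\<close> of law \<open>\<mu>\<close> are realized as the coordinates of the product space
  \<open>Pi\<^sub>M {2..m} (\<lambda>_. \<mu>)\<close>; a sample \<open>V\<close> is completed by \<open>U\<^sub>1 = I\<^sub>n\<close>.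
\<close>

definition with_id :: "nat \<Rightarrow> (nat \<Rightarrow> rmat) \<Rightarrow> (nat \<Rightarrow> rmat)" where
  "with_id n V = V(1 := id_mat n)"

definition Lam :: "nat \<Rightarrow> nat \<Rightarrow> real" where
  "Lam m n = min (real n) (ln (exp 1 + real m))"

definition is_median :: "'w measure \<Rightarrow> ('w \<Rightarrow> real) \<Rightarrow> real \<Rightarrow> bool" where
  "is_median M X q \<longleftrightarrow>
     measure M {\<omega> \<in> space M. X \<omega> \<le> q} \<ge> 1/2 \<and> measure M {\<omega> \<in> space M. X \<omega> \<ge> q} \<ge> 1/2"

end

theory Submission
  imports Defs "HOL-Real_Asymp.Real_Asymp"
begin

text \<open>
  Lower bound. An unconditional isotropic body contains a cube of fixed size: the barycenter \<open>v\<close> of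
  \<open>(\<bar>x\<^sub>1\<bar>, \<dots>, \<bar>x\<^sub>n\<bar>)\<close> lies in it, so does the box with vertices \<open>(\<plusminus>v\<^sub>1, \<dots>, \<plusminus>v\<^sub>n)\<close>, and each
  \<open>v\<^sub>j\<close> is comparable to the isotropic constant because the tails of \<open>\<bar>x\<^sub>j\<bar>\<close> are log-concave. It
  remains to bound from below the volume of an intersection of \<open>n m\<close> slabs: round the \<open>n m\<close> linear
  functionals on a cube; the rounded vector has entropy \<open>O(n)\<close>, so some cell is large, and each cell
  has a translate inside the intersection. A ball contained in all the cubes gives the bound for
  \<open>m \<ge> e\<^sup>n\<close>.

  Upper bound. The expected volume is \<open>\<integral> \<phi>(x)\<^sup>m\<^sup>-\<^sup>1 dx\<close> over the cube, where \<open>\<phi>(x)\<close> is the probability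
  that a random rotation of the cube contains \<open>x\<close>. The function \<open>\<phi>\<close> is radial and decreasing, and
  outside a ball of radius of order \<open>sqrt (n / \<Lambda>)\<close> it is bounded by comparison with a Gaussian. The
  other two claims follow by Markov's inequality.
\<close>

subsection \<open>Lebesgue measure\<close>

text \<open>Since \<open>n\<close> is a variable, Lebesgue measure is reached only through iterated
  integrals, so its rotation invariance and the Prekopa-Leindler inequality behind log-concavity
  have to be built up by induction on the dimension or from translation invariance. In the lower
  bound there are \<open>n * m\<close> slabs, yet only a factor of the form C^n may be lost. The
  width of order sqrt(ln(e + m)) is chosen so that one functional rounds to a nonzero integer with
  probability of order (e + m)^-2. Charging ln(e + m) per unit of a rounded entry, the mean total
  charge is at most 2 n, and the matching sum over all integer vectors is at most e^(2 n). In the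
  upper bound the law of a rotated point on its sphere is never computed: testing the radial
  function \<phi> against a Gaussian turns the question into a product of one-dimensional integrals.
  The cut-off \<Lambda> \<le> n ensures that the gain of order n e^(-\<Lambda>/2) in the exponent
  dominates the exponentially small Gaussian mass outside the ball. The lower bound holds for every
  choice of rotations, so concentration and medians only have to control the upper tail, of
  probability at most e^-n < 1/2.\<close>

lemma sets_leb [simp, measurable_cong]: "sets (leb n) = sets borel"
  by (simp add: leb_def)

lemma space_leb [simp]: "space (leb n) = UNIV"
  by (simp add: leb_def)

lemma measurable_leb1 [simp]: "measurable (leb n) N = measurable borel N"
  by (rule measurable_cong_sets) simp_all

lemma measurable_coord [measurable]: "(\<lambda>x::rvec. x i) \<in> borel_measurable borel"
  by (rule measurable_product_coordinates)

lemma measurable_rvec_iff: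
  "f \<in> measurable M (borel :: rvec measure) \<longleftrightarrow> (\<forall>i. (\<lambda>x. f x i) \<in> borel_measurable M)"
proof safe
  fix i assume f: "f \<in> measurable M (borel :: rvec measure)"
  show "(\<lambda>x. f x i) \<in> borel_measurable M"
    by (rule measurable_compose[OF f measurable_coord])
qed (auto intro: measurable_coordinatewise_then_product)

lemma measurable_fun_upd_pair [measurable]:
  "(\<lambda>(x, t). (x::rvec)(n := t)) \<in> measurable (borel \<Otimes>\<^sub>M borel) borel"
  by (rule measurable_coordinatewise_then_product) (auto simp: fun_upd_def split_beta)

lemma measurable_fun_upd_rvec [measurable]:
  assumes [measurable]: "f \<in> measurable M (borel :: rvec measure)" "g \<in> borel_measurable M"
  shows "(\<lambda>x. (f x)(n := g x)) \<in> measurable M (borel :: rvec measure)"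
  using measurable_compose[OF measurable_Pair[OF assms] measurable_fun_upd_pair, of n] by simp

lemma measurable_rvec_ops [measurable]:
  assumes [measurable]: "f \<in> measurable M (borel :: rvec measure)" "g \<in> measurable M (borel :: rvec measure)"
  shows "(\<lambda>x i. f x i + g x i) \<in> measurable M (borel :: rvec measure)"
    "(\<lambda>x i. f x i - g x i) \<in> measurable M (borel :: rvec measure)"
    "(\<lambda>x i. \<bar>f x i\<bar>) \<in> measurable M (borel :: rvec measure)"
    "(\<lambda>x i. b i * f x i) \<in> measurable M (borel :: rvec measure)"
    "(\<lambda>x i. f x i + b i) \<in> measurable M (borel :: rvec measure)"
    "(\<lambda>x. mat_act n A (f x)) \<in> measurable M (borel :: rvec measure)"
    "(\<lambda>x. ip n (f x) (g x)) \<in> borel_measurable M"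
  unfolding measurable_rvec_iff mat_act_def ip_def by measurable

lemma Rn_iff: "x \<in> Rn n \<longleftrightarrow> (\<forall>i\<ge>n. x i = 0)"
  by (simp add: topspace_Euclidean_space)

lemma sets_Rn [measurable]: "Rn n \<in> sets borel"
proof -
  have "Rn n = {x\<in>space borel. \<forall>i\<in>{n..}. x i = 0}" by (auto simp: Rn_iff)
  also have "\<dots> \<in> sets borel" by measurable
  finally show ?thesis .
qed

lemma AE_leb_Rn: "AE x in leb n. x \<in> Rn n"
  unfolding leb_def by (subst AE_distr_iff) (auto simp: Rn_iff zero_ext_def)

interpretation lborel_prod: product_sigma_finite "\<lambda>_::nat. lborel :: real measure"
  by standard

lemma nn_integral_leb_0:
  assumes [measurable]: "f \<in> borel_measurable borel"
  shows "(\<integral>\<^sup>+x. f x \<partial>leb 0) = f (\<lambda>_. 0)"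
proof -
  have "zero_ext 0 = (\<lambda>x _. 0)" by (simp add: zero_ext_def fun_eq_iff)
  then show ?thesis
    unfolding leb_def using lborel_prod.nn_integral_empty[of "\<lambda>x. f (zero_ext 0 x)"]
    by (subst nn_integral_distr) auto
qed

text \<open>The Fubini step through which products, translations, scalings and Prekopa-Leindler are
  obtained by induction on the dimension; the base case is the unit mass at the zero vector.\<close>

lemma nn_integral_leb_Suc:
  assumes [measurable]: "f \<in> borel_measurable borel"
  shows "(\<integral>\<^sup>+x. f x \<partial>leb (Suc n)) = (\<integral>\<^sup>+x. \<integral>\<^sup>+t. f (x(n := t)) \<partial>lborel \<partial>leb n)"
proof -
  have upd: "zero_ext (Suc n) (x(n := t)) = (zero_ext n x)(n := t)" for x t
    by (auto simp: zero_ext_def fun_eq_iff)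
  have [simp]: "{..<Suc n} = insert n {..<n}" by auto
  have m: "(\<lambda>x. f (zero_ext (Suc n) x)) \<in> borel_measurable (Pi\<^sub>M (insert n {..<n}) (\<lambda>_. lborel))"
    using measurable_compose[OF measurable_zero_ext[of "Suc n"] assms] by simp
  have "(\<integral>\<^sup>+x. f x \<partial>leb (Suc n)) = (\<integral>\<^sup>+x. f (zero_ext (Suc n) x) \<partial>Pi\<^sub>M (insert n {..<n}) (\<lambda>_. lborel))"
    unfolding leb_def by (subst nn_integral_distr) (auto intro: measurable_zero_ext[of "Suc n", simplified])
  also have "\<dots> = (\<integral>\<^sup>+x. \<integral>\<^sup>+t. f ((zero_ext n x)(n := t)) \<partial>lborel \<partial>Pi\<^sub>M {..<n} (\<lambda>_. lborel))"
    by (subst lborel_prod.product_nn_integral_insert[OF _ _ m]) (auto simp: upd)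
  also have "\<dots> = (\<integral>\<^sup>+x. \<integral>\<^sup>+t. f (x(n := t)) \<partial>lborel \<partial>leb n)"
    unfolding leb_def by (subst nn_integral_distr) (auto intro!: lborel.borel_measurable_nn_integral)
  finally show ?thesis .
qed

lemma prod_indicator:
  fixes n :: nat
  shows "(\<Prod>i<n. indicator (A i) (x i) :: ennreal) = indicator {x. \<forall>i<n. x i \<in> A i} x"
  by (induction n) (auto simp: indicator_def less_Suc_eq)

lemma nn_integral_leb_prod:
  assumes [measurable]: "\<And>i. f i \<in> borel_measurable borel"
  shows "(\<integral>\<^sup>+x. (\<Prod>i<n. f i (x i)) \<partial>leb n) = (\<Prod>i<n. \<integral>\<^sup>+t. f i t \<partial>lborel)"
proof (induction n)
  case (Suc n)
  have "(\<integral>\<^sup>+x. (\<Prod>i<Suc n. f i (x i)) \<partial>leb (Suc n)) =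
      (\<integral>\<^sup>+x. \<integral>\<^sup>+t. (\<Prod>i<n. f i (x i)) * f n t \<partial>lborel \<partial>leb n)"
    by (subst nn_integral_leb_Suc) (auto simp: lessThan_Suc mult.commute)
  then show ?case
    by (simp add: nn_integral_cmult nn_integral_multc Suc.IH mult.commute)
qed (subst nn_integral_leb_0, auto)

lemma nn_integral_leb_translate:
  assumes "f \<in> borel_measurable borel" and "a \<in> Rn n"
  shows "(\<integral>\<^sup>+x. f (\<lambda>i. x i + a i) \<partial>leb n) = (\<integral>\<^sup>+x. f x \<partial>leb n)"
  using assms
proof (induction n arbitrary: a f)
  case 0
  note [measurable] = 0(1)
  show ?case using 0(2) by (simp add: nn_integral_leb_0 Rn_iff fun_eq_iff)
next
  case (Suc n)
  note [measurable] = Suc.prems(1)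
  define a' where "a' = a(n := 0)"
  have a': "a' \<in> Rn n" using Suc.prems(2) by (auto simp: Rn_iff a'_def)
  \<comment> \<open>The factor 1 is kept so that the inner integral has the affine shape of
    \<open>nn_integral_real_affine\<close>.\<close>
  have eq: "(\<lambda>i. (if i = n then t else x i) + a i) = (\<lambda>i. x i + a' i)(n := a n + 1 * t)" for x t
    by (auto simp: a'_def fun_eq_iff)
  have "(\<integral>\<^sup>+x. f (\<lambda>i. x i + a i) \<partial>leb (Suc n)) =
      (\<integral>\<^sup>+x. \<integral>\<^sup>+t. f ((\<lambda>i. x i + a' i)(n := a n + 1 * t)) \<partial>lborel \<partial>leb n)"
    by (subst nn_integral_leb_Suc) (auto simp: eq)
  also have "\<dots> = (\<integral>\<^sup>+x. \<integral>\<^sup>+t. f ((\<lambda>i. x i + a' i)(n := t)) \<partial>lborel \<partial>leb n)"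
  proof (rule nn_integral_cong)
    fix x :: rvec
    show "(\<integral>\<^sup>+t. f ((\<lambda>i. x i + a' i)(n := a n + 1 * t)) \<partial>lborel) =
        (\<integral>\<^sup>+t. f ((\<lambda>i. x i + a' i)(n := t)) \<partial>lborel)"
      using nn_integral_real_affine[of "\<lambda>t. f ((\<lambda>i. x i + a' i)(n := t))" 1 "a n"] by simp
  qed
  also have "\<dots> = (\<integral>\<^sup>+x. \<integral>\<^sup>+t. f (x(n := t)) \<partial>lborel \<partial>leb n)"
    by (rule Suc.IH[OF _ a']) measurable
  finally show ?case by (simp add: nn_integral_leb_Suc)
qed

lemma nn_integral_leb_scale:
  assumes "f \<in> borel_measurable borel" and c: "c > 0"
  shows "(\<integral>\<^sup>+x. f x \<partial>leb n) = ennreal (c ^ n) * (\<integral>\<^sup>+x. f (\<lambda>i. c * x i) \<partial>leb n)"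
  using assms(1)
proof (induction n arbitrary: f)
  case 0
  note [measurable] = 0(1)
  show ?case by (simp add: nn_integral_leb_0)
next
  case (Suc n)
  note [measurable] = Suc.prems(1)
  have eq: "(\<lambda>i. c * (x(n := t)) i) = (\<lambda>i. c * x i)(n := 0 + c * t)" for x t
    by (auto simp: fun_eq_iff)
  have "(\<integral>\<^sup>+x. f x \<partial>leb (Suc n)) = (\<integral>\<^sup>+x. \<integral>\<^sup>+t. f (x(n := t)) \<partial>lborel \<partial>leb n)"
    by (simp add: nn_integral_leb_Suc)
  also have "\<dots> = ennreal (c ^ n) * (\<integral>\<^sup>+x. \<integral>\<^sup>+t. f ((\<lambda>i. c * x i)(n := t)) \<partial>lborel \<partial>leb n)"
    by (rule Suc.IH) measurable
  also have "(\<integral>\<^sup>+x. \<integral>\<^sup>+t. f ((\<lambda>i. c * x i)(n := t)) \<partial>lborel \<partial>leb n) =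
      (\<integral>\<^sup>+x. ennreal c * (\<integral>\<^sup>+t. f ((\<lambda>i. c * x i)(n := 0 + c * t)) \<partial>lborel) \<partial>leb n)"
    by (intro nn_integral_cong, subst nn_integral_real_affine[where c=c and t=0]) (use c in auto)
  also have "\<dots> = ennreal c * (\<integral>\<^sup>+x. (\<integral>\<^sup>+t. f (\<lambda>i. c * (x(n := t)) i) \<partial>lborel) \<partial>leb n)"
    unfolding eq by (rule nn_integral_cmult) measurable
  also have "(\<integral>\<^sup>+x. (\<integral>\<^sup>+t. f (\<lambda>i. c * (x(n := t)) i) \<partial>lborel) \<partial>leb n) = (\<integral>\<^sup>+x. f (\<lambda>i. c * x i) \<partial>leb (Suc n))"
    by (subst nn_integral_leb_Suc) auto
  finally show ?case
    using c by (simp add: ennreal_mult mult_ac)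
qed

lemma sigma_finite_leb: "sigma_finite_measure (leb n)"
proof
  define A where "A k = {x::rvec. \<forall>i<n. \<bar>x i\<bar> \<le> real k}" for k :: nat
  have [measurable]: "A k \<in> sets borel" for k
  proof -
    have "A k = {x\<in>space borel. \<forall>i\<in>{..<n}. \<bar>x i\<bar> \<le> real k}" by (auto simp: A_def)
    also have "\<dots> \<in> sets borel" by measurable
    finally show ?thesis .
  qed
  have fin: "emeasure (leb n) (A k) < \<infinity>" for k
  proof -
    have "emeasure (leb n) (A k) = (\<integral>\<^sup>+x. (\<Prod>i<n. indicator {- real k..real k} (x i)) \<partial>leb n)"
      unfolding prod_indicator
    proof (subst nn_integral_indicator[symmetric])
      show "integral\<^sup>N (leb n) (indicator (A k)) =
          (\<integral>\<^sup>+x. indicator {x. \<forall>i<n. x i \<in> {- real k..real k}} x \<partial>leb n)"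
        by (rule nn_integral_cong) (auto simp: A_def indicator_def abs_le_iff minus_le_iff)
    qed simp
    also have "\<dots> = (\<Prod>i<n. ennreal (2 * real k))"
      by (subst nn_integral_leb_prod) auto
    also have "\<dots> = ennreal ((2 * real k) ^ n)" by (simp add: ennreal_power)
    finally show ?thesis by simp
  qed
  have cov: "x \<in> (\<Union>k. A k)" for x
  proof -
    obtain k where "(\<Sum>i<n. \<bar>x i\<bar>) \<le> real k" using real_arch_simple by blast
    moreover have "\<bar>x i\<bar> \<le> (\<Sum>i<n. \<bar>x i\<bar>)" if "i < n" for i
      by (rule member_le_sum) (use that in auto)
    ultimately show ?thesis unfolding A_def using order_trans by blast
  qed
  show "\<exists>B. countable B \<and> B \<subseteq> sets (leb n) \<and> \<Union>B = space (leb n) \<and> (\<forall>a\<in>B. emeasure (leb n) a \<noteq> \<infinity>)"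
    using fin cov by (intro exI[of _ "range A"]) (auto simp: less_top)
qed

interpretation leb: sigma_finite_measure "leb n" for n by (rule sigma_finite_leb)

lemma vol_cbox:
  assumes "\<And>i. i < n \<Longrightarrow> r i \<ge> 0"
  shows "emeasure (leb n) {x\<in>Rn n. \<forall>i<n. \<bar>x i\<bar> \<le> r i} = ennreal (\<Prod>i<n. 2 * r i)"
proof -
  have "emeasure (leb n) {x\<in>Rn n. \<forall>i<n. \<bar>x i\<bar> \<le> r i} =
      (\<integral>\<^sup>+x. indicator {x\<in>Rn n. \<forall>i<n. \<bar>x i\<bar> \<le> r i} x \<partial>leb n)"
  proof (subst nn_integral_indicator)
    have "{x\<in>Rn n. \<forall>i<n. \<bar>x i\<bar> \<le> r i} = Rn n \<inter> {x\<in>space borel. \<forall>i\<in>{..<n}. \<bar>x i\<bar> \<le> r i}" by auto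
    also have "\<dots> \<in> sets borel" by measurable
    finally show "{x\<in>Rn n. \<forall>i<n. \<bar>x i\<bar> \<le> r i} \<in> sets (leb n)" by simp
  qed simp
  also have "\<dots> = (\<integral>\<^sup>+x. (\<Prod>i<n. indicator {- r i..r i} (x i)) \<partial>leb n)"
    unfolding prod_indicator
    by (rule nn_integral_cong_AE, rule AE_mp[OF AE_leb_Rn], rule AE_I2)
       (auto simp: indicator_def abs_le_iff minus_le_iff)
  also have "\<dots> = (\<Prod>i<n. ennreal (2 * r i))"
    by (subst nn_integral_leb_prod) (auto intro!: prod.cong simp: assms)
  also have "\<dots> = ennreal (\<Prod>i<n. 2 * r i)"
    by (rule prod_ennreal) (use assms in auto)
  finally show ?thesis .
qed

subsection \<open>Orthogonal matrices\<close>

abbreviation (input) mtr :: "rmat \<Rightarrow> rmat" where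
  "mtr A \<equiv> (\<lambda>i j. A j i)"

lemma orth_columns:
  assumes "U \<in> orth_group n" "j < n" "k < n"
  shows "(\<Sum>i<n. U i j * U i k) = (if j = k then 1 else 0)"
proof -
  have "mat_mult n (mtr U) U = id_mat n"
    by (rule conjunct2[OF CollectD[OF assms(1)[unfolded orth_group_def]]])
  then have "mat_mult n (mtr U) U j k = id_mat n j k" by metis
  then show ?thesis using assms(2,3) by (simp add: mat_mult_def id_mat_def)
qed

lemma orth_zero: "U \<in> orth_group n \<Longrightarrow> \<not> (i < n \<and> j < n) \<Longrightarrow> U i j = 0"
  unfolding orth_group_def by blast

lemma orth_groupI:
  assumes "\<And>i j. \<not> (i < n \<and> j < n) \<Longrightarrow> U i j = 0"
    and "\<And>j k. j < n \<Longrightarrow> k < n \<Longrightarrow> (\<Sum>i<n. U i j * U i k) = (if j = k then 1 else 0)"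
  shows "U \<in> orth_group n"
proof -
  have "mat_mult n (mtr U) U j k = id_mat n j k" for j k
    using assms by (cases "j < n \<and> k < n") (auto simp: mat_mult_def id_mat_def intro!: sum.neutral)
  then have "mat_mult n (mtr U) U = id_mat n" by blast
  then show ?thesis using assms(1) unfolding orth_group_def by blast
qed

lemma ip_adjoint: "ip n (mat_act n A x) y = ip n x (mat_act n (mtr A) y)"
  unfolding ip_def mat_act_def sum_distrib_left sum_distrib_right
  by (subst sum.swap) (simp add: mult_ac)

lemma ip_nonneg: "0 \<le> ip n x x"
  by (auto simp: ip_def intro: sum_nonneg)

lemma mat_act_orth_Rn: "U \<in> orth_group n \<Longrightarrow> mat_act n U x \<in> Rn n"
  by (auto simp: Rn_iff mat_act_def orth_zero)

lemma mat_act_transp_cancel: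
  assumes U: "U \<in> orth_group n" and x: "x \<in> Rn n"
  shows "mat_act n (mtr U) (mat_act n U x) = x"
proof
  fix j
  have "mat_act n (mtr U) (mat_act n U x) j = (\<Sum>k<n. (\<Sum>i<n. U i j * U i k) * x k)"
    unfolding mat_act_def sum_distrib_left sum_distrib_right
    by (subst sum.swap) (simp add: mult_ac)
  also have "\<dots> = (if j < n then x j else 0)"
  proof (cases "j < n")
    case True
    have "(\<Sum>k<n. (\<Sum>i<n. U i j * U i k) * x k) = (\<Sum>k<n. if j = k then x k else 0)"
      by (rule sum.cong) (use True orth_columns[OF U] in auto)
    then show ?thesis using True by simp
  qed (simp add: orth_zero[OF U])
  also have "\<dots> = x j" using x by (simp add: Rn_iff)
  finally show "mat_act n (mtr U) (mat_act n U x) j = x j" .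
qed

lemma ip_mat_act_orth:
  assumes U: "U \<in> orth_group n"
  shows "ip n (mat_act n U x) (mat_act n U y) = ip n x y"
proof -
  \<comment> \<open>Here \<open>x\<close> and \<open>y\<close> may be nonzero beyond
    \<open>n\<close>. Neither side sees those coordinates, so truncation brings the vectors into
    \<open>Rn n\<close>, where the cancellation law applies.\<close>
  have act: "mat_act n U (zero_ext n x) = mat_act n U x" for x
    by (auto simp: mat_act_def zero_ext_def fun_eq_iff)
  have ip: "ip n (zero_ext n x) (zero_ext n y) = ip n x y"
    by (simp add: ip_def zero_ext_def)
  have "ip n (mat_act n U (zero_ext n x)) (mat_act n U (zero_ext n y)) = ip n (zero_ext n x) (zero_ext n y)"
    by (simp add: ip_adjoint mat_act_transp_cancel[OF U] Rn_iff zero_ext_def)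
  then show ?thesis by (simp only: act ip)
qed

text \<open>
  That a left inverse is a right inverse follows from the trace: \<open>P = U U\<^sup>T\<close> satisfies
  \<open>P\<^sup>2 = P\<close>, so its diagonal entries are at most 1, and its trace is the trace \<open>n\<close> of \<open>U\<^sup>T U\<close>.
\<close>

lemma transp_orth:
  assumes U: "U \<in> orth_group n"
  shows "mtr U \<in> orth_group n"
proof (rule orth_groupI)
  define c where "c i k = (\<Sum>j<n. U i j * U k j)" for i k
  have sq: "(\<Sum>k<n. (c k i)\<^sup>2) = c i i" if "i < n" for i
  proof -
    \<comment> \<open>Row \<open>i\<close> of \<open>U\<close>, seen as a vector, has squared norm
      \<open>c i i\<close>, and \<open>U\<close> maps it to column \<open>i\<close> of
      \<open>c\<close>.\<close>
    have "ip n (mat_act n U (U i)) (mat_act n U (U i)) = ip n (U i) (U i)"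
      by (rule ip_mat_act_orth[OF U])
    then show ?thesis by (simp add: ip_def mat_act_def c_def power2_eq_square)
  qed
  have le1: "c i i \<le> 1" if "i < n" for i
  proof -
    have "(c i i)\<^sup>2 \<le> (\<Sum>k<n. (c k i)\<^sup>2)" by (rule member_le_sum) (use that in auto)
    then have "c i i * c i i \<le> c i i * 1" using sq[OF that] by (simp add: power2_eq_square)
    moreover have "c i i \<ge> 0" by (auto simp: c_def intro: sum_nonneg)
    ultimately show ?thesis using mult_le_cancel_left_pos[of "c i i" "c i i" 1] by (cases "c i i = 0") auto
  qed
  have "(\<Sum>i<n. c i i) = (\<Sum>j<n. \<Sum>i<n. U i j * U i j)"
    unfolding c_def by (rule sum.swap)
  also have "\<dots> = (\<Sum>j<n. 1)" by (rule sum.cong) (auto simp: orth_columns[OF U])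
  finally have tr: "(\<Sum>i<n. 1 - c i i) = 0" by (simp add: sum_subtractf)
  have diag: "c i i = 1" if "i < n" for i
    using sum_nonneg_0[OF _ _ tr, of i] le1 that by auto
  fix j k assume jk: "j < n" "k < n"
  show "(\<Sum>i<n. U j i * U k i) = (if j = k then 1 else 0)"
  proof (cases "j = k")
    case False
    \<comment> \<open>The diagonal entry \<open>c k k = 1\<close> exhausts the sum of squares of
      column \<open>k\<close>, so the entry \<open>c j k\<close> vanishes.\<close>
    have "(\<Sum>i\<in>{j, k}. (c i k)\<^sup>2) \<le> (\<Sum>i<n. (c i k)\<^sup>2)"
      by (rule sum_mono2) (use jk in auto)
    then have "(c j k)\<^sup>2 \<le> 0" using sq[OF jk(2)] diag[OF jk(2)] False by simp
    then show ?thesis using False by (simp add: c_def)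
  qed (use diag[OF jk(1)] in \<open>simp add: c_def\<close>)
qed (use orth_zero[OF U] in auto)

lemma mat_act_cancel_transp:
  "U \<in> orth_group n \<Longrightarrow> x \<in> Rn n \<Longrightarrow> mat_act n U (mat_act n (mtr U) x) = x"
  using mat_act_transp_cancel[OF transp_orth] by simp

lemma mat_act_image_iff:
  assumes U: "U \<in> orth_group n" and K: "K \<subseteq> Rn n"
  shows "x \<in> mat_act n U ` K \<longleftrightarrow> x \<in> Rn n \<and> mat_act n (mtr U) x \<in> K"
proof safe
  fix y assume "y \<in> K"
  then show "mat_act n (mtr U) (mat_act n U y) \<in> K"
    using mat_act_transp_cancel[OF U] K by auto
qed (use mat_act_orth_Rn[OF U] mat_act_cancel_transp[OF U] in \<open>auto intro: rev_image_eqI\<close>)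

lemma mat_act_mat_mult: "mat_act n (mat_mult n A B) x = mat_act n A (mat_act n B x)"
  unfolding mat_act_def mat_mult_def sum_distrib_left sum_distrib_right
  by (rule ext, subst sum.swap) (simp add: mult_ac)

lemma transp_mat_mult: "mtr (mat_mult n A B) = mat_mult n (mtr B) (mtr A)"
  by (simp add: mat_mult_def mult.commute)

lemma mat_act_id: "x \<in> Rn n \<Longrightarrow> mat_act n (id_mat n) x = x"
proof
  fix i assume "x \<in> Rn n"
  moreover have "mat_act n (id_mat n) x i = (\<Sum>j<n. if i = j then (if i < n then x j else 0) else 0)"
    unfolding mat_act_def by (rule sum.cong) (auto simp: id_mat_def)
  ultimately show "mat_act n (id_mat n) x i = x i" by (auto simp: Rn_iff)
qed

lemma id_mat_orth: "id_mat n \<in> orth_group n"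
proof (rule orth_groupI)
  fix j k assume "j < n" "k < n"
  have "(\<Sum>i<n. id_mat n i j * id_mat n i k) = (\<Sum>i<n. if i = j then (if j = k then 1 else 0) else 0)"
    by (rule sum.cong) (auto simp: id_mat_def)
  then show "(\<Sum>i<n. id_mat n i j * id_mat n i k) = (if j = k then 1 else 0)"
    using \<open>j < n\<close> by simp
qed (auto simp: id_mat_def)

section \<open>Gaussian integrals and rotation invariance of Lebesgue measure\<close>

lemma nn_integral_gauss:
  assumes "a > 0"
  shows "(\<integral>\<^sup>+t. ennreal (exp (- a * t\<^sup>2)) \<partial>lborel) = ennreal (sqrt (pi / a))"
proof -
  define \<sigma> where "\<sigma> = sqrt (1 / (2 * a))"
  have \<sigma>: "\<sigma> > 0" "\<sigma>\<^sup>2 = 1 / (2 * a)" using assms by (auto simp: \<sigma>_def)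
  have eq: "exp (- a * t\<^sup>2) = sqrt (pi / a) * normal_density 0 \<sigma> t" for t
    using assms by (simp add: normal_density_def \<sigma>(2))
  have "(\<integral>\<^sup>+t. ennreal (exp (- a * t\<^sup>2)) \<partial>lborel) =
      (\<integral>\<^sup>+t. ennreal (sqrt (pi / a)) * ennreal (normal_density 0 \<sigma> t) \<partial>lborel)"
    unfolding eq using assms by (simp add: ennreal_mult)
  also have "\<dots> = ennreal (sqrt (pi / a)) * (\<integral>\<^sup>+t. ennreal (normal_density 0 \<sigma> t) \<partial>lborel)"
    by (rule nn_integral_cmult) simp
  also have "(\<integral>\<^sup>+t. ennreal (normal_density 0 \<sigma> t) \<partial>lborel) = 1"
    using \<sigma> by (subst nn_integral_eq_integral) auto
  finally show ?thesis by simp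
qed

lemma exp_ip_prod: "ennreal (exp (- a * ip n x x)) = (\<Prod>i<n. ennreal (exp (- a * (x i)\<^sup>2)))"
  by (simp add: prod_ennreal ip_def sum_distrib_left exp_sum sum_negf[symmetric] power2_eq_square)

lemma nn_integral_leb_gauss:
  assumes "a > 0"
  shows "(\<integral>\<^sup>+x. ennreal (exp (- a * ip n x x)) \<partial>leb n) = ennreal (sqrt (pi / a) ^ n)"
proof -
  have "(\<integral>\<^sup>+x. ennreal (exp (- a * ip n x x)) \<partial>leb n) = (\<Prod>i<n. ennreal (sqrt (pi / a)))"
    unfolding exp_ip_prod
    by (subst nn_integral_leb_prod) (auto simp: nn_integral_gauss[OF assms, simplified])
  then show ?thesis using assms by (simp add: ennreal_power)
qed

lemma mat_act_add: "mat_act n A (\<lambda>i. x i + y i) = (\<lambda>i. mat_act n A x i + mat_act n A y i)"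
  and mat_act_diff: "mat_act n A (\<lambda>i. x i - y i) = (\<lambda>i. mat_act n A x i - mat_act n A y i)"
  and mat_act_scale: "mat_act n A (\<lambda>i. c * x i) = (\<lambda>i. c * mat_act n A x i)"
  by (simp_all add: mat_act_def algebra_simps sum.distrib sum_subtractf sum_distrib_left)

text \<open>
  The image of Lebesgue measure under \<open>U\<close> is invariant under translations, hence a multiple of
  Lebesgue measure; testing against a Gaussian shows that the factor is 1. The multiple is
  identified by integrating \<open>f (U x + y) g y\<close> in both orders.
\<close>

lemma nn_integral_leb_orth:
  assumes [measurable]: "f \<in> borel_measurable borel" and U: "U \<in> orth_group n"
  shows "(\<integral>\<^sup>+x. f (mat_act n U x) \<partial>leb n) = (\<integral>\<^sup>+x. f x \<partial>leb n)"
proof -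
  let ?T = "mtr U"
  define g where "g x = ennreal (exp (- 1 * ip n x x))" for x
  have [measurable]: "g \<in> borel_measurable borel" unfolding g_def by measurable
  have pair[measurable]: "fst \<in> measurable (leb n \<Otimes>\<^sub>M leb n) borel" "snd \<in> measurable (leb n \<Otimes>\<^sub>M leb n) borel"
    using measurable_fst[of "leb n" "leb n"] measurable_snd[of "leb n" "leb n"]
    by (simp_all add: measurable_cong_sets[OF refl sets_leb])
  interpret P: pair_sigma_finite "leb n" "leb n" by standard
  define G where "G = (\<integral>\<^sup>+x. g x \<partial>leb n)"
  have G: "G = ennreal (sqrt pi ^ n)" unfolding G_def g_def by (subst nn_integral_leb_gauss) auto
  have "(\<integral>\<^sup>+x. f (mat_act n U x) \<partial>leb n) * G = (\<integral>\<^sup>+y. g y * (\<integral>\<^sup>+x. f (mat_act n U x) \<partial>leb n) \<partial>leb n)"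
    unfolding G_def by (subst nn_integral_multc) (auto simp: mult.commute)
  also have "\<dots> = (\<integral>\<^sup>+y. g y * (\<integral>\<^sup>+x. f (\<lambda>i. mat_act n U x i + y i) \<partial>leb n) \<partial>leb n)"
  proof (rule nn_integral_cong_AE, rule AE_mp[OF AE_leb_Rn], rule AE_I2, rule impI)
    fix y assume y: "y \<in> Rn n"
    have "(\<integral>\<^sup>+x. f (\<lambda>i. mat_act n U x i + y i) \<partial>leb n) =
        (\<integral>\<^sup>+x. f (mat_act n U (\<lambda>i. x i + mat_act n ?T y i)) \<partial>leb n)"
      by (simp add: mat_act_add mat_act_cancel_transp[OF U y])
    also have "\<dots> = (\<integral>\<^sup>+x. f (mat_act n U x) \<partial>leb n)"
      by (rule nn_integral_leb_translate[OF _ mat_act_orth_Rn[OF transp_orth[OF U]]]) measurable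
    finally show "g y * (\<integral>\<^sup>+x. f (mat_act n U x) \<partial>leb n) = g y * (\<integral>\<^sup>+x. f (\<lambda>i. mat_act n U x i + y i) \<partial>leb n)"
      by simp
  qed
  also have "\<dots> = (\<integral>\<^sup>+y. \<integral>\<^sup>+x. g y * f (\<lambda>i. mat_act n U x i + y i) \<partial>leb n \<partial>leb n)"
    by (intro nn_integral_cong nn_integral_cmult[symmetric]) measurable
  also have "\<dots> = (\<integral>\<^sup>+x. \<integral>\<^sup>+y. g y * f (\<lambda>i. mat_act n U x i + y i) \<partial>leb n \<partial>leb n)"
    by (rule P.Fubini'[symmetric]) (simp add: split_beta', measurable)
  also have "\<dots> = (\<integral>\<^sup>+x. \<integral>\<^sup>+y. g (\<lambda>i. y i - mat_act n U x i) * f y \<partial>leb n \<partial>leb n)"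
  proof (rule nn_integral_cong)
    fix x
    show "(\<integral>\<^sup>+y. g y * f (\<lambda>i. mat_act n U x i + y i) \<partial>leb n) =
        (\<integral>\<^sup>+y. g (\<lambda>i. y i - mat_act n U x i) * f y \<partial>leb n)"
      using nn_integral_leb_translate[OF _ mat_act_orth_Rn[OF U],
          of "\<lambda>y. g (\<lambda>i. y i - mat_act n U x i) * f y" x] by (simp add: add.commute)
  qed
  also have "\<dots> = (\<integral>\<^sup>+y. \<integral>\<^sup>+x. g (\<lambda>i. y i - mat_act n U x i) * f y \<partial>leb n \<partial>leb n)"
    by (rule P.Fubini') (simp add: split_beta', measurable)
  also have "\<dots> = (\<integral>\<^sup>+y. f y * G \<partial>leb n)"
  proof (rule nn_integral_cong_AE, rule AE_mp[OF AE_leb_Rn], rule AE_I2, rule impI)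
    fix y assume y: "y \<in> Rn n"
    let ?z = "\<lambda>i. - mat_act n ?T y i"
    \<comment> \<open>Rotation invariance of \<open>g\<close> removes \<open>U\<close>, and evenness
      of \<open>g\<close> then turns the integrand into a translate of \<open>g\<close>, whose
      integral is \<open>G\<close>.\<close>
    have "g (\<lambda>i. y i - mat_act n U x i) = g (\<lambda>i. x i + ?z i)" for x
    proof -
      have "(\<lambda>i. y i - mat_act n U x i) = mat_act n U (\<lambda>i. mat_act n ?T y i - x i)"
        by (simp add: mat_act_diff mat_act_cancel_transp[OF U y])
      then have "g (\<lambda>i. y i - mat_act n U x i) = g (\<lambda>i. mat_act n ?T y i - x i)"
        by (simp add: g_def ip_mat_act_orth[OF U])
      also have "\<dots> = g (\<lambda>i. x i + ?z i)"
        by (simp add: g_def ip_def algebra_simps)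
      finally show ?thesis .
    qed
    then have "(\<integral>\<^sup>+x. g (\<lambda>i. y i - mat_act n U x i) * f y \<partial>leb n) = (\<integral>\<^sup>+x. g (\<lambda>i. x i + ?z i) \<partial>leb n) * f y"
      by (simp add: nn_integral_multc)
    also have "(\<integral>\<^sup>+x. g (\<lambda>i. x i + ?z i) \<partial>leb n) = G"
      unfolding G_def
      by (rule nn_integral_leb_translate) (use mat_act_orth_Rn[OF transp_orth[OF U], of y] in \<open>auto simp: Rn_iff\<close>)
    finally show "(\<integral>\<^sup>+x. g (\<lambda>i. y i - mat_act n U x i) * f y \<partial>leb n) = f y * G" by (simp add: mult.commute)
  qed
  also have "\<dots> = (\<integral>\<^sup>+x. f x \<partial>leb n) * G"
    by (rule nn_integral_multc) measurable
  finally show ?thesis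
    using G by (subst (asm) (1 2) mult.commute) (simp add: ennreal_mult_cancel_left)
qed

text \<open>The witness is the Householder reflection \<open>I - 2 w w^T / |w|^2\<close> with
  \<open>w = x - y\<close>. Equality of the norms means \<open>2 <w, x> = |w|^2\<close>, hence
  \<open>x\<close> goes to \<open>x - w = y\<close>.\<close>

lemma orth_transitive:
  assumes x: "x \<in> Rn n" and y: "y \<in> Rn n" and eq: "ip n x x = ip n y y"
  shows "\<exists>A\<in>orth_group n. mat_act n A x = y"
proof (cases "x = y")
  case True
  then show ?thesis using id_mat_orth mat_act_id[OF x] by blast
next
  case False
  define w where "w i = x i - y i" for i
  define N where "N = ip n w w"
  have w: "w i = 0" if "i \<ge> n" for i using x y that by (simp add: w_def Rn_iff)
  have N: "N > 0"
  proof -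
    obtain i where i: "x i \<noteq> y i" using False by auto
    then have "i < n" using w[of i] by (cases "i < n") (auto simp: w_def)
    then have "(w i)\<^sup>2 \<le> N" unfolding N_def ip_def power2_eq_square
      by (intro member_le_sum) auto
    moreover have "(w i)\<^sup>2 > 0" using i by (simp add: w_def)
    ultimately show ?thesis by linarith
  qed
  define A where "A i j = id_mat n i j - 2 * w i * w j / N" for i j
  have sum_id: "(\<Sum>i<n. id_mat n i j * f i) = (if j < n then f j else 0)" for j and f :: "nat \<Rightarrow> real"
  proof -
    have "(\<Sum>i<n. id_mat n i j * f i) = (\<Sum>i<n. if i = j then f i else 0)"
      by (rule sum.cong) (auto simp: id_mat_def)
    then show ?thesis by auto
  qed
  have id_sym: "id_mat n i j = id_mat n j i" for i j by (auto simp: id_mat_def)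
  have "A \<in> orth_group n"
  proof (rule orth_groupI)
    fix j k assume jk: "j < n" "k < n"
    have "(\<Sum>i<n. A i j * A i k) = (\<Sum>i<n. id_mat n i j * id_mat n i k) - 2 * w k / N * (\<Sum>i<n. id_mat n i j * w i)
        - 2 * w j / N * (\<Sum>i<n. id_mat n i k * w i) + 4 * w j * w k / (N * N) * (\<Sum>i<n. w i * w i)"
      by (simp add: A_def algebra_simps sum.distrib sum_subtractf sum_distrib_left sum_divide_distrib)
    also have "(\<Sum>i<n. w i * w i) = N" by (simp add: N_def ip_def)
    finally show "(\<Sum>i<n. A i j * A i k) = (if j = k then 1 else 0)"
      using jk N by (simp add: sum_id) (simp add: id_mat_def field_simps)
  qed (auto simp: A_def id_mat_def w)
  moreover have "mat_act n A x = y"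
  proof
    fix i
    have wx: "2 * ip n w x = N"
      using eq unfolding N_def ip_def w_def
      by (simp add: algebra_simps sum.distrib sum_subtractf sum_distrib_left)
    have "mat_act n A x i = (\<Sum>j<n. id_mat n j i * x j) - w i / N * (2 * ip n w x)"
      by (simp add: mat_act_def A_def ip_def id_sym[of i] algebra_simps sum.distrib sum_subtractf sum_distrib_left)
    also have "\<dots> = (if i < n then x i else 0) - w i" unfolding wx sum_id using N by simp
    also have "\<dots> = y i" using x y by (auto simp: w_def Rn_iff)
    finally show "mat_act n A x i = y i" .
  qed
  ultimately show ?thesis by blast
qed

subsection \<open>Prekopa-Leindler for even decreasing functions\<close>

text \<open>Layer-cake formula by Tonelli on the region under the graph. Levels are restricted to
  (0, 1), where functions with value 1 at the origin have level sets containing 0, as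
  \<open>emeasure_sum_le_midpoint\<close> requires.\<close>

lemma nn_integral_layers:
  fixes F :: "real \<Rightarrow> real"
  assumes [measurable]: "F \<in> borel_measurable borel" and F: "\<And>t. 0 \<le> F t" "\<And>t. F t \<le> 1"
  shows "(\<integral>\<^sup>+t. ennreal (F t) \<partial>lborel) =
    (\<integral>\<^sup>+\<sigma>. indicator {0<..<1} \<sigma> * emeasure lborel {t. F t > \<sigma>} \<partial>lborel)"
proof -
  have ind: "indicator {0<..<F t} \<sigma> = indicator {0<..<1} \<sigma> * (indicator {t. F t > \<sigma>} t :: ennreal)" for t \<sigma>
    using F(2)[of t] by (auto simp: indicator_def)
  have "(\<integral>\<^sup>+t. ennreal (F t) \<partial>lborel) = (\<integral>\<^sup>+t. (\<integral>\<^sup>+\<sigma>. indicator {0<..<F t} \<sigma> \<partial>lborel) \<partial>lborel)"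
    using F(1) by simp
  also have "\<dots> = (\<integral>\<^sup>+t. (\<integral>\<^sup>+\<sigma>. indicator {0<..<1} \<sigma> * (if F t > \<sigma> then 1 else 0) \<partial>lborel) \<partial>lborel)"
    unfolding ind by (intro nn_integral_cong) (simp add: indicator_def)
  also have "\<dots> = (\<integral>\<^sup>+\<sigma>. (\<integral>\<^sup>+t. indicator {0<..<1} \<sigma> * (if F t > \<sigma> then 1 else 0) \<partial>lborel) \<partial>lborel)"
    by (rule lborel_pair.Fubini'[symmetric]) measurable
  also have "\<dots> = (\<integral>\<^sup>+\<sigma>. indicator {0<..<1} \<sigma> * (\<integral>\<^sup>+t. (if F t > \<sigma> then 1 else 0) \<partial>lborel) \<partial>lborel)"
    by (intro nn_integral_cong nn_integral_cmult) measurable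
  also have "\<dots> = (\<integral>\<^sup>+\<sigma>. indicator {0<..<1} \<sigma> * emeasure lborel {t. F t > \<sigma>} \<partial>lborel)"
  proof (rule nn_integral_cong)
    fix \<sigma>
    have "(\<integral>\<^sup>+t. (if F t > \<sigma> then 1 else 0) \<partial>lborel) = (\<integral>\<^sup>+t. indicator {t. F t > \<sigma>} t \<partial>lborel)"
      by (rule nn_integral_cong) (simp add: indicator_def)
    also have "\<dots> = emeasure lborel {t. F t > \<sigma>}" by (rule nn_integral_indicator) measurable
    finally show "indicator {0<..<1} \<sigma> * (\<integral>\<^sup>+t. (if F t > \<sigma> then 1 else 0) \<partial>lborel) =
      indicator {0<..<1} \<sigma> * emeasure lborel {t. F t > \<sigma>}" by simp
  qed
  finally show ?thesis .
qed

text \<open>A one-dimensional Brunn-Minkowski inequality. Each pair \<open>s\<close>,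
  \<open>t\<close> places an interval of length |s| + |t| inside \<open>C\<close>, so |s| + |t| is
  at most the measure \<open>c\<close> of \<open>C\<close>. With \<alpha> the supremum of |s|, the
  set \<open>A\<close> lies in an interval of length 2 \<alpha> and \<open>B\<close> in one of
  length 2 (c - \<alpha>).\<close>

lemma emeasure_sum_le_midpoint:
  fixes A B C :: "real set"
  assumes A: "0 \<in> A" and B: "0 \<in> B" and [measurable]: "C \<in> sets borel"
    and C: "\<And>s t u. s \<in> A \<Longrightarrow> t \<in> B \<Longrightarrow> 2 * \<bar>u\<bar> \<le> \<bar>s\<bar> + \<bar>t\<bar> \<Longrightarrow> u \<in> C"
  shows "emeasure lborel A + emeasure lborel B \<le> 2 * emeasure lborel C"
proof (cases "emeasure lborel C = \<infinity>")
  case False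
  then obtain c where c: "c \<ge> 0" "emeasure lborel C = ennreal c"
    by (cases "emeasure lborel C") auto
  have half: "2 * \<bar>u\<bar> \<le> p" if "u \<in> {- (p / 2)..p / 2}" for u p :: real
    using that by (auto simp: abs_if)
  have le: "\<bar>s\<bar> + \<bar>t\<bar> \<le> c" if "s \<in> A" "t \<in> B" for s t
  proof -
    have "{- ((\<bar>s\<bar> + \<bar>t\<bar>) / 2)..(\<bar>s\<bar> + \<bar>t\<bar>) / 2} \<subseteq> C"
      by (intro subsetI C[OF that] half)
    then have "emeasure lborel {- ((\<bar>s\<bar> + \<bar>t\<bar>) / 2)..(\<bar>s\<bar> + \<bar>t\<bar>) / 2} \<le> emeasure lborel C"
      by (rule emeasure_mono) simp
    moreover have "emeasure lborel {- (p / 2)..p / 2} = ennreal p" if "p \<ge> 0" for p :: real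
      using that by simp
    ultimately have "ennreal (\<bar>s\<bar> + \<bar>t\<bar>) \<le> ennreal c" using c by simp
    then show ?thesis using c ennreal_le_iff by blast
  qed
  have sub: "emeasure lborel S \<le> ennreal (2 * r)" if "\<And>s. s \<in> S \<Longrightarrow> \<bar>s\<bar> \<le> r" "0 \<in> S" for S :: "real set" and r
  proof -
    have "S \<subseteq> {- r..r}" using that(1) by (force simp: abs_le_iff)
    then have "emeasure lborel S \<le> emeasure lborel {- r..r}" by (rule emeasure_mono) simp
    moreover have "r \<ge> 0" using that(1)[OF that(2)] by simp
    ultimately show ?thesis by simp
  qed
  define \<alpha> where "\<alpha> = (SUP s\<in>A. \<bar>s\<bar>)"
  have bdd: "bdd_above (abs ` A)" using le[OF _ B] by (intro bdd_aboveI[of _ c]) force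
  have "\<bar>s\<bar> \<le> \<alpha>" if "s \<in> A" for s
    unfolding \<alpha>_def by (rule cSUP_upper[OF that bdd])
  then have "emeasure lborel A \<le> ennreal (2 * \<alpha>)" "\<alpha> \<ge> 0" using sub[of A \<alpha>] A by force+
  moreover have \<alpha>t: "\<alpha> \<le> c - \<bar>t\<bar>" if "t \<in> B" for t
    unfolding \<alpha>_def using A le[OF _ that] by (intro cSUP_least) force+
  then have "emeasure lborel B \<le> ennreal (2 * (c - \<alpha>))"
    by (intro sub[OF _ B]) (smt (verit))
  ultimately have "emeasure lborel A + emeasure lborel B \<le> ennreal (2 * \<alpha>) + ennreal (2 * (c - \<alpha>))"
    by (rule_tac add_mono)
  also have "\<dots> = ennreal (2 * c)"
    using \<open>\<alpha> \<ge> 0\<close> \<alpha>t[OF B] by (subst ennreal_plus[symmetric]) auto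
  finally show ?thesis using c by (simp add: ennreal_mult)
qed (simp add: ennreal_mult_top)

text \<open>Once both maxima are 1, the same level \<sigma> serves \<open>F\<close> and
  \<open>G\<close>: values above \<sigma> at \<open>s\<close> and \<open>t\<close> force
  \<open>H\<close> above \<sigma> at the midpoint. Integrating the level-set inequality gives the
  additive form, from which the product form follows by the inequality of means.\<close>

lemma prekopa_even_normalized:
  fixes F G H :: "real \<Rightarrow> real"
  assumes [measurable]: "F \<in> borel_measurable borel" "G \<in> borel_measurable borel" "H \<in> borel_measurable borel"
    and F: "\<And>t. 0 \<le> F t" "\<And>t. F t \<le> 1" "F 0 = 1" "\<And>t. F \<bar>t\<bar> = F t"
    and G: "\<And>t. 0 \<le> G t" "\<And>t. G t \<le> 1" "G 0 = 1" "\<And>t. G \<bar>t\<bar> = G t"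
    and H: "\<And>t. 0 \<le> H t" "\<And>t. H t \<le> 1" "\<And>t. H \<bar>t\<bar> = H t" "\<And>s t. 0 \<le> s \<Longrightarrow> s \<le> t \<Longrightarrow> H t \<le> H s"
    and mult: "\<And>s t. 0 \<le> s \<Longrightarrow> 0 \<le> t \<Longrightarrow> F s * G t \<le> (H ((s + t) / 2))\<^sup>2"
  shows "(\<integral>\<^sup>+t. ennreal (F t) \<partial>lborel) + (\<integral>\<^sup>+t. ennreal (G t) \<partial>lborel) \<le> 2 * (\<integral>\<^sup>+t. ennreal (H t) \<partial>lborel)"
proof -
  have meas: "(\<lambda>\<sigma>. emeasure lborel {t. f t > \<sigma>}) \<in> borel_measurable borel"
    if [measurable]: "f \<in> borel_measurable borel" for f :: "real \<Rightarrow> real"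
  proof -
    have "{t. f t > \<sigma>} = Pair \<sigma> -` {p\<in>space (borel \<Otimes>\<^sub>M lborel). f (snd p) > fst p}" for \<sigma>
      by (auto simp: space_pair_measure)
    moreover have "(\<lambda>\<sigma>. emeasure lborel (Pair \<sigma> -` {p\<in>space (borel \<Otimes>\<^sub>M lborel). f (snd p) > fst p})) \<in> borel_measurable borel"
      by (rule lborel.measurable_emeasure_Pair) measurable
    ultimately show ?thesis by simp
  qed
  note [measurable] = meas[OF assms(1)] meas[OF assms(2)] meas[OF assms(3)]
  have "(\<integral>\<^sup>+t. ennreal (F t) \<partial>lborel) + (\<integral>\<^sup>+t. ennreal (G t) \<partial>lborel) =
      (\<integral>\<^sup>+\<sigma>. indicator {0<..<1} \<sigma> * emeasure lborel {t. F t > \<sigma>}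
         + indicator {0<..<1} \<sigma> * emeasure lborel {t. G t > \<sigma>} \<partial>lborel)"
    using F G by (simp add: nn_integral_layers nn_integral_add)
  also have "\<dots> \<le> (\<integral>\<^sup>+\<sigma>. 2 * (indicator {0<..<1} \<sigma> * emeasure lborel {t. H t > \<sigma>}) \<partial>lborel)"
  proof (rule nn_integral_mono)
    fix \<sigma> :: real
    have "emeasure lborel {t. F t > \<sigma>} + emeasure lborel {t. G t > \<sigma>} \<le> 2 * emeasure lborel {t. H t > \<sigma>}"
      if \<sigma>: "0 < \<sigma>" "\<sigma> < 1"
    proof (rule emeasure_sum_le_midpoint)
      fix s t u assume st: "s \<in> {t. F t > \<sigma>}" "t \<in> {t. G t > \<sigma>}" "2 * \<bar>u\<bar> \<le> \<bar>s\<bar> + \<bar>t\<bar>"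
      then have "\<sigma> < F \<bar>s\<bar>" "\<sigma> < G \<bar>t\<bar>" by (simp_all add: F(4) G(4))
      then have "\<sigma> * \<sigma> < F \<bar>s\<bar> * G \<bar>t\<bar>" using \<sigma> by (intro mult_strict_mono) auto
      also have "\<dots> \<le> (H ((\<bar>s\<bar> + \<bar>t\<bar>) / 2))\<^sup>2" by (rule mult) auto
      finally have "\<sigma>\<^sup>2 < (H ((\<bar>s\<bar> + \<bar>t\<bar>) / 2))\<^sup>2" by (simp add: power2_eq_square)
      then have "\<sigma> < H ((\<bar>s\<bar> + \<bar>t\<bar>) / 2)" using H(1) by (rule power2_less_imp_less)
      also have "\<dots> \<le> H \<bar>u\<bar>" using st(3) by (intro H(4)) auto
      finally show "u \<in> {t. H t > \<sigma>}" by (simp add: H(3))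
    qed (use \<sigma> F G in auto)
    then show "indicator {0<..<1} \<sigma> * emeasure lborel {t. F t > \<sigma>} + indicator {0<..<1} \<sigma> * emeasure lborel {t. G t > \<sigma>}
        \<le> 2 * (indicator {0<..<1} \<sigma> * emeasure lborel {t. H t > \<sigma>})"
      by (auto simp: indicator_def)
  qed
  also have "\<dots> = 2 * (\<integral>\<^sup>+t. ennreal (H t) \<partial>lborel)"
    using H by (simp add: nn_integral_layers nn_integral_cmult)
  finally show ?thesis .
qed

lemma ennreal_am_gm:
  fixes x y z :: ennreal
  assumes "x + y \<le> 2 * z"
  shows "x * y \<le> z\<^sup>2"
proof (cases "z = \<infinity>")
  case False
  then obtain c where c: "c \<ge> 0" "z = ennreal c" by (cases z) auto
  have "2 * z < \<infinity>" using c by (simp add: ennreal_mult_less_top)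
  then have "x + y < \<infinity>" using assms by (rule le_less_trans[rotated])
  then obtain a b where ab: "a \<ge> 0" "x = ennreal a" "b \<ge> 0" "y = ennreal b"
    by (cases x; cases y) auto
  have "ennreal (a + b) \<le> ennreal (2 * c)" using assms c ab by (simp add: ennreal_mult)
  then have "a + b \<le> 2 * c" using c by simp
  then have "(a + b)\<^sup>2 \<le> (2 * c)\<^sup>2" using ab by (intro power_mono) auto
  moreover have "4 * (a * b) \<le> (a + b)\<^sup>2" using zero_le_power2[of "a - b"] by (simp add: power2_eq_square algebra_simps)
  ultimately have "a * b \<le> c\<^sup>2" by (simp add: power_mult_distrib)
  then show ?thesis using c ab by (simp add: ennreal_mult[symmetric] ennreal_power)
qed (simp add: power2_eq_square ennreal_mult_top)

lemma prekopa_even_bounded: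
  fixes f g h :: "real \<Rightarrow> ennreal"
  assumes [measurable]: "f \<in> borel_measurable borel" "g \<in> borel_measurable borel" "h \<in> borel_measurable borel"
    and f: "f 0 < \<infinity>" "\<And>t. f t \<le> f 0" "\<And>t. f \<bar>t\<bar> = f t"
    and g: "g 0 < \<infinity>" "\<And>t. g t \<le> g 0" "\<And>t. g \<bar>t\<bar> = g t"
    and h: "\<And>t. h \<bar>t\<bar> = h t" "\<And>s t. 0 \<le> s \<Longrightarrow> s \<le> t \<Longrightarrow> h t \<le> h s"
    and mult: "\<And>s t. 0 \<le> s \<Longrightarrow> 0 \<le> t \<Longrightarrow> f s * g t \<le> (h ((s + t) / 2))\<^sup>2"
  shows "(\<integral>\<^sup>+t. f t \<partial>lborel) * (\<integral>\<^sup>+t. g t \<partial>lborel) \<le> (\<integral>\<^sup>+t. h t \<partial>lborel)\<^sup>2"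
proof (cases "f 0 = 0 \<or> g 0 = 0")
  case True
  then have "(\<forall>t. f t = 0) \<or> (\<forall>t. g t = 0)" using f(2) g(2) by (metis le_zero_eq)
  then show ?thesis by auto
next
  case False
  obtain a where a: "a > 0" "f 0 = ennreal a" using False f(1) by (cases "f 0") (auto simp: less_le)
  obtain b where b: "b > 0" "g 0 = ennreal b" using False g(1) by (cases "g 0") (auto simp: less_le)
  define c where "c = sqrt (a * b)"
  have c: "c > 0" "c * c = a * b" using a b by (auto simp: c_def)
  define F where "F t = enn2real (f t) / a" for t
  define G where "G t = enn2real (g t) / b" for t
  \<comment> \<open>Since \<open>F\<close> and \<open>G\<close> are at most 1, the product
    hypothesis asks only for values of \<open>h\<close> up to \<open>c = sqrt (a * b)\<close>.
    Truncation at \<open>c\<close> therefore preserves it and yields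
    \<open>H t \<le> 1\<close>.\<close>
  define H where "H t = enn2real (min (ennreal c) (h t)) / c" for t
  have [measurable]: "F \<in> borel_measurable borel" "G \<in> borel_measurable borel" "H \<in> borel_measurable borel"
    unfolding F_def G_def H_def by measurable
  have fF: "f t = ennreal (a * F t)" for t
    using f(2)[of t] a by (cases "f t") (auto simp: F_def top_unique)
  have gG: "g t = ennreal (b * G t)" for t
    using g(2)[of t] b by (cases "g t") (auto simp: G_def top_unique)
  have hH: "min (ennreal c) (h t) = ennreal (c * H t)" for t
    using c by (cases "h t") (auto simp: H_def min_def)
  have F01: "F t \<ge> 0" "F t \<le> 1" for t
  proof -
    show "F t \<ge> 0" using a by (simp add: F_def)
    have "ennreal (a * F t) \<le> ennreal a" unfolding fF[symmetric] using f(2)[of t] a(2) by simp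
    then show "F t \<le> 1" using a by simp
  qed
  have G01: "G t \<ge> 0" "G t \<le> 1" for t
  proof -
    show "G t \<ge> 0" using b by (simp add: G_def)
    have "ennreal (b * G t) \<le> ennreal b" unfolding gG[symmetric] using g(2)[of t] b(2) by simp
    then show "G t \<le> 1" using b by simp
  qed
  have H01: "H t \<ge> 0" "H t \<le> 1" for t
  proof -
    show "H t \<ge> 0" using c by (simp add: H_def)
    have "ennreal (c * H t) \<le> ennreal c" unfolding hH[symmetric] by simp
    then show "H t \<le> 1" using c by simp
  qed
  have key: "(\<integral>\<^sup>+t. ennreal (F t) \<partial>lborel) + (\<integral>\<^sup>+t. ennreal (G t) \<partial>lborel) \<le> 2 * (\<integral>\<^sup>+t. ennreal (H t) \<partial>lborel)"
  proof (rule prekopa_even_normalized)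
    show "F 0 = 1" "G 0 = 1" using a b by (simp_all add: F_def G_def)
    show "F \<bar>t\<bar> = F t" "G \<bar>t\<bar> = G t" "H \<bar>t\<bar> = H t" for t by (simp_all add: F_def G_def H_def f g h)
    show "H t \<le> H s" if "0 \<le> s" "s \<le> t" for s t
    proof -
      have "ennreal (c * H t) \<le> ennreal (c * H s)"
        unfolding hH[symmetric] using h(2)[OF that] by (rule min.mono[OF order_refl])
      then show ?thesis using c H01 by (simp add: ennreal_le_iff)
    qed
    show "F s * G t \<le> (H ((s + t) / 2))\<^sup>2" if "0 \<le> s" "0 \<le> t" for s t
    proof (cases "h ((s + t) / 2) \<le> ennreal c")
      case True
      then have "h ((s + t) / 2) = ennreal (c * H ((s + t) / 2))"
        by (simp add: hH[symmetric] min_def)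
      then have "ennreal (a * F s) * ennreal (b * G t) \<le> ennreal ((c * H ((s + t) / 2))\<^sup>2)"
        using mult[OF that] H01 c by (simp add: fF gG ennreal_power)
      then have "a * F s * (b * G t) \<le> (c * H ((s + t) / 2))\<^sup>2"
        using a b F01 G01 by (simp add: ennreal_mult[symmetric])
      also have "\<dots> = a * b * (H ((s + t) / 2))\<^sup>2" using c(2) by (simp add: power2_eq_square)
      finally have "(a * b) * (F s * G t) \<le> (a * b) * (H ((s + t) / 2))\<^sup>2" by (simp add: mult_ac)
      then show ?thesis using a b by (simp add: mult_le_cancel_left_pos)
    next
      case False
      then have "ennreal c = ennreal (c * H ((s + t) / 2))" unfolding hH[symmetric] by (simp add: min_absorb1)
      then have "H ((s + t) / 2) = 1" using c H01 by simp
      moreover have "F s * G t \<le> 1" using F01 G01 by (simp add: mult_le_one)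
      ultimately show ?thesis by simp
    qed
  qed (use F01 G01 H01 in auto)
  have "(\<integral>\<^sup>+t. f t \<partial>lborel) * (\<integral>\<^sup>+t. g t \<partial>lborel)
      = ennreal (a * b) * ((\<integral>\<^sup>+t. ennreal (F t) \<partial>lborel) * (\<integral>\<^sup>+t. ennreal (G t) \<partial>lborel))"
    using a b F01 G01 by (simp add: fF gG ennreal_mult nn_integral_cmult mult_ac)
  also have "\<dots> \<le> ennreal (a * b) * (\<integral>\<^sup>+t. ennreal (H t) \<partial>lborel)\<^sup>2"
    by (intro mult_left_mono ennreal_am_gm key) simp
  also have "\<dots> = (\<integral>\<^sup>+t. ennreal (c * H t) \<partial>lborel)\<^sup>2"
    using c(1) H01 by (simp add: c(2)[symmetric] ennreal_mult nn_integral_cmult power2_eq_square mult_ac)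
  also have "\<dots> \<le> (\<integral>\<^sup>+t. h t \<partial>lborel)\<^sup>2"
    by (intro power_mono nn_integral_mono) (auto simp: hH[symmetric])
  finally show ?thesis .
qed

lemma SUP_min_of_nat: "(SUP k. min x (of_nat k)) = (x :: ennreal)"
proof (rule antisym)
  show "x \<le> (SUP k. min x (of_nat k))"
  proof (cases x)
    case (real r)
    obtain k :: nat where "r \<le> real k" using real_arch_simple by blast
    then have "min x (of_nat k) = x" using real by (simp add: min_def ennreal_of_nat_eq_real_of_nat ennreal_leI)
    then show ?thesis by (metis SUP_upper UNIV_I)
  next
    case top
    then show ?thesis by (simp add: ennreal_SUP_of_nat_eq_top)
  qed
qed (auto intro: SUP_least)

lemma prekopa_even_real:
  fixes f g h :: "real \<Rightarrow> ennreal"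
  assumes [measurable]: "f \<in> borel_measurable borel" "g \<in> borel_measurable borel" "h \<in> borel_measurable borel"
    and f: "\<And>t. f t \<le> f 0" "\<And>t. f \<bar>t\<bar> = f t"
    and g: "\<And>t. g t \<le> g 0" "\<And>t. g \<bar>t\<bar> = g t"
    and h: "\<And>t. h \<bar>t\<bar> = h t" "\<And>s t. 0 \<le> s \<Longrightarrow> s \<le> t \<Longrightarrow> h t \<le> h s"
    and mult: "\<And>s t. 0 \<le> s \<Longrightarrow> 0 \<le> t \<Longrightarrow> f s * g t \<le> (h ((s + t) / 2))\<^sup>2"
  shows "(\<integral>\<^sup>+t. f t \<partial>lborel) * (\<integral>\<^sup>+t. g t \<partial>lborel) \<le> (\<integral>\<^sup>+t. h t \<partial>lborel)\<^sup>2"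
proof -
  let ?f = "\<lambda>k t. min (f t) (of_nat k)" and ?g = "\<lambda>k t. min (g t) (of_nat k)"
  have sup: "(\<integral>\<^sup>+t. f t \<partial>lborel) = (SUP k. \<integral>\<^sup>+t. min (f t) (of_nat k) \<partial>lborel)"
    if [measurable]: "f \<in> borel_measurable borel" for f :: "real \<Rightarrow> ennreal"
  proof -
    have "(\<integral>\<^sup>+t. f t \<partial>lborel) = (\<integral>\<^sup>+t. (SUP k. min (f t) (of_nat k)) \<partial>lborel)"
      by (simp add: SUP_min_of_nat)
    also have "\<dots> = (SUP k. \<integral>\<^sup>+t. min (f t) (of_nat k) \<partial>lborel)"
      by (rule nn_integral_monotone_convergence_SUP)
         (auto simp: incseq_def le_fun_def intro: min.coboundedI2)
    finally show ?thesis .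
  qed
  have "(\<integral>\<^sup>+t. ?f k t \<partial>lborel) * (\<integral>\<^sup>+t. ?g j t \<partial>lborel) \<le> (\<integral>\<^sup>+t. h t \<partial>lborel)\<^sup>2" for k j
  proof (rule prekopa_even_bounded)
    show "?f k 0 < \<infinity>" "?g j 0 < \<infinity>" by (auto simp: min_less_iff_disj ennreal_of_nat_eq_real_of_nat)
    show "?f k t \<le> ?f k 0" "?g j t \<le> ?g j 0" for t using f(1)[of t] g(1)[of t] by (intro min.mono; simp)+
    show "?f k s * ?g j t \<le> (h ((s + t) / 2))\<^sup>2" if "0 \<le> s" "0 \<le> t" for s t
      by (rule order_trans[OF mult_mono mult[OF that]]) auto
  qed (use f g h in auto)
  then show ?thesis
    by (simp add: sup[OF assms(1)] sup[OF assms(2)] SUP_mult_right_ennreal SUP_mult_left_ennreal SUP_le_iff)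
qed

text \<open>
  For even functions that decrease in each coordinate, the superlevel sets of the one-dimensional
  marginals are intervals, so the Prekopa-Leindler inequality needs no Brunn-Minkowski inequality
  for general sets.
\<close>

lemma prekopa_even:
  fixes F G H :: "rvec \<Rightarrow> ennreal"
  assumes "F \<in> borel_measurable borel" "G \<in> borel_measurable borel" "H \<in> borel_measurable borel"
    and "\<And>x. F (\<lambda>i. \<bar>x i\<bar>) = F x" "\<And>x. G (\<lambda>i. \<bar>x i\<bar>) = G x" "\<And>x. H (\<lambda>i. \<bar>x i\<bar>) = H x"
    and "\<And>x y. (\<And>i. 0 \<le> x i) \<Longrightarrow> (\<And>i. x i \<le> y i) \<Longrightarrow> F y \<le> F x"
    and "\<And>x y. (\<And>i. 0 \<le> x i) \<Longrightarrow> (\<And>i. x i \<le> y i) \<Longrightarrow> G y \<le> G x"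
    and "\<And>x y. (\<And>i. 0 \<le> x i) \<Longrightarrow> (\<And>i. x i \<le> y i) \<Longrightarrow> H y \<le> H x"
    and "\<And>x y. (\<And>i. 0 \<le> x i) \<Longrightarrow> (\<And>i. 0 \<le> y i) \<Longrightarrow> F x * G y \<le> (H (\<lambda>i. (x i + y i) / 2))\<^sup>2"
  shows "(\<integral>\<^sup>+x. F x \<partial>leb n) * (\<integral>\<^sup>+x. G x \<partial>leb n) \<le> (\<integral>\<^sup>+x. H x \<partial>leb n)\<^sup>2"
  using assms
proof (induction n arbitrary: F G H)
  case 0
  show ?case using 0(10)[of "\<lambda>_. 0" "\<lambda>_. 0"] 0(1-3) by (simp add: nn_integral_leb_0)
next
  case (Suc n)
  note [measurable] = Suc.prems(1-3)
  note even = Suc.prems(4-6) and decr = Suc.prems(7-9) and mult = Suc.prems(10)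
  have upd_abs: "(\<lambda>i. \<bar>(x(n := t)) i\<bar>) = (\<lambda>i. \<bar>x i\<bar>)(n := \<bar>t\<bar>)" for x :: rvec and t by auto
  have even1: "\<Phi> ((\<lambda>i. \<bar>x i\<bar>)(n := \<bar>t\<bar>)) = \<Phi> (x(n := t))"
    if "\<And>x. \<Phi> (\<lambda>i. \<bar>x i\<bar>) = \<Phi> x" for \<Phi> :: "rvec \<Rightarrow> ennreal" and x :: rvec and t
    unfolding upd_abs[symmetric] by (rule that)
  have even2: "\<Phi> (x(n := \<bar>t\<bar>)) = \<Phi> (x(n := t))"
    if *: "\<And>x. \<Phi> (\<lambda>i. \<bar>x i\<bar>) = \<Phi> x" for \<Phi> :: "rvec \<Rightarrow> ennreal" and x :: rvec and t
    using even1[of \<Phi>, OF *, of x t] even1[of \<Phi>, OF *, of x "\<bar>t\<bar>"] by simp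
  have even3: "\<Phi> ((\<lambda>i. \<bar>x i\<bar>)(n := t)) = \<Phi> (x(n := t))"
    if *: "\<And>x. \<Phi> (\<lambda>i. \<bar>x i\<bar>) = \<Phi> x" for \<Phi> :: "rvec \<Rightarrow> ennreal" and x :: rvec and t
    using even1[of \<Phi>, OF *, of x t] even2[of \<Phi>, OF *, of "\<lambda>i. \<bar>x i\<bar>" t] by simp
  have decr0: "\<Phi> (x(n := t)) \<le> \<Phi> (x(n := 0))" if "\<And>x. \<Phi> (\<lambda>i. \<bar>x i\<bar>) = \<Phi> x"
    "\<And>x y. (\<And>i. 0 \<le> x i) \<Longrightarrow> (\<And>i. x i \<le> y i) \<Longrightarrow> \<Phi> y \<le> \<Phi> x" "\<And>i. 0 \<le> x i"
    for \<Phi> :: "rvec \<Rightarrow> ennreal" and x :: rvec and t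
  proof -
    have "\<Phi> (x(n := \<bar>t\<bar>)) \<le> \<Phi> (x(n := 0))" by (rule that(2)) (use that(3) in auto)
    then show ?thesis using even2[of \<Phi>, OF that(1)] by simp
  qed
  have "(\<integral>\<^sup>+x. \<integral>\<^sup>+t. F (x(n := t)) \<partial>lborel \<partial>leb n) * (\<integral>\<^sup>+x. \<integral>\<^sup>+t. G (x(n := t)) \<partial>lborel \<partial>leb n) \<le>
      (\<integral>\<^sup>+x. \<integral>\<^sup>+t. H (x(n := t)) \<partial>lborel \<partial>leb n)\<^sup>2"
  \<comment> \<open>The induction hypothesis is applied to the marginals in the last coordinate:
    their product inequality is \<open>prekopa_even_real\<close> on a line, and evenness and
    monotonicity pass to them by integration.\<close>
  proof (rule Suc.IH)
    fix x y :: rvec assume x: "\<And>i. 0 \<le> x i" and y: "\<And>i. 0 \<le> y i"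
    show "(\<integral>\<^sup>+t. F (x(n := t)) \<partial>lborel) * (\<integral>\<^sup>+t. G (y(n := t)) \<partial>lborel) \<le>
        (\<integral>\<^sup>+t. H ((\<lambda>i. (x i + y i) / 2)(n := t)) \<partial>lborel)\<^sup>2"
    proof (rule prekopa_even_real)
      show "F (x(n := t)) \<le> F (x(n := 0))" "G (y(n := t)) \<le> G (y(n := 0))" for t
        using decr0[of F, OF even(1) decr(1), of x t] decr0[of G, OF even(2) decr(2), of y t] x y by auto
      show "H ((\<lambda>i. (x i + y i) / 2)(n := t)) \<le> H ((\<lambda>i. (x i + y i) / 2)(n := s))" if "0 \<le> s" "s \<le> t" for s t
        by (rule decr(3)) (use that x y in auto)
      show "F (x(n := s)) * G (y(n := t)) \<le> (H ((\<lambda>i. (x i + y i) / 2)(n := (s + t) / 2)))\<^sup>2"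
        if "0 \<le> s" "0 \<le> t" for s t
      proof -
        have "(\<lambda>i. ((x(n := s)) i + (y(n := t)) i) / 2) = (\<lambda>i. (x i + y i) / 2)(n := (s + t) / 2)" by auto
        moreover have "F (x(n := s)) * G (y(n := t)) \<le> (H (\<lambda>i. ((x(n := s)) i + (y(n := t)) i) / 2))\<^sup>2"
          by (rule mult) (use x y that in auto)
        ultimately show ?thesis by simp
      qed
    qed (simp_all add: even2[of F, OF even(1)] even2[of G, OF even(2)] even2[of H, OF even(3)])
  next
    show "(\<integral>\<^sup>+t. F (y(n := t)) \<partial>lborel) \<le> (\<integral>\<^sup>+t. F (x(n := t)) \<partial>lborel)"
      "(\<integral>\<^sup>+t. G (y(n := t)) \<partial>lborel) \<le> (\<integral>\<^sup>+t. G (x(n := t)) \<partial>lborel)"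
      "(\<integral>\<^sup>+t. H (y(n := t)) \<partial>lborel) \<le> (\<integral>\<^sup>+t. H (x(n := t)) \<partial>lborel)"
      if xy: "\<And>i. 0 \<le> x i" "\<And>i. x i \<le> y i" for x y :: rvec
    proof -
      have "\<Phi> (y(n := t)) \<le> \<Phi> (x(n := t))" if "\<And>x. \<Phi> (\<lambda>i. \<bar>x i\<bar>) = \<Phi> x"
        "\<And>x y. (\<And>i. 0 \<le> x i) \<Longrightarrow> (\<And>i. x i \<le> y i) \<Longrightarrow> \<Phi> y \<le> \<Phi> x" for \<Phi> :: "rvec \<Rightarrow> ennreal" and t
      proof -
        have "\<Phi> (y(n := \<bar>t\<bar>)) \<le> \<Phi> (x(n := \<bar>t\<bar>))" by (rule that(2)) (use xy in auto)
        then show ?thesis using even2[of \<Phi>, OF that(1)] by simp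
      qed
      note * = this
      show "(\<integral>\<^sup>+t. F (y(n := t)) \<partial>lborel) \<le> (\<integral>\<^sup>+t. F (x(n := t)) \<partial>lborel)"
        "(\<integral>\<^sup>+t. G (y(n := t)) \<partial>lborel) \<le> (\<integral>\<^sup>+t. G (x(n := t)) \<partial>lborel)"
        "(\<integral>\<^sup>+t. H (y(n := t)) \<partial>lborel) \<le> (\<integral>\<^sup>+t. H (x(n := t)) \<partial>lborel)"
        by (intro nn_integral_mono * even decr; assumption)+
    qed
  next
    show "(\<integral>\<^sup>+t. F ((\<lambda>i. \<bar>x i\<bar>)(n := t)) \<partial>lborel) = (\<integral>\<^sup>+t. F (x(n := t)) \<partial>lborel)"
      "(\<integral>\<^sup>+t. G ((\<lambda>i. \<bar>x i\<bar>)(n := t)) \<partial>lborel) = (\<integral>\<^sup>+t. G (x(n := t)) \<partial>lborel)"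
      "(\<integral>\<^sup>+t. H ((\<lambda>i. \<bar>x i\<bar>)(n := t)) \<partial>lborel) = (\<integral>\<^sup>+t. H (x(n := t)) \<partial>lborel)" for x
      by (simp_all only: even3[of F, OF even(1)] even3[of G, OF even(2)] even3[of H, OF even(3)])
  qed measurable
  then show ?case by (simp add: nn_integral_leb_Suc)
qed

subsection \<open>Unconditional convex bodies\<close>

locale unconditional_convex_body =
  fixes n :: nat and K :: "rvec set"
  assumes body: "convex_body n K" and uncond: "unconditional n K"
begin

lemma subset_Rn: "K \<subseteq> Rn n"
  using body compactin_subset_topspace by (auto simp: convex_body_def)

lemma compact: "compact K"
proof -
  have "compactin (powertop_real UNIV) K"
    using body by (auto simp: convex_body_def Euclidean_space_def compactin_subtopology)
  then show ?thesis by (simp add: euclidean_product_topology)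
qed

lemma closed: "closed K"
  using compact by (rule compact_imp_closed)

lemma sets_K [measurable]: "K \<in> sets borel"
  using closed by (rule borel_closed)

lemma convex: "x \<in> K \<Longrightarrow> y \<in> K \<Longrightarrow> 0 \<le> t \<Longrightarrow> t \<le> 1 \<Longrightarrow> (\<lambda>i. (1 - t) * x i + t * y i) \<in> K"
  using body by (simp add: convex_body_def)

text \<open>The new point lies on the segment from \<open>x\<close> to its mirror image in
  coordinate \<open>j\<close>; the parameter \<open>t\<close> solves
  \<open>(1 - 2 * t) * x j = s\<close>.\<close>

lemma shrink_coordinate:
  assumes x: "x \<in> K" and s: "\<bar>s\<bar> \<le> \<bar>x j\<bar>"
  shows "x(j := s) \<in> K"
proof (cases "x j = 0")
  case True
  then show ?thesis using s x by (metis abs_0 abs_le_zero_iff fun_upd_triv)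
next
  case False
  define \<epsilon> :: rvec where "\<epsilon> i = (if i = j then -1 else 1)" for i
  have flip: "(\<lambda>i. \<epsilon> i * x i) \<in> K"
    using uncond x by (auto simp: unconditional_def \<epsilon>_def)
  define t where "t = (1 - s / x j) / 2"
  have "\<bar>s / x j\<bar> \<le> 1" using s False by (simp add: abs_divide)
  then have "- 1 \<le> s / x j" "s / x j \<le> 1" by (simp_all only: abs_le_iff minus_le_iff)
  then have "0 \<le> t" "t \<le> 1" unfolding t_def by simp_all
  then have "(\<lambda>i. (1 - t) * x i + t * (\<epsilon> i * x i)) \<in> K" by (rule convex[OF x flip])
  moreover have "(\<lambda>i. (1 - t) * x i + t * (\<epsilon> i * x i)) = x(j := s)"
    using False by (auto simp: \<epsilon>_def t_def field_simps)
  ultimately show ?thesis by simp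
qed

lemma solid:
  assumes x: "x \<in> K" and y: "\<And>i. \<bar>y i\<bar> \<le> \<bar>x i\<bar>"
  shows "y \<in> K"
proof -
  have "(\<lambda>i. if i < k then y i else x i) \<in> K" for k
  proof (induction k)
    case (Suc k)
    have "(\<lambda>i. if i < k then y i else x i)(k := y k) \<in> K"
      by (rule shrink_coordinate[OF Suc]) (simp add: y)
    moreover have "(\<lambda>i. if i < k then y i else x i)(k := y k) = (\<lambda>i. if i < Suc k then y i else x i)"
      by auto
    ultimately show ?case by simp
  qed (use x in simp)
  moreover have "(\<lambda>i. if i < n then y i else x i) = y"
  proof
    fix i
    show "(if i < n then y i else x i) = y i"
      using y[of i] subset_Rn x by (auto simp: Rn_iff subset_iff)
  qed
  ultimately show ?thesis by metis
qed

lemma abs_mem_iff: "(\<lambda>i. \<bar>x i\<bar>) \<in> K \<longleftrightarrow> x \<in> K"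
  using solid[of "\<lambda>i. \<bar>x i\<bar>" x] solid[of x "\<lambda>i. \<bar>x i\<bar>"] by auto

lemma bounded_coords: "\<exists>B. \<forall>x\<in>K. \<forall>i. \<bar>x i\<bar> \<le> B"
proof -
  have "\<exists>B. \<forall>x\<in>K. \<bar>x i\<bar> \<le> B" for i
  proof -
    have "continuous_on K (\<lambda>x. x i)" by (intro continuous_on_subset[OF continuous_on_product_coordinates]) auto
    then have "compact ((\<lambda>x. x i) ` K)" using compact by (rule compact_continuous_image)
    then have "bounded ((\<lambda>x. x i) ` K)" by (rule compact_imp_bounded)
    then show ?thesis unfolding bounded_iff real_norm_def by blast
  qed
  then obtain B where B: "\<And>i x. x \<in> K \<Longrightarrow> \<bar>x i\<bar> \<le> B i" by metis
  show ?thesis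
  proof (intro exI ballI allI)
    fix x i assume x: "x \<in> K"
    show "\<bar>x i\<bar> \<le> (\<Sum>i<n. \<bar>B i\<bar>)"
    proof (cases "i < n")
      case True
      have "\<bar>x i\<bar> \<le> \<bar>B i\<bar>" using B[OF x, of i] by simp
      also have "\<dots> \<le> (\<Sum>i<n. \<bar>B i\<bar>)" by (rule member_le_sum) (use True in auto)
      finally show ?thesis .
    next
      case False
      then show ?thesis using subset_Rn x by (auto simp: Rn_iff intro: sum_nonneg)
    qed
  qed
qed

lemma emeasure_finite: "emeasure (leb n) K < \<infinity>"
proof -
  obtain B where B: "\<And>x i. x \<in> K \<Longrightarrow> \<bar>x i\<bar> \<le> B" using bounded_coords by blast
  have "K \<subseteq> {x\<in>Rn n. \<forall>i<n. \<bar>x i\<bar> \<le> \<bar>B\<bar>}"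
    using subset_Rn order_trans[OF B abs_ge_self] by blast
  then have "emeasure (leb n) K \<le> emeasure (leb n) {x\<in>Rn n. \<forall>i<n. \<bar>x i\<bar> \<le> \<bar>B\<bar>}"
  proof (rule emeasure_mono)
    have "{x\<in>Rn n. \<forall>i<n. \<bar>x i\<bar> \<le> \<bar>B\<bar>} = Rn n \<inter> {x\<in>space borel. \<forall>i\<in>{..<n}. \<bar>x i\<bar> \<le> \<bar>B\<bar>}" by auto
    also have "\<dots> \<in> sets borel" by measurable
    finally show "{x\<in>Rn n. \<forall>i<n. \<bar>x i\<bar> \<le> \<bar>B\<bar>} \<in> sets (leb n)" by simp
  qed
  also have "\<dots> < \<infinity>" by (subst vol_cbox) auto
  finally show ?thesis .
qed

lemma vol_eq:
  assumes "S \<subseteq> K"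
  shows "emeasure (leb n) S = ennreal (vol n S)"
proof -
  have "emeasure (leb n) S \<le> emeasure (leb n) K" using assms by (rule emeasure_mono) simp
  then have "emeasure (leb n) S < \<infinity>" using emeasure_finite by (rule le_less_trans)
  then show ?thesis by (intro emeasure_eq_ennreal_measure) auto
qed

text \<open>One inequality is weak and the other strict, to match the cut of space into
  \<open>x j \<ge> 0\<close> and \<open>x j < 0\<close> used for translating; in particular
  \<open>tail j 0 = K\<close>.\<close>

definition tail :: "nat \<Rightarrow> real \<Rightarrow> rvec set" where
  "tail j t = {x\<in>K. x j \<ge> t \<or> x j < - t}"

lemma sets_tail [measurable]: "tail j t \<in> sets borel"
  unfolding tail_def by measurable

text \<open>Cutting along \<open>x j = 0\<close> and pushing the two halves apart by
  \<open>t\<close> preserves volume on each half. The resulting integrand is even and, by solidity,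
  decreasing in every |x i|, as \<open>prekopa_even\<close> demands.\<close>

lemma emeasure_tail:
  assumes j: "j < n" and t: "t \<ge> 0"
  shows "emeasure (leb n) (tail j t) = (\<integral>\<^sup>+x. indicator K (\<lambda>i. \<bar>x i\<bar> + (if i = j then t else 0)) \<partial>leb n)"
proof -
  let ?e = "\<lambda>s i. if i = j then s else (0::real)"
  have eRn: "?e s \<in> Rn n" for s using j by (auto simp: Rn_iff)
  let ?P = "\<lambda>y. indicator K y * indicator {y. y j \<ge> t} y :: ennreal"
  let ?N = "\<lambda>y. indicator K y * indicator {y. y j < - t} y :: ennreal"
  have split: "indicator K (\<lambda>i. \<bar>x i\<bar> + ?e t i) = ?P (\<lambda>i. x i + ?e t i) + ?N (\<lambda>i. x i + ?e (- t) i)" for x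
  proof -
    have "(\<lambda>i. \<bar>x i\<bar> + ?e t i) \<in> K \<longleftrightarrow> (\<lambda>i. x i + ?e (if x j \<ge> 0 then t else - t) i) \<in> K"
    proof -
      have "(\<lambda>i. \<bar>x i\<bar> + ?e t i) = (\<lambda>i. \<bar>x i + ?e (if x j \<ge> 0 then t else - t) i\<bar>)"
        using t by (auto simp: fun_eq_iff)
      then show ?thesis using abs_mem_iff[of "\<lambda>i. x i + ?e (if x j \<ge> 0 then t else - t) i"] by simp
    qed
    then show ?thesis by (auto simp: indicator_def)
  qed
  have "(\<integral>\<^sup>+x. indicator K (\<lambda>i. \<bar>x i\<bar> + ?e t i) \<partial>leb n) =
      (\<integral>\<^sup>+x. ?P (\<lambda>i. x i + ?e t i) \<partial>leb n) + (\<integral>\<^sup>+x. ?N (\<lambda>i. x i + ?e (- t) i) \<partial>leb n)"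
    unfolding split by (rule nn_integral_add) measurable
  also have "(\<integral>\<^sup>+x. ?P (\<lambda>i. x i + ?e t i) \<partial>leb n) = (\<integral>\<^sup>+x. ?P x \<partial>leb n)"
    by (rule nn_integral_leb_translate[OF _ eRn]) measurable
  also have "(\<integral>\<^sup>+x. ?N (\<lambda>i. x i + ?e (- t) i) \<partial>leb n) = (\<integral>\<^sup>+x. ?N x \<partial>leb n)"
    by (rule nn_integral_leb_translate[OF _ eRn]) measurable
  also have "(\<integral>\<^sup>+x. ?P x \<partial>leb n) + (\<integral>\<^sup>+x. ?N x \<partial>leb n) = (\<integral>\<^sup>+x. ?P x + ?N x \<partial>leb n)"
    by (rule nn_integral_add[symmetric]) measurable
  also have "\<dots> = (\<integral>\<^sup>+x. indicator (tail j t) x \<partial>leb n)"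
    by (rule nn_integral_cong) (use t in \<open>auto simp: indicator_def tail_def\<close>)
  finally show ?thesis by (simp add: sets_tail)
qed

text \<open>Log-concavity of the tail at 0, t/2 and t. In Prekopa-Leindler for the shifted
  indicators, the midpoint condition is convexity of \<open>K\<close>: the mean of a point shifted
  by 0 and one shifted by \<open>t\<close> is shifted by t/2.\<close>

lemma tail_decay:
  assumes j: "j < n" and t: "t \<ge> 0"
  shows "vol n K * vol n (tail j t) \<le> (vol n (tail j (t / 2)))\<^sup>2"
proof -
  let ?e = "\<lambda>s i. if i = j then s else (0::real)"
  let ?\<Phi> = "\<lambda>s x. indicator K (\<lambda>i. \<bar>x i\<bar> + ?e s i) :: ennreal"
  have even: "?\<Phi> s (\<lambda>i. \<bar>x i\<bar>) = ?\<Phi> s x" for s x by simp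
  have decr: "?\<Phi> s y \<le> ?\<Phi> s x" if "\<And>i. 0 \<le> x i" "\<And>i. x i \<le> y i" "s \<ge> 0" for s and x y :: rvec
  proof -
    have "(\<lambda>i. \<bar>x i\<bar> + ?e s i) \<in> K" if "(\<lambda>i. \<bar>y i\<bar> + ?e s i) \<in> K"
    proof (rule solid[OF that])
      fix i
      show "\<bar>\<bar>x i\<bar> + ?e s i\<bar> \<le> \<bar>\<bar>y i\<bar> + ?e s i\<bar>"
        using \<open>0 \<le> x i\<close> \<open>x i \<le> y i\<close> \<open>s \<ge> 0\<close> by auto
    qed
    then show ?thesis by (auto simp: indicator_def)
  qed
  have mult: "?\<Phi> 0 x * ?\<Phi> t y \<le> (?\<Phi> (t / 2) (\<lambda>i. (x i + y i) / 2))\<^sup>2" if "\<And>i. 0 \<le> x i" "\<And>i. 0 \<le> y i" for x y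
  proof -
    have "(\<lambda>i. \<bar>(x i + y i) / 2\<bar> + ?e (t / 2) i) \<in> K" if "(\<lambda>i. \<bar>x i\<bar> + ?e 0 i) \<in> K" "(\<lambda>i. \<bar>y i\<bar> + ?e t i) \<in> K"
    proof -
      have "(\<lambda>i. (1 - 1/2) * (\<bar>x i\<bar> + ?e 0 i) + 1/2 * (\<bar>y i\<bar> + ?e t i)) \<in> K"
        using that by (rule convex) auto
      moreover have "(\<lambda>i. (1 - 1/2) * (\<bar>x i\<bar> + ?e 0 i) + 1/2 * (\<bar>y i\<bar> + ?e t i)) = (\<lambda>i. \<bar>(x i + y i) / 2\<bar> + ?e (t / 2) i)"
        using \<open>\<And>i. 0 \<le> x i\<close> \<open>\<And>i. 0 \<le> y i\<close> by (auto simp: fun_eq_iff field_simps)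
      ultimately show ?thesis by simp
    qed
    then show ?thesis by (auto simp: indicator_def)
  qed
  have [measurable]: "?\<Phi> s \<in> borel_measurable borel" for s
  proof -
    have "(\<lambda>x::rvec. \<lambda>i. \<bar>x i\<bar> + ?e s i) \<in> borel \<rightarrow>\<^sub>M borel" by measurable
    from measurable_compose[OF this borel_measurable_indicator[OF sets_K]] show ?thesis .
  qed
  have "(\<integral>\<^sup>+x. ?\<Phi> 0 x \<partial>leb n) * (\<integral>\<^sup>+x. ?\<Phi> t x \<partial>leb n) \<le> (\<integral>\<^sup>+x. ?\<Phi> (t / 2) x \<partial>leb n)\<^sup>2"
  proof (rule prekopa_even)
    fix x :: rvec
    show "?\<Phi> 0 (\<lambda>i. \<bar>x i\<bar>) = ?\<Phi> 0 x" "?\<Phi> t (\<lambda>i. \<bar>x i\<bar>) = ?\<Phi> t x"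
      "?\<Phi> (t / 2) (\<lambda>i. \<bar>x i\<bar>) = ?\<Phi> (t / 2) x" by (rule even)+
  next
    fix x y :: rvec assume xy: "\<And>i. 0 \<le> x i" "\<And>i. x i \<le> y i"
    show "?\<Phi> 0 y \<le> ?\<Phi> 0 x" "?\<Phi> t y \<le> ?\<Phi> t x" "?\<Phi> (t / 2) y \<le> ?\<Phi> (t / 2) x"
      by (rule decr; use xy t in simp)+
  next
    fix x y :: rvec assume "\<And>i. 0 \<le> x i" "\<And>i. 0 \<le> y i"
    then show "?\<Phi> 0 x * ?\<Phi> t y \<le> (?\<Phi> (t / 2) (\<lambda>i. (x i + y i) / 2))\<^sup>2" by (rule mult)
  qed measurable
  then have "emeasure (leb n) (tail j 0) * emeasure (leb n) (tail j t) \<le> (emeasure (leb n) (tail j (t / 2)))\<^sup>2"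
    using t by (simp add: emeasure_tail[OF j])
  moreover have "tail j 0 = K" by (auto simp: tail_def)
  moreover have "tail j s \<subseteq> K" for s by (auto simp: tail_def)
  ultimately have "ennreal (vol n K) * ennreal (vol n (tail j t)) \<le> (ennreal (vol n (tail j (t / 2))))\<^sup>2"
    by (simp add: vol_eq)
  then show ?thesis by (simp add: ennreal_mult[symmetric] ennreal_power)
qed

end

section \<open>Coordinate moments and the inscribed cube of an unconditional isotropic body\<close>

lemma nn_integral_exp_abs:
  assumes r: "r > 0"
  shows "(\<integral>\<^sup>+t. ennreal (exp (1 - \<bar>t\<bar> / r)) \<partial>lborel) \<le> ennreal (2 * exp 1 * r)"
proof -
  let ?f = "\<lambda>t. ennreal (exp (1 - t / r)) * indicator {0..} t"
  have I: "(\<integral>\<^sup>+t. ?f t \<partial>lborel) = ennreal (0 - (- r * exp (1 - 0 / r)))"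
  proof (rule nn_integral_FTC_atLeast)
    show "((\<lambda>t. - r * exp (1 - t / r)) \<longlongrightarrow> 0) at_top"
      using r by real_asymp
    show "((\<lambda>t. - r * exp (1 - t / r)) has_real_derivative exp (1 - x / r)) (at x)" for x
      using r by (auto intro!: derivative_eq_intros)
  qed auto
  have "(\<integral>\<^sup>+t. ennreal (exp (1 - \<bar>t\<bar> / r)) \<partial>lborel) \<le> (\<integral>\<^sup>+t. ?f t + ?f (0 + (-1) * t) \<partial>lborel)"
    by (rule nn_integral_mono) (auto simp: indicator_def)
  also have "\<dots> = (\<integral>\<^sup>+t. ?f t \<partial>lborel) + (\<integral>\<^sup>+t. ?f (0 + (-1) * t) \<partial>lborel)"
    by (rule nn_integral_add) auto
  also have "(\<integral>\<^sup>+t. ?f (0 + (-1) * t) \<partial>lborel) = (\<integral>\<^sup>+t. ?f t \<partial>lborel)"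
    using nn_integral_real_affine[of ?f "-1" 0] by simp
  also have "(\<integral>\<^sup>+t. ?f t \<partial>lborel) + (\<integral>\<^sup>+t. ?f t \<partial>lborel) = ennreal (2 * exp 1 * r)"
    unfolding I using r by (subst ennreal_plus[symmetric]) auto
  finally show ?thesis .
qed

lemma sets_sum_abs_le [measurable]: "{x::rvec. (\<Sum>i<n. \<bar>x i\<bar>) \<le> c} \<in> sets borel"
proof -
  have "{x\<in>space borel. (\<Sum>i<n. \<bar>x i\<bar>) \<le> c} \<in> sets (borel :: rvec measure)" by measurable
  then show ?thesis by simp
qed

text \<open>Exponential Markov inequality: on the l1 ball the product of the factors
  \<open>exp (1 - |x i| / r)\<close> is at least 1, and each factor has integral at most
  \<open>2 * exp 1 * r\<close>.\<close>

lemma vol_l1_ball: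
  assumes r: "r > 0"
  shows "emeasure (leb n) {x. (\<Sum>i<n. \<bar>x i\<bar>) \<le> real n * r} \<le> ennreal ((2 * exp 1 * r) ^ n)"
proof -
  have "emeasure (leb n) {x. (\<Sum>i<n. \<bar>x i\<bar>) \<le> real n * r} =
      (\<integral>\<^sup>+x. indicator {x. (\<Sum>i<n. \<bar>x i\<bar>) \<le> real n * r} x \<partial>leb n)"
    by simp
  also have "\<dots> \<le> (\<integral>\<^sup>+x. (\<Prod>i<n. ennreal (exp (1 - \<bar>x i\<bar> / r))) \<partial>leb n)"
  proof (rule nn_integral_mono)
    fix x :: rvec
    have "1 \<le> exp (\<Sum>i<n. 1 - \<bar>x i\<bar> / r)" if "(\<Sum>i<n. \<bar>x i\<bar>) \<le> real n * r"
      using that r by (simp add: sum_subtractf sum_divide_distrib[symmetric] field_simps)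
    then show "indicator {x. (\<Sum>i<n. \<bar>x i\<bar>) \<le> real n * r} x \<le> (\<Prod>i<n. ennreal (exp (1 - \<bar>x i\<bar> / r)))"
      by (auto simp: indicator_def prod_ennreal exp_sum)
  qed
  also have "\<dots> = (\<Prod>i<n. \<integral>\<^sup>+t. ennreal (exp (1 - \<bar>t\<bar> / r)) \<partial>lborel)"
    by (rule nn_integral_leb_prod) measurable
  also have "\<dots> \<le> (\<Prod>i<n. ennreal (2 * exp 1 * r))"
    by (intro prod_mono_ennreal nn_integral_exp_abs r)
  also have "\<dots> = ennreal ((2 * exp 1 * r) ^ n)" using r by (simp add: ennreal_power)
  finally show ?thesis .
qed

context unconditional_convex_body
begin

lemma set_integrable_bounded:
  fixes f :: "rvec \<Rightarrow> real"
  assumes [measurable]: "f \<in> borel_measurable borel" and B: "\<And>x. x \<in> K \<Longrightarrow> \<bar>f x\<bar> \<le> B"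
  shows "set_integrable (leb n) K f"
  unfolding set_integrable_def
  by (rule integrableI_bounded_set[where A=K and B=B]) (use B emeasure_finite in auto)

lemma set_integrable_coord:
  fixes c :: real
  shows "set_integrable (leb n) K (\<lambda>x. \<bar>x j\<bar>)" "set_integrable (leb n) K (\<lambda>x. (x j)\<^sup>2)"
    "set_integrable (leb n) K (\<lambda>x. c)"
proof -
  obtain B where B: "\<And>x i. x \<in> K \<Longrightarrow> \<bar>x i\<bar> \<le> B" using bounded_coords by blast
  show "set_integrable (leb n) K (\<lambda>x. \<bar>x j\<bar>)"
    by (rule set_integrable_bounded[where B=B]) (use B in auto)
  show "set_integrable (leb n) K (\<lambda>x. (x j)\<^sup>2)"
  proof (rule set_integrable_bounded[where B="B\<^sup>2"])
    fix x assume "x \<in> K"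
    then show "\<bar>(x j)\<^sup>2\<bar> \<le> B\<^sup>2" using power_mono[OF B, of x j 2] by simp
  qed measurable
  show "set_integrable (leb n) K (\<lambda>x. c)"
    by (rule set_integrable_bounded[where B="\<bar>c\<bar>"]) auto
qed

lemma set_integrable_sum:
  fixes f :: "'a \<Rightarrow> rvec \<Rightarrow> real"
  assumes "\<And>i. i \<in> I \<Longrightarrow> set_integrable (leb n) K (f i)"
  shows "set_integrable (leb n) K (\<lambda>x. \<Sum>i\<in>I. f i x)"
  using assms unfolding set_integrable_def scaleR_sum_right by (rule Bochner_Integration.integrable_sum)

lemma set_integral_sum:
  fixes f :: "'a \<Rightarrow> rvec \<Rightarrow> real"
  assumes "\<And>i. i \<in> I \<Longrightarrow> set_integrable (leb n) K (f i)"
  shows "(LINT x:K|leb n. (\<Sum>i\<in>I. f i x)) = (\<Sum>i\<in>I. LINT x:K|leb n. f i x)"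
  using assms unfolding set_integrable_def set_lebesgue_integral_def scaleR_sum_right
  by (rule Bochner_Integration.integral_sum)

lemma set_integrable_tail:
  fixes c :: real
  shows "set_integrable (leb n) K (\<lambda>x. c * indicator (tail j t) x)"
  by (rule set_integrable_bounded[where B="\<bar>c\<bar>"]) (auto simp: indicator_def)

lemma set_integral_tail:
  fixes c :: real
  shows "(LINT x:K|leb n. c * indicator (tail j t) x) = c * vol n (tail j t)"
proof -
  have "(LINT x:K|leb n. c * indicator (tail j t) x) = (LINT x|leb n. c * indicator (tail j t) x)"
    unfolding set_lebesgue_integral_def
    by (rule Bochner_Integration.integral_cong) (auto simp: indicator_def tail_def)
  also have "\<dots> = c * vol n (tail j t)" by simp
  finally show ?thesis .
qed

lemma set_integral_const_K:
  fixes c :: real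
  shows "(LINT x:K|leb n. c) = c * vol n K"
  by (simp add: set_lebesgue_integral_def)

text \<open>
  The tails decay doubly exponentially along dyadic multiples of a level that is large compared with the
  first moment, by \<open>tail_decay\<close>; this is the reverse Hoelder inequality for \<open>\<bar>x j\<bar>\<close>.
\<close>

lemma second_moment_le:
  assumes vol: "vol n K = 1" and j: "j < n" and T: "T > 0" "16 * (LINT x:K|leb n. \<bar>x j\<bar>) \<le> T"
  shows "(LINT x:K|leb n. (x j)\<^sup>2) \<le> 4 / 3 * T\<^sup>2"
proof -
  define p where "p k = vol n (tail j (T * 2 ^ k))" for k :: nat
  have "T * vol n (tail j T) = (LINT x:K|leb n. T * indicator (tail j T) x)"
    by (rule set_integral_tail[symmetric])
  also have "\<dots> \<le> (LINT x:K|leb n. \<bar>x j\<bar>)"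
    by (rule set_integral_mono[OF set_integrable_tail set_integrable_coord(1)])
       (use T in \<open>auto simp: indicator_def tail_def\<close>)
  finally have "T * vol n (tail j T) \<le> T * (1 / 16)" using T(2) by linarith
  then have p0: "p 0 \<le> 1 / 16" using T(1) unfolding p_def by (simp only: mult_le_cancel_left_pos power_0 mult_1_right)
  have pSuc: "p (Suc k) \<le> (p k)\<^sup>2" for k
    using tail_decay[OF j, of "T * 2 ^ Suc k"] T vol by (simp add: p_def)
  \<comment> \<open>Repeated squaring would give doubly exponential decay, but the rate 1/16 is
    enough: against the factors 4^(k+1) it leaves 4^-(k+1), whose sum is at most 1/3. This is the
    origin of 4/3.\<close>
  have p: "p k \<le> (1 / 16) ^ Suc k" for k
  proof (induction k)
    case (Suc k)
    have "p k \<le> 1 / 16" by (rule order_trans[OF Suc]) (simp add: power_le_one)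
    then have "(p k)\<^sup>2 \<le> (1 / 16) * (1 / 16) ^ Suc k"
      unfolding power2_eq_square by (intro mult_mono Suc) (auto simp: p_def)
    then show ?case using pSuc[of k] by simp
  qed (use p0 in simp)
  obtain B where B: "\<And>x i. x \<in> K \<Longrightarrow> \<bar>x i\<bar> \<le> B" using bounded_coords by blast
  obtain N :: nat where N: "B \<le> T * 2 ^ N"
  proof -
    obtain N :: nat where "B / T < 2 ^ N" using real_arch_pow[of 2] by auto
    then show ?thesis using T(1) by (intro that[of N]) (simp add: field_simps)
  qed
  \<comment> \<open>Dyadic layers: for \<open>T * 2 ^ k < |x j| \<le> T * 2 ^ Suc k\<close> the term
    of index \<open>k\<close> alone is at least the square. Boundedness of \<open>K\<close> makes
    finitely many layers sufficient.\<close>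
  have pt: "(x j)\<^sup>2 \<le> T\<^sup>2 + (\<Sum>k<M. T\<^sup>2 * 4 ^ Suc k * indicator (tail j (T * 2 ^ k)) x)"
    if "x \<in> K" "\<bar>x j\<bar> \<le> T * 2 ^ M" for x M
    using that(2)
  proof (induction M)
    case 0
    then have "\<bar>x j\<bar>\<^sup>2 \<le> T\<^sup>2" by (intro power_mono) auto
    then show ?case by simp
  next
    case (Suc M)
    have nn: "(\<Sum>k<M. T\<^sup>2 * 4 ^ Suc k * indicator (tail j (T * 2 ^ k)) x) \<ge> 0"
      by (intro sum_nonneg) auto
    show ?case
    proof (cases "\<bar>x j\<bar> \<le> T * 2 ^ M")
      case True
      have "0 \<le> T\<^sup>2 * 4 ^ Suc M * (indicator (tail j (T * 2 ^ M)) x :: real)" by simp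
      with Suc.IH[OF True] show ?thesis unfolding sum.lessThan_Suc by linarith
    next
      case False
      then have "x \<in> tail j (T * 2 ^ M)" using that(1) by (auto simp: tail_def abs_if split: if_splits)
      then have ind: "indicator (tail j (T * 2 ^ M)) x = (1 :: real)" by simp
      have "\<bar>x j\<bar>\<^sup>2 \<le> (T * 2 ^ Suc M)\<^sup>2" using Suc.prems by (intro power_mono) auto
      moreover have "(T * 2 ^ Suc M)\<^sup>2 = T\<^sup>2 * 4 ^ Suc M"
      proof -
        have "(2::real) ^ Suc M * 2 ^ Suc M = 4 ^ Suc M"
          by (simp only: power_mult_distrib[symmetric]) simp
        moreover have "(T * a)\<^sup>2 = T\<^sup>2 * (a * a)" for a by (simp add: power2_eq_square)
        ultimately show ?thesis by simp
      qed
      ultimately show ?thesis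
        unfolding sum.lessThan_Suc ind using nn zero_le_power2[of T] by (simp only: power2_abs mult_1_right)
    qed
  qed
  have "(LINT x:K|leb n. (x j)\<^sup>2) \<le>
      (LINT x:K|leb n. T\<^sup>2 + (\<Sum>k<N. T\<^sup>2 * 4 ^ Suc k * indicator (tail j (T * 2 ^ k)) x))"
  proof (rule set_integral_mono)
    show "set_integrable (leb n) K (\<lambda>x. T\<^sup>2 + (\<Sum>k<N. T\<^sup>2 * 4 ^ Suc k * indicator (tail j (T * 2 ^ k)) x))"
      by (intro set_integral_add set_integrable_coord(3) set_integrable_sum set_integrable_tail)
  qed (use pt[of _ N] B N order_trans set_integrable_coord in blast)+
  also have "\<dots> = T\<^sup>2 + (\<Sum>k<N. T\<^sup>2 * 4 ^ Suc k * p k)"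
  proof -
    have "(LINT x:K|leb n. (\<Sum>k<N. T\<^sup>2 * 4 ^ Suc k * indicator (tail j (T * 2 ^ k)) x)) = (\<Sum>k<N. T\<^sup>2 * 4 ^ Suc k * p k)"
      unfolding p_def set_integral_tail[symmetric]
      by (rule set_integral_sum) (rule set_integrable_tail)
    moreover have "set_integrable (leb n) K (\<lambda>x. \<Sum>k<N. T\<^sup>2 * 4 ^ Suc k * indicator (tail j (T * 2 ^ k)) x)"
      by (intro set_integrable_sum set_integrable_tail)
    ultimately show ?thesis
      by (subst set_integral_add) (auto simp: set_integrable_coord set_integral_const_K vol)
  qed
  also have "\<dots> \<le> T\<^sup>2 + (\<Sum>k<N. T\<^sup>2 * (1 / 4) ^ Suc k)"
  proof (intro add_left_mono sum_mono)
    fix k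
    have "4 ^ Suc k * p k \<le> 4 ^ Suc k * (1 / 16) ^ Suc k" by (intro mult_left_mono p) auto
    also have "\<dots> = (1 / 4) ^ Suc k" by (simp only: power_mult_distrib[symmetric]) simp
    finally show "T\<^sup>2 * 4 ^ Suc k * p k \<le> T\<^sup>2 * (1 / 4) ^ Suc k"
      by (simp only: mult.assoc) (intro mult_left_mono, auto)
  qed
  also have "(\<Sum>k<N. T\<^sup>2 * (1 / 4) ^ Suc k) = T\<^sup>2 / 3 * (1 - (1 / 4) ^ N)"
    by (induction N) (auto simp: algebra_simps)
  also have "T\<^sup>2 + T\<^sup>2 / 3 * (1 - (1 / 4) ^ N) \<le> T\<^sup>2 + T\<^sup>2 / 3 * 1"
    by (intro add_left_mono mult_left_mono) auto
  finally show ?thesis by simp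
qed

text \<open>The l1 ball of radius n/12 has volume at most (2 e / 12)^n \<le> 2^-n because e \<le> 3.
  So at least half of a body of volume 1 lies outside it, which gives n/12 times 1/2.\<close>

lemma sum_first_moments_ge:
  assumes vol: "vol n K = 1" and n: "n \<ge> 1"
  shows "(\<Sum>j<n. LINT x:K|leb n. \<bar>x j\<bar>) \<ge> real n / 24"
proof -
  define S where "S = {x::rvec. (\<Sum>i<n. \<bar>x i\<bar>) \<le> real n * (1 / 12)}"
  have [measurable]: "S \<in> sets borel" unfolding S_def by (rule sets_sum_abs_le)
  have "emeasure (leb n) (K \<inter> S) \<le> emeasure (leb n) S" by (rule emeasure_mono) auto
  also have "\<dots> \<le> ennreal ((2 * exp 1 * (1 / 12)) ^ n)" unfolding S_def by (rule vol_l1_ball) simp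
  also have "\<dots> \<le> ennreal ((1 / 2) ^ n)" by (intro ennreal_leI power_mono) (use exp_le in auto)
  also have "\<dots> \<le> ennreal (1 / 2)" by (intro ennreal_leI) (use n power_decreasing[of 1 n "1/2::real"] in auto)
  finally have "ennreal (vol n (K \<inter> S)) \<le> ennreal (1 / 2)" by (subst (asm) vol_eq) auto
  then have half: "vol n (K \<inter> S) \<le> 1 / 2" by (subst (asm) ennreal_le_iff) auto
  have "real n / 12 * (1 / 2) \<le> real n / 12 * (vol n K - vol n (K \<inter> S))"
    using half vol by (intro mult_left_mono) auto
  also have "\<dots> = (LINT x:K|leb n. real n / 12 - real n / 12 * indicator S x)"
  proof -
    have "(LINT x:K|leb n. real n / 12 * indicator S x) = (LINT x|leb n. real n / 12 * indicator (K \<inter> S) x)"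
      unfolding set_lebesgue_integral_def
      by (rule Bochner_Integration.integral_cong) (auto simp: indicator_def)
    then have "(LINT x:K|leb n. real n / 12 * indicator S x) = real n / 12 * vol n (K \<inter> S)" by simp
    moreover have "set_integrable (leb n) K (\<lambda>x. real n / 12 * indicator S x)"
      by (rule set_integrable_bounded[where B="real n / 12"]) (auto simp: indicator_def)
    ultimately show ?thesis
      by (subst set_integral_diff) (auto simp: set_integrable_coord set_integral_const_K algebra_simps)
  qed
  also have "\<dots> \<le> (LINT x:K|leb n. (\<Sum>j<n. \<bar>x j\<bar>))"
  proof (rule set_integral_mono)
    show "set_integrable (leb n) K (\<lambda>x. real n / 12 - real n / 12 * indicator S x)"
      by (rule set_integrable_bounded[where B="real n / 12"]) (auto simp: indicator_def)
    show "set_integrable (leb n) K (\<lambda>x. \<Sum>j<n. \<bar>x j\<bar>)"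
      by (intro set_integrable_sum set_integrable_coord)
  qed (auto simp: S_def indicator_def sum_nonneg)
  also have "\<dots> = (\<Sum>j<n. LINT x:K|leb n. \<bar>x j\<bar>)"
    by (simp add: set_integral_sum set_integrable_coord)
  finally show ?thesis by simp
qed

text \<open>
  The nearest point \<open>z\<close> of \<open>K\<close> to the barycenter \<open>v\<close> of \<open>\<bar>x\<bar>\<close> satisfies \<open>(z - v)\<bullet>(\<bar>x\<bar> - z) \<ge> 0\<close> on \<open>K\<close>;
  integrating over \<open>K\<close> gives \<open>z = v\<close>.
\<close>

lemma abs_barycenter_mem:
  assumes vol: "vol n K = 1"
  shows "(\<lambda>j. if j < n then (LINT x:K|leb n. \<bar>x j\<bar>) else 0) \<in> K" (is "?v \<in> K")
proof -
  define D where "D x = (\<Sum>i<n. (x i - ?v i)\<^sup>2)" for x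
  have "K \<noteq> {}" using vol by auto
  moreover have "continuous_on K D"
    unfolding D_def by (intro continuous_intros continuous_on_subset[OF continuous_on_product_coordinates]) auto
  ultimately obtain z where z: "z \<in> K" "\<And>x. x \<in> K \<Longrightarrow> D z \<le> D x"
    using continuous_attains_inf[OF compact] by blast
  have var: "(\<Sum>i<n. (z i - ?v i) * (\<bar>x i\<bar> - z i)) \<ge> 0" if x: "x \<in> K" for x
  proof (rule ccontr)
    define A where "A = (\<Sum>i<n. (z i - ?v i) * (\<bar>x i\<bar> - z i))"
    define B where "B = (\<Sum>i<n. (\<bar>x i\<bar> - z i)\<^sup>2)"
    assume "\<not> ?thesis"
    then have A: "A < 0" by (simp add: A_def)
    have B: "B \<ge> 0" unfolding B_def by (intro sum_nonneg) auto
    \<comment> \<open>The choice gives \<open>t * (B + 1) \<le> - A\<close>, so the linear term wins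
      and \<open>2 * A + t * B\<close> is negative; the summand 1 covers
      \<open>B = 0\<close>.\<close>
    define t where "t = min 1 (- A / (B + 1))"
    have "- A / (B + 1) > 0" using A B by (intro divide_pos_pos) auto
    then have t: "0 < t" "t \<le> 1" by (auto simp: t_def)
    have "(\<lambda>i. (1 - t) * z i + t * \<bar>x i\<bar>) \<in> K"
      by (rule convex) (use t z x abs_mem_iff in auto)
    then have "D z \<le> D (\<lambda>i. (1 - t) * z i + t * \<bar>x i\<bar>)" by (rule z(2))
    also have "\<dots> = (\<Sum>i<n. (z i - ?v i)\<^sup>2 + 2 * t * ((z i - ?v i) * (\<bar>x i\<bar> - z i)) + t\<^sup>2 * (\<bar>x i\<bar> - z i)\<^sup>2)"
      unfolding D_def by (rule sum.cong) (auto simp: power2_eq_square algebra_simps)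
    also have "\<dots> = D z + 2 * t * A + t\<^sup>2 * B"
      by (simp add: D_def A_def B_def sum.distrib sum_distrib_left)
    finally have "0 \<le> t * (2 * A + t * B)" by (simp add: power2_eq_square algebra_simps)
    then have "0 \<le> 2 * A + t * B" using t by (simp add: zero_le_mult_iff)
    moreover have "t * (B + 1) \<le> - A / (B + 1) * (B + 1)"
      using B unfolding t_def by (intro mult_right_mono) auto
    moreover have "- A / (B + 1) * (B + 1) = - A" using B by simp
    ultimately show False using A B t by (simp add: algebra_simps)
  qed
  have "0 \<le> (LINT x:K|leb n. (\<Sum>i<n. (z i - ?v i) * (\<bar>x i\<bar> - z i)))"
    unfolding set_lebesgue_integral_def[of _ _ "\<lambda>x. \<Sum>i<n. _ x i"]
  proof (rule Bochner_Integration.integral_nonneg)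
    fix x show "0 \<le> indicator K x *\<^sub>R (\<Sum>i<n. (z i - ?v i) * (\<bar>x i\<bar> - z i))"
      using var[of x] by (cases "x \<in> K") simp_all
  qed
  also have "\<dots> = (\<Sum>i<n. (z i - ?v i) * (?v i - z i))"
  proof (subst set_integral_sum)
    show "set_integrable (leb n) K (\<lambda>x. (z i - ?v i) * (\<bar>x i\<bar> - z i))" for i
      by (intro set_integrable_mult_right set_integral_diff set_integrable_coord)
    show "(\<Sum>i<n. LINT x:K|leb n. (z i - ?v i) * (\<bar>x i\<bar> - z i)) = (\<Sum>i<n. (z i - ?v i) * (?v i - z i))"
      by (rule sum.cong)
         (auto simp: set_integral_diff set_integrable_coord set_integral_const_K vol)
  qed
  also have "\<dots> = - D z" by (simp add: D_def sum_negf[symmetric] power2_eq_square algebra_simps)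
  finally have "D z \<le> 0" by simp
  moreover have "D z \<ge> 0" unfolding D_def by (intro sum_nonneg) auto
  ultimately have "D z = 0" by simp
  then have "z i = ?v i" if "i < n" for i
    using that sum_nonneg_eq_0_iff[of "{..<n}" "\<lambda>i. (z i - ?v i)\<^sup>2"] by (auto simp: D_def)
  then have "z = ?v" using subset_Rn z(1) by (fastforce simp: Rn_iff)
  then show ?thesis using z(1) by simp
qed

text \<open>Isotropy transfers an averaged bound to every coordinate: all second moments equal
  \<open>L\<^sup>2\<close>, first moments are at most \<open>L\<close>, and their sum is at least
  n/24, so \<open>L \<ge> 1 / 24\<close>. A first moment below 1/500 would give
  \<open>L\<^sup>2 \<le> 4 / 3 * (16 / 500)\<^sup>2\<close>, which is less than
  \<open>(1 / 24)\<^sup>2\<close>.\<close>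

lemma contains_cube:
  assumes iso: "isotropic n K" and n: "n \<ge> 1"
  shows "{x\<in>Rn n. \<forall>i<n. \<bar>x i\<bar> \<le> 1 / 500} \<subseteq> K"
proof -
  have vol: "vol n K = 1" using iso by (simp add: isotropic_def)
  obtain L where L: "L > 0" "\<And>\<theta>. \<theta> \<in> unit_sphere n \<Longrightarrow> (LINT x:K|leb n. (ip n x \<theta>)\<^sup>2) = L\<^sup>2"
    using iso by (auto simp: isotropic_def)
  have mom2: "(LINT x:K|leb n. (x j)\<^sup>2) = L\<^sup>2" if j: "j < n" for j
  proof -
    define e where "e i = (if i = j then 1 else 0 :: real)" for i
    have ip: "ip n x e = x j" for x
    proof -
      have "ip n x e = (\<Sum>i<n. if i = j then x i else 0)" unfolding ip_def e_def by (rule sum.cong) auto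
      then show ?thesis using j by simp
    qed
    moreover have "e \<in> unit_sphere n" using j by (auto simp: unit_sphere_def ip Rn_iff e_def)
    ultimately show ?thesis using L(2)[of e] by simp
  qed
  have mom1: "(LINT x:K|leb n. \<bar>x j\<bar>) \<le> L" if j: "j < n" for j
  proof -
    have "(LINT x:K|leb n. \<bar>x j\<bar>) \<le> (LINT x:K|leb n. 1 / (2 * L) * (x j)\<^sup>2 + L / 2)"
    proof (rule set_integral_mono)
      fix x
      have "2 * L * \<bar>x j\<bar> \<le> \<bar>x j\<bar>\<^sup>2 + L\<^sup>2" using sum_squares_bound[of "\<bar>x j\<bar>" L] by (simp add: mult_ac)
      then show "\<bar>x j\<bar> \<le> 1 / (2 * L) * (x j)\<^sup>2 + L / 2"
        using L(1) by (simp add: field_simps power2_eq_square)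
    qed (intro set_integral_add set_integrable_mult_right set_integrable_coord)+
    also have "\<dots> = 1 / (2 * L) * L\<^sup>2 + L / 2"
      by (subst set_integral_add)
         (auto simp: set_integrable_coord set_integral_const_K vol mom2[OF j] intro!: set_integrable_mult_right simp del: times_divide_eq_left)
    also have "\<dots> = L" using L(1) by (simp add: power2_eq_square)
    finally show ?thesis .
  qed
  have "real n / 24 \<le> (\<Sum>j<n. LINT x:K|leb n. \<bar>x j\<bar>)" by (rule sum_first_moments_ge[OF vol n])
  also have "\<dots> \<le> (\<Sum>j<n. L)" by (intro sum_mono mom1) auto
  finally have "real n * (1 / 24) \<le> real n * L" by simp
  then have L24: "1 / 24 \<le> L" using n by (simp only: mult_le_cancel_left_pos of_nat_0_less_iff)
  have v: "(LINT x:K|leb n. \<bar>x j\<bar>) \<ge> 1 / 500" if j: "j < n" for j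
  proof (rule ccontr)
    assume "\<not> ?thesis"
    then have "L\<^sup>2 \<le> 4 / 3 * (16 / 500)\<^sup>2"
      using second_moment_le[OF vol j, of "16 / 500"] mom2[OF j] by simp
    moreover have "(1 / 24)\<^sup>2 \<le> L\<^sup>2" using L24 by (intro power_mono) auto
    ultimately show False by (simp add: power2_eq_square)
  qed
  show ?thesis
  proof
    fix x assume "x \<in> {x\<in>Rn n. \<forall>i<n. \<bar>x i\<bar> \<le> 1 / 500}"
    then have x: "x \<in> Rn n" "\<And>i. i < n \<Longrightarrow> \<bar>x i\<bar> \<le> 1 / 500" by auto
    show "x \<in> K"
    proof (rule solid[OF abs_barycenter_mem[OF vol]])
      fix i show "\<bar>x i\<bar> \<le> \<bar>if i < n then (LINT x:K|leb n. \<bar>x i\<bar>) else 0\<bar>"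
        using x(1) order_trans[OF x(2) v, of i i] by (auto simp: Rn_iff)
    qed
  qed
qed

end

subsection \<open>Intersections of slabs\<close>

text \<open>The exponential moment of a fair sign: the analytic inequality behind Hoeffding's lemma
  is taken at \<open>h = 2 * a\<close> and \<open>p = 1 / 2\<close>. It concerns nonnegative
  arguments; evenness of \<open>cosh\<close> covers the rest.\<close>

lemma cosh_le_exp_half_square: "cosh a \<le> exp (a\<^sup>2 / 2)" for a :: real
proof -
  have pos: "cosh a \<le> exp (a\<^sup>2 / 2)" if "a \<ge> 0" for a :: real
  proof -
    have "- (2 * a) * (1 / 2) + ln (1 + 1 / 2 * (exp (2 * a) - 1)) \<le> (2 * a)\<^sup>2 / 8"
      by (rule Hoeffdings_lemma_aux) (use that in auto)
    moreover have "1 + 1 / 2 * (exp (2 * a) - 1) = exp a * cosh a"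
      using exp_add[of a a] by (simp add: cosh_def field_simps exp_minus mult_2)
    ultimately have "ln (cosh a) \<le> a\<^sup>2 / 2" by (simp add: ln_mult power2_eq_square)
    then show ?thesis by (metis cosh_real_pos exp_le_cancel_iff exp_ln)
  qed
  show ?thesis using pos[of a] pos[of "- a"] by (cases "a \<ge> 0") auto
qed

text \<open>On [-1, 1] the exponential lies below its chord \<open>cosh a + t * sinh a\<close>,
  whose odd part integrates to zero.\<close>

lemma nn_integral_exp_Icc_le:
  "(\<integral>\<^sup>+t. indicator {-1..1} t * ennreal (exp (a * t)) \<partial>lborel) \<le> ennreal (2 * exp (a\<^sup>2 / 2))"
proof -
  have conv: "exp (a * t) \<le> cosh a + t * sinh a" if "t \<in> {-1..1}" for t
  proof -
    have "exp ((1 - (1 + t) / 2) *\<^sub>R (- a) + ((1 + t) / 2) *\<^sub>R a) \<le> (1 - (1 + t) / 2) * exp (- a) + (1 + t) / 2 * exp a"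
      by (rule convex_onD[OF exp_convex]) (use that in auto)
    moreover have "(1 - (1 + t) / 2) *\<^sub>R (- a) + ((1 + t) / 2) *\<^sub>R a = a * t"
      by (simp add: field_simps)
    ultimately show ?thesis by (simp add: cosh_def sinh_def field_simps)
  qed
  have "(\<integral>\<^sup>+t. indicator {-1..1} t * ennreal (exp (a * t)) \<partial>lborel) \<le>
      (\<integral>\<^sup>+t. ennreal (cosh a + t * sinh a) * indicator {-1..1} t \<partial>lborel)"
    by (rule nn_integral_mono) (auto simp: indicator_def conv ennreal_leI)
  also have "\<dots> = ennreal ((cosh a * 1 + 1\<^sup>2 / 2 * sinh a) - (cosh a * (-1) + (-1)\<^sup>2 / 2 * sinh a))"
  proof (rule nn_integral_FTC_Icc[where F="\<lambda>t. cosh a * t + t\<^sup>2 / 2 * sinh a"])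
    show "((\<lambda>t. cosh a * t + t\<^sup>2 / 2 * sinh a) has_real_derivative cosh a + t * sinh a) (at t)" for t
      by (auto intro!: derivative_eq_intros)
    show "0 \<le> cosh a + t * sinh a" if "t \<in> {-1..1}" for t
      using conv[of t] that by (auto intro: order_trans[OF less_imp_le[OF exp_gt_zero]])
  qed auto
  also have "\<dots> \<le> ennreal (2 * exp (a\<^sup>2 / 2))"
    using cosh_le_exp_half_square[of a] by (intro ennreal_leI) simp
  finally show ?thesis .
qed

text \<open>Cubes are encoded without \<open>x \<in> Rn n\<close>, which holds almost everywhere for \<open>leb n\<close>.\<close>

definition symm_cube :: "nat \<Rightarrow> rvec set" where
  "symm_cube n = {x. \<forall>i<n. x i \<in> {-1..1}}"

lemma sets_symm_cube [measurable]: "symm_cube n \<in> sets borel"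
proof -
  have "symm_cube n = {x\<in>space borel. \<forall>i\<in>{..<n}. x i \<in> {-1..1}}" by (auto simp: symm_cube_def)
  also have "\<dots> \<in> sets borel" by measurable
  finally show ?thesis .
qed

lemma indicator_symm_cube: "indicator (symm_cube n) x = (\<Prod>i<n. indicator {-1..1} (x i) :: ennreal)"
  unfolding prod_indicator symm_cube_def ..

lemma emeasure_symm_cube: "emeasure (leb n) (symm_cube n) = ennreal (2 ^ n)"
proof -
  have "emeasure (leb n) (symm_cube n) = (\<integral>\<^sup>+x. (\<Prod>i<n. indicator {-1..1} (x i)) \<partial>leb n)"
    unfolding indicator_symm_cube[symmetric] by simp
  also have "\<dots> = (\<Prod>i<n. 2)" by (subst nn_integral_leb_prod) auto
  also have "\<dots> = ennreal (2 ^ n)" by (simp add: ennreal_power[symmetric])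
  finally show ?thesis .
qed

lemma cube_exp_moment:
  assumes u: "ip n u u = 1"
  shows "(\<integral>\<^sup>+x. indicator (symm_cube n) x * ennreal (exp (l * ip n u x)) \<partial>leb n) \<le> ennreal (2 ^ n * exp (l\<^sup>2 / 2))"
proof -
  have eq: "indicator (symm_cube n) x * ennreal (exp (l * ip n u x)) =
      (\<Prod>i<n. indicator {-1..1} (x i) * ennreal (exp ((l * u i) * x i)))" for x
    by (simp add: indicator_symm_cube prod.distrib prod_ennreal exp_sum[symmetric] ip_def sum_distrib_left mult.assoc)
  have "(\<integral>\<^sup>+x. indicator (symm_cube n) x * ennreal (exp (l * ip n u x)) \<partial>leb n) =
      (\<Prod>i<n. \<integral>\<^sup>+t. indicator {-1..1} t * ennreal (exp ((l * u i) * t)) \<partial>lborel)"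
    unfolding eq by (rule nn_integral_leb_prod) measurable
  also have "\<dots> \<le> (\<Prod>i<n. ennreal (2 * exp ((l * u i)\<^sup>2 / 2)))"
    by (intro prod_mono_ennreal nn_integral_exp_Icc_le)
  also have "\<dots> = ennreal (2 ^ n * exp (\<Sum>i<n. (l * u i)\<^sup>2 / 2))"
    by (simp add: prod_ennreal prod.distrib exp_sum)
  also have "(\<Sum>i<n. (l * u i)\<^sup>2 / 2) = l\<^sup>2 / 2 * ip n u u"
    by (simp add: ip_def sum_distrib_left power_mult_distrib power2_eq_square sum_divide_distrib mult_ac)
  finally show ?thesis using u by simp
qed

text \<open>A nonzero rounding forces \<open>a = 2 * |z| / s\<close> to be at least 1; then the
  rounded value is at most \<open>(a + 1) / 2 \<le> a \<le> exp (a - 1)\<close>, and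
  \<open>s \<ge> 2\<close> raises the exponent to \<open>s\<^sup>2 / 4 * (a - 1)\<close>. The rate
  s/2 costs \<open>exp (s\<^sup>2 / 8)\<close> on the cube, so the prefactor leaves
  \<open>exp (- s\<^sup>2 / 8)\<close>.\<close>

lemma round_moment_pointwise:
  fixes z s :: real
  assumes s: "s \<ge> 2"
  shows "\<bar>real_of_int (round (z / s))\<bar> \<le> exp (- s\<^sup>2 / 4) * (exp (s / 2 * z) + exp (- (s / 2) * z))"
proof (cases "round (z / s) = 0")
  case False
  let ?k = "\<bar>real_of_int (round (z / s))\<bar>"
  define a where "a = 2 * \<bar>z\<bar> / s"
  define w where "w = z / s"
  have near: "?k - \<bar>w\<bar> \<le> 1 / 2"
    unfolding w_def by (rule order_trans[OF abs_triangle_ineq2 of_int_round_abs_le])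
  have w: "\<bar>w\<bar> = a / 2" using s by (simp add: w_def a_def abs_divide)
  have "1 \<le> \<bar>round (z / s)\<bar>" using False by linarith
  then have ge1: "?k \<ge> 1" by linarith
  have k: "?k \<le> (a + 1) / 2" "a \<ge> 1"
    using near ge1 unfolding w by (simp_all add: field_simps)
  have "?k \<le> a" using k by simp
  also have "\<dots> \<le> exp (a - 1)" using exp_ge_add_one_self[of "a - 1"] by simp
  also have "\<dots> \<le> exp (s\<^sup>2 / 4 * (a - 1))"
  proof -
    have "2\<^sup>2 \<le> s\<^sup>2" using s by (intro power_mono) auto
    then have "1 * (a - 1) \<le> s\<^sup>2 / 4 * (a - 1)" using k by (intro mult_right_mono) auto
    then show ?thesis by simp
  qed
  also have "s\<^sup>2 / 4 * (a - 1) = - s\<^sup>2 / 4 + s / 2 * \<bar>z\<bar>"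
    using s by (simp add: a_def power2_eq_square field_simps)
  also have "exp (- s\<^sup>2 / 4 + s / 2 * \<bar>z\<bar>) = exp (- s\<^sup>2 / 4) * exp (s / 2 * \<bar>z\<bar>)"
    by (rule exp_add)
  also have "\<dots> \<le> exp (- s\<^sup>2 / 4) * (exp (s / 2 * z) + exp (- (s / 2) * z))"
    by (intro mult_left_mono) (auto simp: abs_if)
  finally show ?thesis .
qed (simp add: add_nonneg_nonneg)

lemma cube_round_moment:
  assumes u: "ip n u u = 1" and s: "s \<ge> 2"
  shows "(\<integral>\<^sup>+x. indicator (symm_cube n) x * ennreal \<bar>real_of_int (round (ip n u x / s))\<bar> \<partial>leb n)
    \<le> ennreal (2 ^ n * (2 * exp (- s\<^sup>2 / 8)))"
proof -
  have [measurable]: "(\<lambda>x. ip n u x) \<in> borel_measurable borel" unfolding ip_def by measurable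
  let ?E = "\<lambda>l x. indicator (symm_cube n) x * ennreal (exp (l * ip n u x))"
  have "(\<integral>\<^sup>+x. indicator (symm_cube n) x * ennreal \<bar>real_of_int (round (ip n u x / s))\<bar> \<partial>leb n) \<le>
      (\<integral>\<^sup>+x. ennreal (exp (- s\<^sup>2 / 4)) * (?E (s / 2) x + ?E (- (s / 2)) x) \<partial>leb n)"
  proof (rule nn_integral_mono)
    fix x
    show "indicator (symm_cube n) x * ennreal \<bar>real_of_int (round (ip n u x / s))\<bar> \<le>
        ennreal (exp (- s\<^sup>2 / 4)) * (?E (s / 2) x + ?E (- (s / 2)) x)"
      using ennreal_leI[OF round_moment_pointwise[OF s, of "ip n u x"]]
      by (simp add: indicator_def ennreal_mult ennreal_plus)
  qed
  also have "\<dots> = ennreal (exp (- s\<^sup>2 / 4)) * ((\<integral>\<^sup>+x. ?E (s / 2) x \<partial>leb n) + (\<integral>\<^sup>+x. ?E (- (s / 2)) x \<partial>leb n))"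
    by (subst nn_integral_cmult, measurable) (subst nn_integral_add, auto)
  also have "\<dots> \<le> ennreal (exp (- s\<^sup>2 / 4)) * (ennreal (2 ^ n * exp ((s / 2)\<^sup>2 / 2)) + ennreal (2 ^ n * exp ((- (s / 2))\<^sup>2 / 2)))"
    by (intro mult_left_mono add_mono cube_exp_moment u) auto
  also have "\<dots> = ennreal (2 ^ n * (2 * (exp (- s\<^sup>2 / 4) * exp (s\<^sup>2 / 8))))"
    by (subst ennreal_plus[symmetric]) (auto simp: ennreal_mult[symmetric] power_divide algebra_simps)
  also have "exp (- s\<^sup>2 / 4) * exp (s\<^sup>2 / 8) = exp (- s\<^sup>2 / 8)"
    by (simp add: exp_add[symmetric])
  finally show ?thesis .
qed

text \<open>
  Rounding \<open>(\<langle>u\<^sub>i, x\<rangle> / s)\<^sub>i\<close> divides the cube into cells, each of which has a translate inside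
  the intersection of slabs, since differences of two points of a cell lie in it. The rounded vector
  is mostly zero, so it has small entropy and some cell is large.
\<close>

lemma slabs_volume_ge:
  fixes u :: "'i \<Rightarrow> rvec"
  assumes I: "finite I" and u: "\<And>i. i \<in> I \<Longrightarrow> ip n (u i) (u i) = 1" and s: "s \<ge> 2" and L: "L > 0"
  defines "T \<equiv> {x. \<forall>i\<in>I. \<bar>ip n (u i) x\<bar> \<le> s}"
  shows "ennreal (2 ^ n * exp (- (L * real (card I) * (2 * exp (- s\<^sup>2 / 8))))) \<le>
    ennreal ((1 + 2 * exp (- L) / (1 - exp (- L))) ^ card I) * emeasure (leb n) T"
proof -
  define k where "k i x = round (ip n (u i) x / s)" for i x
  have [measurable]: "(\<lambda>x. ip n v x) \<in> borel_measurable borel" for v unfolding ip_def by measurable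
  have [measurable]: "k i \<in> measurable borel (count_space UNIV)" for i unfolding k_def round_def by measurable
  have [measurable]: "(\<lambda>x. real_of_int (k i x)) \<in> borel_measurable borel" for i by measurable
  have T[measurable]: "T \<in> sets borel"
  proof -
    have "T = {x\<in>space borel. \<forall>i\<in>I. \<bar>ip n (u i) x\<bar> \<le> s}" by (auto simp: T_def)
    also have "\<dots> \<in> sets borel" using I by measurable
    finally show ?thesis .
  qed
  \<comment> \<open>\<open>exp (- Y x)\<close> is the weight of the cell of \<open>x\<close>. Summed
    over all integer vectors these weights factorize over \<open>I\<close>, so a partition function
    takes the role of the entropy count.\<close>
  define Y where "Y x = L * (\<Sum>i\<in>I. \<bar>real_of_int (k i x)\<bar>)" for x
  have Y0: "Y x \<ge> 0" for x unfolding Y_def using L by (intro mult_nonneg_nonneg sum_nonneg) auto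
  have [measurable]: "Y \<in> borel_measurable borel" unfolding Y_def by measurable
  define \<mu> where "\<mu> = L * real (card I) * (2 * exp (- s\<^sup>2 / 8))"
  have \<mu>0: "\<mu> \<ge> 0" using L by (simp add: \<mu>_def)
  let ?Q = "symm_cube n"
  have EY: "(\<integral>\<^sup>+x. indicator ?Q x * ennreal (Y x) \<partial>leb n) \<le> ennreal (2 ^ n * \<mu>)"
  proof -
    have "(\<integral>\<^sup>+x. indicator ?Q x * ennreal (Y x) \<partial>leb n) =
        (\<integral>\<^sup>+x. ennreal L * (\<Sum>i\<in>I. indicator ?Q x * ennreal \<bar>real_of_int (k i x)\<bar>) \<partial>leb n)"
      using L by (intro nn_integral_cong) (simp add: Y_def ennreal_mult sum_ennreal[symmetric] sum_nonneg sum_distrib_left mult_ac)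
    also have "\<dots> = ennreal L * (\<Sum>i\<in>I. \<integral>\<^sup>+x. indicator ?Q x * ennreal \<bar>real_of_int (k i x)\<bar> \<partial>leb n)"
      by (subst nn_integral_cmult, measurable) (subst nn_integral_sum, auto)
    also have "\<dots> \<le> ennreal L * (\<Sum>i\<in>I. ennreal (2 ^ n * (2 * exp (- s\<^sup>2 / 8))))"
      unfolding k_def by (intro mult_left_mono sum_mono cube_round_moment u s) auto
    also have "\<dots> = ennreal (2 ^ n * \<mu>)"
      using L by (simp add: \<mu>_def ennreal_mult[symmetric] ennreal_of_nat_eq_real_of_nat mult_ac)
    finally show ?thesis .
  qed
  have lower: "ennreal (2 ^ n * exp (- \<mu>)) \<le> (\<integral>\<^sup>+x. indicator ?Q x * ennreal (exp (- Y x)) \<partial>leb n)"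
  proof -
    let ?J = "\<integral>\<^sup>+x. indicator ?Q x * ennreal (exp (- Y x)) \<partial>leb n"
    \<comment> \<open>Jensen's inequality for the mean of \<open>exp (- Y)\<close>, by the tangent
      of \<open>exp (\<mu> - Y)\<close>; \<mu> bounds the mean of \<open>Y\<close> over the cube.
      \<open>Y x\<close> is kept on the larger side so that every term is nonnegative and can be
      integrated in \<open>ennreal\<close>.\<close>
    have tangent: "1 + \<mu> \<le> exp (\<mu> - Y x) + Y x" for x
      using exp_ge_add_one_self[of "\<mu> - Y x"] by linarith
    have "ennreal (1 + \<mu>) * emeasure (leb n) ?Q = (\<integral>\<^sup>+x. ennreal (1 + \<mu>) * indicator ?Q x \<partial>leb n)"
      by (simp add: nn_integral_cmult)
    also have "\<dots> \<le> (\<integral>\<^sup>+x. ennreal (exp \<mu>) * (indicator ?Q x * ennreal (exp (- Y x))) + indicator ?Q x * ennreal (Y x) \<partial>leb n)"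
    proof (rule nn_integral_mono)
      fix x
      have "ennreal (1 + \<mu>) \<le> ennreal (exp \<mu>) * ennreal (exp (- Y x)) + ennreal (Y x)"
        using ennreal_leI[OF tangent[of x]] Y0[of x]
        by (simp add: ennreal_mult[symmetric] exp_diff exp_minus divide_inverse)
      then show "ennreal (1 + \<mu>) * indicator ?Q x \<le>
          ennreal (exp \<mu>) * (indicator ?Q x * ennreal (exp (- Y x))) + indicator ?Q x * ennreal (Y x)"
        by (simp add: indicator_def)
    qed
    also have "\<dots> = ennreal (exp \<mu>) * ?J + (\<integral>\<^sup>+x. indicator ?Q x * ennreal (Y x) \<partial>leb n)"
      by (subst nn_integral_add, measurable) (subst nn_integral_cmult, auto)
    also have "\<dots> \<le> ennreal (exp \<mu>) * ?J + ennreal (2 ^ n * \<mu>)"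
      by (intro add_left_mono EY)
    finally have "ennreal (2 ^ n) + ennreal (2 ^ n * \<mu>) \<le> ennreal (exp \<mu>) * ?J + ennreal (2 ^ n * \<mu>)"
      using \<mu>0 by (simp add: emeasure_symm_cube ennreal_mult[symmetric] ennreal_plus[symmetric] algebra_simps del: ennreal_plus)
    then have *: "ennreal (2 ^ n) \<le> ennreal (exp \<mu>) * ?J"
      by (subst (asm) (1 2) add.commute, subst (asm) ennreal_add_left_cancel_le) auto
    have "ennreal (2 ^ n * exp (- \<mu>)) = ennreal (exp (- \<mu>)) * ennreal (2 ^ n)"
      by (simp add: ennreal_mult[symmetric] mult.commute)
    also have "\<dots> \<le> ennreal (exp (- \<mu>)) * (ennreal (exp \<mu>) * ?J)" by (intro mult_left_mono *) auto
    also have "\<dots> = ?J" by (simp add: mult.assoc[symmetric] ennreal_mult[symmetric] exp_minus)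
    finally show ?thesis .
  qed
  obtain M :: nat where M: "\<And>x i. x \<in> ?Q \<Longrightarrow> i \<in> I \<Longrightarrow> \<bar>k i x\<bar> \<le> int M"
  proof -
    define R where "R = (\<Sum>i\<in>I. \<Sum>j<n. \<bar>u i j\<bar>)"
    have "\<bar>k i x\<bar> \<le> int (nat \<lceil>R\<rceil> + 1)" if "x \<in> ?Q" "i \<in> I" for x i
    proof -
      have "\<bar>ip n (u i) x\<bar> \<le> (\<Sum>j<n. \<bar>u i j * x j\<bar>)" unfolding ip_def by (rule sum_abs)
      also have "\<dots> \<le> (\<Sum>j<n. \<bar>u i j\<bar>)"
        using that by (intro sum_mono) (auto simp: symm_cube_def abs_mult abs_le_iff minus_le_iff intro!: mult_left_le)
      also have "\<dots> \<le> R" unfolding R_def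
        by (rule member_le_sum[of i I "\<lambda>i. \<Sum>j<n. \<bar>u i j\<bar>"]) (use that I in \<open>auto intro: sum_nonneg\<close>)
      finally have "\<bar>ip n (u i) x / s\<bar> \<le> R"
        using s by (simp add: abs_divide divide_le_eq) (smt (verit) mult_le_cancel_left1 mult_left_mono abs_ge_zero)
      moreover have "\<bar>real_of_int (k i x) - ip n (u i) x / s\<bar> \<le> 1 / 2" unfolding k_def by (rule of_int_round_abs_le)
      ultimately have "\<bar>real_of_int (k i x)\<bar> \<le> R + 1" by linarith
      then show ?thesis by linarith
    qed
    then show ?thesis using that by blast
  qed
  define A where "A = Pi\<^sub>E I (\<lambda>_. {- int M..int M})"
  define C where "C a = {x\<in>?Q. \<forall>i\<in>I. k i x = a i}" for a
  have [measurable]: "C a \<in> sets borel" for a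
  proof -
    have "C a = ?Q \<inter> {x\<in>space borel. \<forall>i\<in>I. k i x = a i}" by (auto simp: C_def)
    also have "\<dots> \<in> sets borel" using I by measurable
    finally show ?thesis .
  qed
  have finA: "finite A" unfolding A_def using I by (intro finite_PiE) auto
  \<comment> \<open>Translation invariance holds for shifts in \<open>Rn n\<close>, so the base
    point \<open>c\<close> is taken there; a cell without such a point is a null set.\<close>
  have cell: "emeasure (leb n) (C a) \<le> emeasure (leb n) T" for a
  proof (cases "C a \<inter> Rn n = {}")
    case True
    have "emeasure (leb n) {x\<in>space (leb n). x \<in> C a} = 0"
      by (rule emeasure_eq_0_AE, rule AE_mp[OF AE_leb_Rn], rule AE_I2) (use True in blast)
    then show ?thesis by simp
  next
    case False
    then obtain c where c: "c \<in> C a" "c \<in> Rn n" by blast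
    have sub: "(\<lambda>i. x i - c i) \<in> T" if x: "x \<in> C a" for x
      unfolding T_def
    proof (safe)
      fix i assume i: "i \<in> I"
      have "\<bar>real_of_int (a i) - ip n (u i) y / s\<bar> \<le> 1 / 2" if "y \<in> C a" for y
        using of_int_round_abs_le[of "ip n (u i) y / s"] that i by (auto simp: C_def k_def)
      from this[OF x] this[OF c(1)] have "\<bar>ip n (u i) x / s - ip n (u i) c / s\<bar> \<le> 1" by linarith
      then have "\<bar>ip n (u i) x - ip n (u i) c\<bar> \<le> s"
        using s by (simp add: diff_divide_distrib[symmetric] abs_divide divide_le_eq)
      then show "\<bar>ip n (u i) (\<lambda>i. x i - c i)\<bar> \<le> s"
        by (simp add: ip_def algebra_simps sum_subtractf)
    qed
    have "emeasure (leb n) (C a) = (\<integral>\<^sup>+x. indicator (C a) x \<partial>leb n)" by simp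
    also have "\<dots> \<le> (\<integral>\<^sup>+x. indicator T (\<lambda>i. x i + - c i) \<partial>leb n)"
      by (rule nn_integral_mono) (use sub in \<open>auto simp: indicator_def\<close>)
    also have "\<dots> = (\<integral>\<^sup>+x. indicator T x \<partial>leb n)"
      by (rule nn_integral_leb_translate) (use c in \<open>auto simp: Rn_iff\<close>)
    finally show ?thesis by simp
  qed
  have weights: "(\<Sum>j\<in>{- int M..int M}. exp (- L * \<bar>real_of_int j\<bar>)) \<le> 1 + 2 * exp (- L) / (1 - exp (- L))"
  proof -
    define q where "q = exp (- L)"
    have q: "0 < q" "q < 1" using L by (auto simp: q_def)
    have "(\<Sum>j\<in>{- int M..int M}. exp (- L * \<bar>real_of_int j\<bar>)) = 1 + 2 * (\<Sum>j\<in>{1..M}. q ^ j)"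
    proof (induction M)
      case (Suc M)
      have "{- int (Suc M)..int (Suc M)} = insert (int (Suc M)) (insert (- int (Suc M)) {- int M..int M})"
        by auto
      moreover have "exp (- (L * (1 + real M))) = q ^ Suc M"
        by (simp only: q_def exp_of_nat_mult[symmetric] of_nat_Suc) (simp add: mult.commute add.commute)
      ultimately show ?case using Suc by (simp add: add.commute)
    qed simp
    also have "(\<Sum>j\<in>{1..M}. q ^ j) \<le> q / (1 - q)"
    proof -
      have "(\<Sum>j\<in>{1..M}. q ^ j) * (1 - q) = q - q ^ Suc M"
      proof (induction M)
        case (Suc M)
        have "(\<Sum>j\<in>{1..Suc M}. q ^ j) * (1 - q) = (\<Sum>j\<in>{1..M}. q ^ j) * (1 - q) + q ^ Suc M * (1 - q)"
          by (simp add: distrib_right)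
        also have "\<dots> = q - q ^ Suc (Suc M)" unfolding Suc by (simp add: algebra_simps)
        finally show ?case .
      qed simp
      also have "\<dots> \<le> q" using q by simp
      finally show ?thesis using q by (simp add: pos_le_divide_eq)
    qed
    finally show ?thesis by (simp add: q_def)
  qed
  have "(\<integral>\<^sup>+x. indicator ?Q x * ennreal (exp (- Y x)) \<partial>leb n) \<le>
      (\<integral>\<^sup>+x. (\<Sum>a\<in>A. ennreal (\<Prod>i\<in>I. exp (- L * \<bar>real_of_int (a i)\<bar>)) * indicator (C a) x) \<partial>leb n)"
  proof (rule nn_integral_mono)
    fix x
    show "indicator ?Q x * ennreal (exp (- Y x)) \<le>
        (\<Sum>a\<in>A. ennreal (\<Prod>i\<in>I. exp (- L * \<bar>real_of_int (a i)\<bar>)) * indicator (C a) x)"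
    proof (cases "x \<in> ?Q")
      case True
      define a where "a = restrict (\<lambda>i. k i x) I"
      have a: "a \<in> A" using M[OF True] by (auto simp: A_def a_def abs_le_iff minus_le_iff)
      have "exp (- Y x) = (\<Prod>i\<in>I. exp (- L * \<bar>real_of_int (a i)\<bar>))"
        by (simp add: Y_def a_def exp_sum[OF I, symmetric] sum_distrib_left sum_negf)
      moreover have "x \<in> C a" using True by (simp add: C_def a_def)
      ultimately have "indicator ?Q x * ennreal (exp (- Y x)) =
          ennreal (\<Prod>i\<in>I. exp (- L * \<bar>real_of_int (a i)\<bar>)) * indicator (C a) x" using True by simp
      also have "\<dots> \<le> (\<Sum>a\<in>A. ennreal (\<Prod>i\<in>I. exp (- L * \<bar>real_of_int (a i)\<bar>)) * indicator (C a) x)"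
        by (rule member_le_sum[OF a _ finA]) auto
      finally show ?thesis .
    qed simp
  qed
  also have "\<dots> = (\<Sum>a\<in>A. ennreal (\<Prod>i\<in>I. exp (- L * \<bar>real_of_int (a i)\<bar>)) * emeasure (leb n) (C a))"
    by (subst nn_integral_sum) (auto simp: nn_integral_cmult)
  also have "\<dots> \<le> (\<Sum>a\<in>A. ennreal (\<Prod>i\<in>I. exp (- L * \<bar>real_of_int (a i)\<bar>)) * emeasure (leb n) T)"
    by (intro sum_mono mult_left_mono cell) auto
  also have "\<dots> = ennreal (\<Sum>a\<in>A. \<Prod>i\<in>I. exp (- L * \<bar>real_of_int (a i)\<bar>)) * emeasure (leb n) T"
    by (simp add: sum_distrib_right[symmetric] sum_ennreal prod_nonneg)
  also have "(\<Sum>a\<in>A. \<Prod>i\<in>I. exp (- L * \<bar>real_of_int (a i)\<bar>)) = (\<Prod>i\<in>I. \<Sum>j\<in>{- int M..int M}. exp (- L * \<bar>real_of_int j\<bar>))"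
    unfolding A_def using I by (subst prod_sum_PiE) auto
  also have "ennreal \<dots> * emeasure (leb n) T \<le> ennreal ((1 + 2 * exp (- L) / (1 - exp (- L))) ^ card I) * emeasure (leb n) T"
  proof (intro mult_right_mono ennreal_leI)
    show "(\<Prod>i\<in>I. \<Sum>j\<in>{- int M..int M}. exp (- L * \<bar>real_of_int j\<bar>)) \<le> (1 + 2 * exp (- L) / (1 - exp (- L))) ^ card I"
      unfolding prod_constant by (rule power_mono[OF weights]) (rule sum_nonneg, simp)
  qed auto
  finally show ?thesis using lower by (simp add: \<mu>_def)
qed

section \<open>Volume of intersections of rotated cubes and bodies\<close>

lemma ln_e_plus_ge_1: "ln (exp 1 + real m) \<ge> 1"
  using ln_mono[of "exp 1" "exp 1 + real m"] by (simp add: add_pos_nonneg)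

lemma Lam_pos: "n \<ge> 1 \<Longrightarrow> Lam m n > 0"
  using ln_e_plus_ge_1[of m] by (simp add: Lam_def)

lemma sets_cbox [measurable]: "{x\<in>Rn n. \<forall>i<n. \<bar>x i\<bar> \<le> r i} \<in> sets borel"
proof -
  have "{x\<in>Rn n. \<forall>i<n. \<bar>x i\<bar> \<le> r i} = Rn n \<inter> {x\<in>space borel. \<forall>i\<in>{..<n}. \<bar>x i\<bar> \<le> r i}" by auto
  also have "\<dots> \<in> sets borel" by measurable
  finally show ?thesis .
qed

text \<open>The intersection of the images of [-r, r]^n under the orthogonal \<open>U i\<close>,
  encoded by slab conditions on the columns of \<open>U i\<close> rather than by images.\<close>

definition rot_cubes :: "nat \<Rightarrow> nat \<Rightarrow> (nat \<Rightarrow> rmat) \<Rightarrow> real \<Rightarrow> rvec set" where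
  "rot_cubes n m U r = {x\<in>Rn n. \<forall>i\<in>{1..m}. \<forall>j<n. \<bar>mat_act n (mtr (U i)) x j\<bar> \<le> r}"

lemma sets_rot_cubes [measurable]: "rot_cubes n m U r \<in> sets borel"
proof -
  have [measurable]: "(\<lambda>x. mat_act n A x j) \<in> borel_measurable borel" for A j unfolding mat_act_def by measurable
  have "rot_cubes n m U r = Rn n \<inter> {x\<in>space borel. \<forall>i\<in>{1..m}. \<forall>j\<in>{..<n}. \<bar>mat_act n (mtr (U i)) x j\<bar> \<le> r}"
    by (auto simp: rot_cubes_def)
  also have "\<dots> \<in> sets borel" by measurable
  finally show ?thesis .
qed

text \<open>With \<open>y = exp 1 + real m\<close> and \<open>L = ln y\<close>, the width
  \<open>s = 4 * sqrt L\<close> gives \<open>exp (- s\<^sup>2 / 8) = 1 / y\<^sup>2\<close>. The cost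
  is then at most 2 n, since \<open>L\<close> and \<open>m\<close> are at most \<open>y\<close>, and
  the partition function is at most (1 + 2 / (y - 1))^(n m) \<le> e^(2 n), since
  \<open>m \<le> y - 1\<close>. Together they give e^(-4 n); rescaling from \<open>s\<close> to
  \<open>r\<close> accounts for the remaining factor.\<close>

lemma rot_cubes_ln:
  assumes U: "\<And>i. i \<in> {1..m} \<Longrightarrow> U i \<in> orth_group n" and r: "r > 0"
  shows "ennreal ((r * exp (-4) / (4 * sqrt (ln (exp 1 + real m)))) ^ n) \<le> emeasure (leb n) (rot_cubes n m U r)"
proof -
  define y where "y = exp 1 + real m"
  define L where "L = ln y"
  define s where "s = 4 * sqrt L"
  define I where "I = {1..m} \<times> {..<n}"
  define u where "u p = (\<lambda>k. U (fst p) k (snd p))" for p :: "nat \<times> nat"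
  have y: "y \<ge> exp 1" "y \<ge> real m + 1" "y > 1"
    using exp_ge_add_one_self[of "1::real"] by (auto simp: y_def)
  have L: "L \<ge> 1" unfolding L_def y_def by (rule ln_e_plus_ge_1)
  have Ly: "L \<le> y" unfolding L_def using y ln_le_minus_one[of y] by simp
  have s2: "s\<^sup>2 = 16 * L" using L by (simp add: s_def power_mult_distrib)
  have "1 \<le> sqrt L" using L by simp
  then have s: "s \<ge> 2" unfolding s_def by linarith
  then have s0: "s > 0" by linarith
  have eL: "exp (- L) = 1 / y" using y by (simp add: L_def exp_minus divide_inverse)
  have es: "exp (- s\<^sup>2 / 8) = 1 / (y * y)"
  proof -
    have "exp (- s\<^sup>2 / 8) = exp (- L) * exp (- L)" unfolding exp_add[symmetric] s2 by simp
    then show ?thesis by (simp add: eL)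
  qed
  have finI: "finite I" by (simp add: I_def)
  define T where "T = {x. \<forall>p\<in>I. \<bar>ip n (u p) x\<bar> \<le> s}"
  have ip_u: "ip n (u (i, j)) x = mat_act n (mtr (U i)) x j" for i j x
    by (simp add: u_def ip_def mat_act_def)
  have T_sets: "T \<in> sets borel"
  proof -
    have [measurable]: "(\<lambda>x. ip n v x) \<in> borel_measurable borel" for v unfolding ip_def by measurable
    have "T = {x\<in>space borel. \<forall>p\<in>I. \<bar>ip n (u p) x\<bar> \<le> s}" by (auto simp: T_def)
    also have "\<dots> \<in> sets borel" using finI by measurable
    finally show ?thesis .
  qed
  have cardI: "real (card I) = real n * real m" by (simp add: I_def)
  have "ennreal (2 ^ n * exp (- (L * real (card I) * (2 * exp (- s\<^sup>2 / 8))))) \<le>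
      ennreal ((1 + 2 * exp (- L) / (1 - exp (- L))) ^ card I) * emeasure (leb n) T"
    unfolding T_def
  proof (rule slabs_volume_ge)
    show "ip n (u p) (u p) = 1" if "p \<in> I" for p
      using that orth_columns[OF U, of "fst p" "snd p" "snd p"] by (auto simp: I_def u_def ip_def)
  qed (use s L in \<open>auto simp: I_def\<close>)
  moreover have "exp (- 2 * real n) \<le> 2 ^ n * exp (- (L * real (card I) * (2 * exp (- s\<^sup>2 / 8))))"
  proof -
    have "(L / y) * (real m / y) \<le> 1 * 1"
      using L y Ly by (intro mult_mono) (auto simp: divide_le_eq)
    then have "2 * real n * ((L / y) * (real m / y)) \<le> 2 * real n * 1"
      by (intro mult_left_mono) auto
    then have "exp (- 2 * real n) \<le> exp (- (L * real (card I) * (2 * exp (- s\<^sup>2 / 8))))"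
      unfolding es cardI by (simp add: mult_ac)
    also have "\<dots> \<le> 2 ^ n * exp (- (L * real (card I) * (2 * exp (- s\<^sup>2 / 8))))" by simp
    finally show ?thesis .
  qed
  moreover have "(1 + 2 * exp (- L) / (1 - exp (- L))) ^ card I \<le> exp (2 * real n)"
  proof -
    have "2 * exp (- L) / (1 - exp (- L)) = 2 / (y - 1)" using y by (simp add: eL field_simps)
    then have "(1 + 2 * exp (- L) / (1 - exp (- L))) ^ card I \<le> exp (2 / (y - 1)) ^ card I"
      using y by (intro power_mono) (auto simp: exp_ge_add_one_self)
    also have "\<dots> = exp (real (card I) * (2 / (y - 1)))" by (rule exp_of_nat_mult[symmetric])
    also have "real (card I) * (2 / (y - 1)) = 2 * real n * (real m / (y - 1))" by (simp add: cardI)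
    also have "exp (2 * real n * (real m / (y - 1))) \<le> exp (2 * real n * 1)"
      using y unfolding exp_le_cancel_iff by (intro mult_left_mono) (auto simp: divide_le_eq)
    finally show ?thesis by simp
  qed
  ultimately have "ennreal (exp (- 2 * real n)) \<le> ennreal (exp (2 * real n)) * emeasure (leb n) T"
    by (meson ennreal_leI mult_right_mono order_trans zero_le)
  then have "ennreal (exp (- 2 * real n)) * ennreal (exp (- 2 * real n)) \<le>
      ennreal (exp (- 2 * real n)) * (ennreal (exp (2 * real n)) * emeasure (leb n) T)"
    by (rule mult_left_mono) simp
  also have "\<dots> = emeasure (leb n) T"
    by (simp add: mult.assoc[symmetric] ennreal_mult[symmetric] exp_add[symmetric])
  also have "ennreal (exp (- 2 * real n)) * ennreal (exp (- 2 * real n)) = ennreal (exp (- 4) ^ n)"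
    by (simp add: ennreal_mult[symmetric] exp_add[symmetric] exp_of_nat_mult[symmetric])
  finally have T_ge: "ennreal (exp (- 4) ^ n) \<le> emeasure (leb n) T" .
  have "ennreal ((r * exp (-4) / (4 * sqrt (ln (exp 1 + real m)))) ^ n) = ennreal ((r / s) ^ n) * ennreal (exp (- 4) ^ n)"
    using r s0 by (simp add: ennreal_mult[symmetric] power_mult_distrib[symmetric] s_def L_def y_def)
  also have "\<dots> \<le> ennreal ((r / s) ^ n) * emeasure (leb n) T" by (rule mult_left_mono[OF T_ge]) simp
  also have "\<dots> = ennreal ((r / s) ^ n) * (\<integral>\<^sup>+x. indicator (rot_cubes n m U r) (\<lambda>i. r / s * x i) \<partial>leb n)"
  proof -
    have "emeasure (leb n) T = (\<integral>\<^sup>+x. indicator T x \<partial>leb n)" using T_sets by simp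
    also have "\<dots> = (\<integral>\<^sup>+x. indicator (rot_cubes n m U r) (\<lambda>i. r / s * x i) \<partial>leb n)"
    proof (rule nn_integral_cong_AE, rule AE_mp[OF AE_leb_Rn], rule AE_I2, rule impI)
      fix x assume x: "x \<in> Rn n"
      have "\<bar>r / s * t\<bar> \<le> r \<longleftrightarrow> \<bar>t\<bar> \<le> s" for t
        using r s0 by (simp add: abs_mult divide_le_eq)
      moreover have "(\<lambda>i. r / s * x i) \<in> rot_cubes n m U r \<longleftrightarrow>
          (\<forall>i\<in>{1..m}. \<forall>j<n. \<bar>r / s * mat_act n (mtr (U i)) x j\<bar> \<le> r)"
        unfolding rot_cubes_def mem_Collect_eq mat_act_scale using x by (simp add: Rn_iff)
      ultimately have "(\<lambda>i. r / s * x i) \<in> rot_cubes n m U r \<longleftrightarrow> x \<in> T"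
        by (simp only:) (auto simp: T_def I_def ip_u)
      then show "indicator T x = (indicator (rot_cubes n m U r) (\<lambda>i. r / s * x i) :: ennreal)"
        by (simp add: indicator_def)
    qed
    finally show ?thesis by simp
  qed
  also have "\<dots> = (\<integral>\<^sup>+x. indicator (rot_cubes n m U r) x \<partial>leb n)"
    using r s0 by (intro nn_integral_leb_scale[symmetric]) auto
  also have "\<dots> = emeasure (leb n) (rot_cubes n m U r)" by simp
  finally show ?thesis .
qed

lemma coord_sq_le_ip: "i < n \<Longrightarrow> (x i)\<^sup>2 \<le> ip n x x"
  unfolding ip_def power2_eq_square by (intro member_le_sum[of i _ "\<lambda>i. x i * x i"]) auto

text \<open>The Euclidean ball of radius \<open>r\<close> lies in every rotated cube and contains a
  cube of half-side \<open>r / sqrt n\<close>. The weaker constant is chosen to agree with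
  \<open>rot_cubes_ln\<close>.\<close>

lemma rot_cubes_dim:
  assumes U: "\<And>i. i \<in> {1..m} \<Longrightarrow> U i \<in> orth_group n" and r: "r > 0" and n: "n \<ge> 1"
  shows "ennreal ((r * exp (-4) / (4 * sqrt (real n))) ^ n) \<le> emeasure (leb n) (rot_cubes n m U r)"
proof -
  let ?B = "{x\<in>Rn n. \<forall>i<n. \<bar>x i\<bar> \<le> r / sqrt (real n)}"
  have "(r * exp (-4) / (4 * sqrt (real n))) ^ n \<le> (2 * (r / sqrt (real n))) ^ n"
  proof (rule power_mono)
    have "exp (- 4 :: real) \<le> 1" by simp
    then have "exp (- 4 :: real) \<le> 8" by linarith
    then have "r * exp (-4) * (1 / (4 * sqrt (real n))) \<le> r * 8 * (1 / (4 * sqrt (real n)))"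
      using r n by (intro mult_right_mono mult_left_mono) auto
    then show "r * exp (-4) / (4 * sqrt (real n)) \<le> 2 * (r / sqrt (real n))" by simp
  qed (use r in auto)
  also have "\<dots> = (\<Prod>i<n. 2 * (r / sqrt (real n)))" by simp
  finally have "ennreal ((r * exp (-4) / (4 * sqrt (real n))) ^ n) \<le> emeasure (leb n) ?B"
    using r by (subst vol_cbox) (auto intro: ennreal_leI)
  also have "\<dots> \<le> emeasure (leb n) (rot_cubes n m U r)"
  proof (rule emeasure_mono)
    show "?B \<subseteq> rot_cubes n m U r"
    proof
      fix x assume x: "x \<in> ?B"
      have "\<bar>mat_act n (mtr (U i)) x j\<bar> \<le> r" if ij: "i \<in> {1..m}" "j < n" for i j
      proof -
        have "(mat_act n (mtr (U i)) x j)\<^sup>2 \<le> ip n (mat_act n (mtr (U i)) x) (mat_act n (mtr (U i)) x)"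
          by (rule coord_sq_le_ip[OF ij(2)])
        also have "\<dots> = ip n x x" by (rule ip_mat_act_orth[OF transp_orth[OF U[OF ij(1)]]])
        also have "\<dots> \<le> (\<Sum>i<n. (r / sqrt (real n))\<^sup>2)"
          unfolding ip_def power2_eq_square[symmetric]
        proof (rule sum_mono)
          fix k assume "k \<in> {..<n}"
          then have "\<bar>x k\<bar> \<le> r / sqrt (real n)" using x by simp
          then have "\<bar>x k\<bar>\<^sup>2 \<le> (r / sqrt (real n))\<^sup>2" by (intro power_mono) auto
          then show "(x k)\<^sup>2 \<le> (r / sqrt (real n))\<^sup>2" by simp
        qed
        also have "\<dots> = r\<^sup>2" using n by (simp add: power_divide)
        finally have "\<bar>mat_act n (mtr (U i)) x j\<bar>\<^sup>2 \<le> r\<^sup>2" by simp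
        then show ?thesis by (rule power2_le_imp_le) (use r in simp)
      qed
      then show "x \<in> rot_cubes n m U r" using x by (simp add: rot_cubes_def)
    qed
  qed simp
  finally show ?thesis .
qed

lemma rot_cubes_volume_ge:
  assumes U: "\<And>i. i \<in> {1..m} \<Longrightarrow> U i \<in> orth_group n" and r: "r > 0" and n: "n \<ge> 1"
  shows "ennreal ((r * exp (-4) / (4 * sqrt (Lam m n))) ^ n) \<le> emeasure (leb n) (rot_cubes n m U r)"
proof (cases "real n \<le> ln (exp 1 + real m)")
  case True
  then show ?thesis using rot_cubes_dim[OF U r n] by (simp add: Lam_def)
next
  case False
  then show ?thesis using rot_cubes_ln[OF U r] by (simp add: Lam_def)
qed

lemma sets_body_inter:
  assumes U: "\<And>i. i \<in> {1..m} \<Longrightarrow> U i \<in> orth_group n"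
    and K: "\<And>i. i \<in> {1..m} \<Longrightarrow> K i \<subseteq> Rn n" "\<And>i. i \<in> {1..m} \<Longrightarrow> K i \<in> sets borel" and m: "m \<ge> 1"
  shows "body_inter n m U K \<in> sets borel"
  unfolding body_inter_def
proof (rule sets.finite_INT)
  show "mat_act n (U i) ` K i \<in> sets borel" if i: "i \<in> {1..m}" for i
  proof -
    note [measurable] = K(2)[OF i]
    have [measurable]: "mat_act n A \<in> measurable borel borel" for A by measurable
    have "mat_act n (U i) ` K i = {x\<in>space borel. x \<in> Rn n \<and> mat_act n (mtr (U i)) x \<in> K i}"
      using mat_act_image_iff[OF U[OF i] K(1)[OF i]] by auto
    also have "\<dots> \<in> sets borel" by measurable
    finally show ?thesis .
  qed
qed (use m in auto)

lemma emeasure_rotate: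
  assumes U: "U \<in> orth_group n" and K: "K \<subseteq> Rn n" and [measurable]: "K \<in> sets borel"
  shows "emeasure (leb n) (mat_act n U ` K) = emeasure (leb n) K"
proof -
  have meas: "mat_act n U ` K \<in> sets borel"
    using sets_body_inter[of 1 "\<lambda>_. U" n "\<lambda>_. K"] U K by (simp add: body_inter_def)
  have "emeasure (leb n) (mat_act n U ` K) = (\<integral>\<^sup>+x. indicator (mat_act n U ` K) x \<partial>leb n)"
    using meas by simp
  also have "\<dots> = (\<integral>\<^sup>+x. indicator K (mat_act n (mtr U) x) \<partial>leb n)"
    by (rule nn_integral_cong_AE, rule AE_mp[OF AE_leb_Rn], rule AE_I2)
       (auto simp: indicator_def mat_act_image_iff[OF U K])
  also have "\<dots> = (\<integral>\<^sup>+x. indicator K x \<partial>leb n)"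
    by (rule nn_integral_leb_orth[OF _ transp_orth[OF U]]) measurable
  finally show ?thesis by simp
qed

text \<open>The inscribed half-side 1/500 and the factor 4 of \<open>rot_cubes_volume_ge\<close>
  make 1/2000. Finiteness of the volume of \<open>K 1\<close> allows passing to \<open>vol\<close>,
  which would be 0 on a set of infinite measure.\<close>

lemma body_inter_volume_ge:
  assumes U: "\<And>i. i \<in> {1..m} \<Longrightarrow> U i \<in> orth_group n"
    and K: "\<And>i. i \<in> {1..m} \<Longrightarrow> K i \<subseteq> Rn n" "\<And>i. i \<in> {1..m} \<Longrightarrow> K i \<in> sets borel"
      "\<And>i. i \<in> {1..m} \<Longrightarrow> emeasure (leb n) (K i) < \<infinity>"
      "\<And>i. i \<in> {1..m} \<Longrightarrow> {x\<in>Rn n. \<forall>j<n. \<bar>x j\<bar> \<le> 1 / 500} \<subseteq> K i"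
    and m: "m \<ge> 1" and n: "n \<ge> 1"
  shows "exp (-4) / 2000 / sqrt (Lam m n) \<le> vol n (body_inter n m U K) powr (1 / real n)"
proof -
  have sub: "rot_cubes n m U (1 / 500) \<subseteq> body_inter n m U K"
    unfolding body_inter_def
  proof (intro INT_greatest subsetI)
    fix i x assume i: "i \<in> {1..m}" and x: "x \<in> rot_cubes n m U (1 / 500)"
    have "mat_act n (mtr (U i)) x \<in> {x\<in>Rn n. \<forall>j<n. \<bar>x j\<bar> \<le> 1 / 500}"
      using x i mat_act_orth_Rn[OF transp_orth[OF U[OF i]]] by (auto simp: rot_cubes_def)
    then have "mat_act n (mtr (U i)) x \<in> K i" using K(4)[OF i] by blast
    then show "x \<in> mat_act n (U i) ` K i"
      using x by (subst mat_act_image_iff[OF U[OF i] K(1)[OF i]]) (simp add: rot_cubes_def)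
  qed
  have meas: "body_inter n m U K \<in> sets borel" by (rule sets_body_inter[OF U K(1,2) m])
  have one: "1 \<in> {1..m}" using m by simp
  have "emeasure (leb n) (body_inter n m U K) \<le> emeasure (leb n) (mat_act n (U 1) ` K 1)"
  proof (rule emeasure_mono)
    show "body_inter n m U K \<subseteq> mat_act n (U 1) ` K 1" using one by (auto simp: body_inter_def)
    show "mat_act n (U 1) ` K 1 \<in> sets (leb n)"
      using sets_body_inter[of 1 U n K] U K one by (simp add: body_inter_def)
  qed
  also have "\<dots> < \<infinity>" using emeasure_rotate[OF U[OF one] K(1,2)[OF one]] K(3)[OF one] by simp
  finally have fin: "emeasure (leb n) (body_inter n m U K) = ennreal (vol n (body_inter n m U K))"
    by (intro emeasure_eq_ennreal_measure) auto
  let ?c = "1 / 500 * exp (-4) / (4 * sqrt (Lam m n))"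
  have "ennreal (?c ^ n) \<le> emeasure (leb n) (rot_cubes n m U (1 / 500))"
    by (rule rot_cubes_volume_ge[OF U _ n]) auto
  also have "\<dots> \<le> emeasure (leb n) (body_inter n m U K)"
    using sub by (rule emeasure_mono) (simp add: meas)
  finally have "?c ^ n \<le> vol n (body_inter n m U K)"
    unfolding fin by (subst (asm) ennreal_le_iff) auto
  then have "(?c ^ n) powr (1 / real n) \<le> vol n (body_inter n m U K) powr (1 / real n)"
    using Lam_pos[OF n, of m] by (intro powr_mono2) auto
  also have "(?c ^ n) powr (1 / real n) = ?c"
    using Lam_pos[OF n, of m] n by (subst powr_realpow[symmetric]) (auto simp: powr_powr)
  finally show ?thesis by simp
qed

subsection \<open>Haar measure\<close>

lemma measurable_row [measurable]: "(\<lambda>A::rmat. A i) \<in> measurable borel borel"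
  by (rule measurable_product_coordinates)

lemma measurable_rmat_iff:
  "f \<in> measurable M (borel :: rmat measure) \<longleftrightarrow> (\<forall>i j. (\<lambda>x. f x i j) \<in> borel_measurable M)"
proof safe
  fix i j assume f: "f \<in> measurable M (borel :: rmat measure)"
  show "(\<lambda>x. f x i j) \<in> borel_measurable M"
    by (rule measurable_compose[OF measurable_compose[OF f measurable_row] measurable_coord])
next
  assume "\<forall>i j. (\<lambda>x. f x i j) \<in> borel_measurable M"
  then have "(\<lambda>x. f x i) \<in> measurable M borel" for i by (simp add: measurable_rvec_iff)
  then show "f \<in> measurable M borel" by (rule measurable_coordinatewise_then_product)
qed

lemma orth_mat_mult:
  assumes A: "A \<in> orth_group n" and B: "B \<in> orth_group n"
  shows "mat_mult n A B \<in> orth_group n"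
proof (rule orth_groupI)
  fix j k assume "j < n" "k < n"
  have col: "mat_mult n A B i j = mat_act n A (\<lambda>l. B l j) i" for i j
    by (simp add: mat_mult_def mat_act_def)
  have "(\<Sum>i<n. mat_mult n A B i j * mat_mult n A B i k) = ip n (mat_act n A (\<lambda>l. B l j)) (mat_act n A (\<lambda>l. B l k))"
    by (simp add: ip_def col)
  also have "\<dots> = ip n (\<lambda>l. B l j) (\<lambda>l. B l k)" by (rule ip_mat_act_orth[OF A])
  also have "\<dots> = (if j = k then 1 else 0)"
    using orth_columns[OF B \<open>j < n\<close> \<open>k < n\<close>] by (simp add: ip_def)
  finally show "(\<Sum>i<n. mat_mult n A B i j * mat_mult n A B i k) = (if j = k then 1 else 0)" .
next
  fix i j assume "\<not> (i < n \<and> j < n)"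
  then show "mat_mult n A B i j = 0"
    using orth_zero[OF A] orth_zero[OF B] by (cases "i < n") (auto simp: mat_mult_def)
qed

lemma cube_eq_cbox: "cube n = {x\<in>Rn n. \<forall>i<n. \<bar>x i\<bar> \<le> 1 / 2}"
  by (auto simp: cube_def abs_le_iff minus_le_iff)

lemma sets_cube [measurable]: "cube n \<in> sets borel"
  unfolding cube_eq_cbox by (rule sets_cbox)

lemma emeasure_cube: "emeasure (leb n) (cube n) = 1"
  unfolding cube_eq_cbox by (subst vol_cbox) auto

locale haar_measure =
  fixes n :: nat and \<mu> :: "rmat measure"
  assumes haar: "haar_prob n \<mu>"
begin

lemma sets_eq: "sets \<mu> = sets (restrict_space borel (orth_group n))"
  using haar by (simp add: haar_prob_def)

lemma space_eq: "space \<mu> = orth_group n"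
  using sets_eq_imp_space_eq[OF sets_eq] by (simp add: space_restrict_space)

sublocale prob_space \<mu>
  using haar by (simp add: haar_prob_def)

lemma entry_measurable [measurable]: "(\<lambda>U. U i j) \<in> borel_measurable \<mu>"
proof -
  have "(\<lambda>U::rmat. U i j) \<in> borel_measurable borel"
    by (rule measurable_compose[OF measurable_row measurable_coord])
  then have "(\<lambda>U::rmat. U i j) \<in> borel_measurable (restrict_space borel (orth_group n))"
    by (rule measurable_restrict_space1)
  then show ?thesis by (subst measurable_cong_sets[OF sets_eq refl])
qed

lemma mat_mult_measurable [measurable]:
  assumes A: "A \<in> orth_group n"
  shows "mat_mult n A \<in> measurable \<mu> \<mu>"
proof -
  have "mat_mult n A \<in> measurable \<mu> borel"
    unfolding measurable_rmat_iff mat_mult_def by measurable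
  then have "mat_mult n A \<in> measurable \<mu> (restrict_space borel (orth_group n))"
    by (rule measurable_restrict_space2[rotated]) (use A orth_mat_mult in \<open>auto simp: space_eq\<close>)
  then show ?thesis by (subst measurable_cong_sets[OF refl sets_eq])
qed

text \<open>For \<open>x\<close> in \<open>Rn n\<close> and \<open>S\<close> inside
  \<open>Rn n\<close> this is the probability that the random image of \<open>S\<close> contains
  \<open>x\<close>, the function \<phi> of the overview when \<open>S\<close> is the cube.\<close>

definition hit :: "rvec set \<Rightarrow> rvec \<Rightarrow> ennreal" where
  "hit S x = emeasure \<mu> {U\<in>space \<mu>. mat_act n (mtr U) x \<in> S}"

lemma act_measurable [measurable]: "(\<lambda>U. mat_act n (mtr U) x) \<in> measurable \<mu> borel"
  unfolding measurable_rvec_iff mat_act_def by measurable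

lemma act_pair_measurable [measurable]:
  "(\<lambda>(U, x). mat_act n (mtr U) x) \<in> measurable (\<mu> \<Otimes>\<^sub>M leb n) borel"
proof -
  have [measurable]: "(\<lambda>p. snd p j) \<in> borel_measurable (\<mu> \<Otimes>\<^sub>M leb n)" for j
    by (rule measurable_compose[OF measurable_snd]) simp
  have [measurable]: "(\<lambda>p. fst p i j) \<in> borel_measurable (\<mu> \<Otimes>\<^sub>M leb n)" for i j
    by (rule measurable_compose[OF measurable_fst]) measurable
  show ?thesis
    unfolding measurable_rvec_iff mat_act_def split_beta' by measurable
qed

lemma hit_eq_nn_integral:
  assumes [measurable]: "S \<in> sets borel"
  shows "hit S x = (\<integral>\<^sup>+U. indicator S (mat_act n (mtr U) x) \<partial>\<mu>)"
proof -
  have "(\<integral>\<^sup>+U. indicator S (mat_act n (mtr U) x) \<partial>\<mu>) =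
      (\<integral>\<^sup>+U. indicator {U\<in>space \<mu>. mat_act n (mtr U) x \<in> S} U \<partial>\<mu>)"
    by (rule nn_integral_cong) (auto simp: indicator_def)
  also have "\<dots> = hit S x" unfolding hit_def by (rule nn_integral_indicator) measurable
  finally show ?thesis ..
qed

lemma hit_measurable [measurable]:
  assumes [measurable]: "S \<in> sets borel"
  shows "hit S \<in> borel_measurable borel"
proof -
  have "(\<lambda>p. indicator S (mat_act n (mtr (fst p)) (snd p)) :: ennreal) \<in> borel_measurable (\<mu> \<Otimes>\<^sub>M leb n)"
    using measurable_compose[OF act_pair_measurable borel_measurable_indicator[OF assms]] by (simp add: split_beta')
  then have "(\<lambda>p. indicator S (mat_act n (mtr (snd p)) (fst p)) :: ennreal) \<in> borel_measurable (leb n \<Otimes>\<^sub>M \<mu>)"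
    by (subst measurable_pair_swap_iff) (simp add: split_beta')
  then have "(\<lambda>x. \<integral>\<^sup>+U. indicator S (mat_act n (mtr U) x) \<partial>\<mu>) \<in> borel_measurable (leb n)"
    using borel_measurable_nn_integral[of "\<lambda>x U. indicator S (mat_act n (mtr U) x)" "leb n"] by (simp add: split_beta')
  moreover have "hit S = (\<lambda>x. \<integral>\<^sup>+U. indicator S (mat_act n (mtr U) x) \<partial>\<mu>)"
    by (rule ext) (rule hit_eq_nn_integral[OF assms])
  ultimately show ?thesis by simp
qed

lemma hit_le_1: "hit S x \<le> 1"
  unfolding hit_def by (rule emeasure_le_1)

text \<open>The point where invariance of the Haar measure enters: replacing \<open>U\<close> by
  \<open>A^T U\<close> replaces \<open>U^T x\<close> by \<open>U^T A x\<close>.\<close>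

lemma hit_rotate:
  assumes A: "A \<in> orth_group n" and [measurable]: "S \<in> sets borel"
  shows "hit S (mat_act n A x) = hit S x"
proof -
  have TA: "mtr A \<in> orth_group n" by (rule transp_orth[OF A])
  have act: "mat_act n (mtr (mat_mult n (mtr A) U)) x = mat_act n (mtr U) (mat_act n A x)" for U
    unfolding transp_mat_mult mat_act_mat_mult ..
  have "hit S x = emeasure (distr \<mu> \<mu> (mat_mult n (mtr A))) {U\<in>space \<mu>. mat_act n (mtr U) x \<in> S}"
    using haar TA by (simp add: hit_def haar_prob_def)
  also have "\<dots> = emeasure \<mu> (mat_mult n (mtr A) -` {U\<in>space \<mu>. mat_act n (mtr U) x \<in> S} \<inter> space \<mu>)"
    by (rule emeasure_distr[OF mat_mult_measurable[OF TA]]) measurable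
  also have "mat_mult n (mtr A) -` {U\<in>space \<mu>. mat_act n (mtr U) x \<in> S} \<inter> space \<mu> =
      {U\<in>space \<mu>. mat_act n (mtr U) (mat_act n A x) \<in> S}"
    using orth_mat_mult[OF TA] by (auto simp: space_eq act)
  finally show ?thesis by (simp add: hit_def)
qed

lemma hit_star_shaped:
  assumes [measurable]: "S \<in> sets borel" and star: "\<And>x t. x \<in> S \<Longrightarrow> 0 \<le> t \<Longrightarrow> t \<le> 1 \<Longrightarrow> (\<lambda>i. t * x i) \<in> S"
    and t: "0 \<le> t" "t \<le> 1"
  shows "hit S x \<le> hit S (\<lambda>i. t * x i)"
  unfolding hit_def by (rule emeasure_mono) (use star t in \<open>auto simp: mat_act_scale\<close>, measurable)

text \<open>Shrink \<open>y\<close> to the norm of \<open>x\<close>, which star-shapedness allows,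
  and then rotate it onto \<open>x\<close>.\<close>

lemma hit_antimono:
  assumes S: "S \<in> sets borel" and star: "\<And>x t. x \<in> S \<Longrightarrow> 0 \<le> t \<Longrightarrow> t \<le> 1 \<Longrightarrow> (\<lambda>i. t * x i) \<in> S"
    and xy: "x \<in> Rn n" "y \<in> Rn n" "ip n x x \<le> ip n y y"
  shows "hit S y \<le> hit S x"
proof -
  \<comment> \<open>The ratio of the norms. If \<open>y\<close> has norm 0, division by zero makes
    \<open>t = 0\<close>, and \<open>x\<close> has norm 0 as well.\<close>
  define t where "t = sqrt (ip n x x / ip n y y)"
  have t: "0 \<le> t" "t \<le> 1" using xy(3) ip_nonneg[of n x] ip_nonneg[of n y] by (auto simp: t_def divide_le_eq)
  have ip_t: "ip n (\<lambda>i. t * y i) (\<lambda>i. t * y i) = t\<^sup>2 * ip n y y"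
    by (simp add: ip_def sum_distrib_left power2_eq_square mult_ac)
  have "t\<^sup>2 * ip n y y = ip n x x"
    using xy(3) ip_nonneg[of n x] ip_nonneg[of n y] by (cases "ip n y y = 0") (auto simp: t_def)
  then obtain A where A: "A \<in> orth_group n" "mat_act n A x = (\<lambda>i. t * y i)"
    using orth_transitive[OF xy(1), of "\<lambda>i. t * y i"] xy(2) ip_t by (auto simp: Rn_iff)
  have "hit S y \<le> hit S (\<lambda>i. t * y i)" by (rule hit_star_shaped[OF S star t])
  also have "\<dots> = hit S x" using hit_rotate[OF A(1) S, of x] A(2) by simp
  finally show ?thesis .
qed

text \<open>For each fixed rotation, a change of variables leaves both Lebesgue measure and the
  radial weight unchanged, so the average over rotations is invisible to such a weight.\<close>

lemma nn_integral_radial_hit: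
  assumes [measurable]: "S \<in> sets borel" "w \<in> borel_measurable borel"
    and radial: "\<And>A x. A \<in> orth_group n \<Longrightarrow> w (mat_act n A x) = w x"
  shows "(\<integral>\<^sup>+x. w x * hit S x \<partial>leb n) = (\<integral>\<^sup>+x. w x * indicator S x \<partial>leb n)"
proof -
  interpret P: pair_sigma_finite \<mu> "leb n" by standard
  have [measurable]: "(\<lambda>p. indicator S (mat_act n (mtr (fst p)) (snd p)) :: ennreal) \<in> borel_measurable (\<mu> \<Otimes>\<^sub>M leb n)"
    using measurable_compose[OF act_pair_measurable borel_measurable_indicator[OF assms(1)]] by (simp add: split_beta')
  have [measurable]: "(\<lambda>p. w (snd p)) \<in> borel_measurable (\<mu> \<Otimes>\<^sub>M leb n)"
    by (rule measurable_compose[OF measurable_snd]) simp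
  have "(\<integral>\<^sup>+x. w x * hit S x \<partial>leb n) = (\<integral>\<^sup>+x. \<integral>\<^sup>+U. w x * indicator S (mat_act n (mtr U) x) \<partial>\<mu> \<partial>leb n)"
    unfolding hit_eq_nn_integral[OF assms(1)]
    by (intro nn_integral_cong nn_integral_cmult[symmetric]) measurable
  also have "\<dots> = (\<integral>\<^sup>+U. \<integral>\<^sup>+x. w x * indicator S (mat_act n (mtr U) x) \<partial>leb n \<partial>\<mu>)"
    by (rule P.Fubini') (simp add: split_beta')
  also have "\<dots> = (\<integral>\<^sup>+U. \<integral>\<^sup>+x. w x * indicator S x \<partial>leb n \<partial>\<mu>)"
  proof (rule nn_integral_cong)
    fix U assume "U \<in> space \<mu>"
    then have TU: "mtr U \<in> orth_group n" using transp_orth by (simp add: space_eq)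
    show "(\<integral>\<^sup>+x. w x * indicator S (mat_act n (mtr U) x) \<partial>leb n) = (\<integral>\<^sup>+x. w x * indicator S x \<partial>leb n)"
      using nn_integral_leb_orth[OF _ TU, of "\<lambda>x. w x * indicator S x"] by (simp add: radial[OF TU])
  qed
  also have "\<dots> = (\<integral>\<^sup>+x. w x * indicator S x \<partial>leb n)" by (simp add: emeasure_space_1)
  finally show ?thesis .
qed

text \<open>Tonelli and independence: for fixed \<open>x\<close> the \<open>m - 1\<close> random
  conditions are independent, each with probability \<open>hit S x\<close>, while the identity
  rotation contributes the indicator of \<open>S\<close>.\<close>

lemma body_inter_expectation:
  assumes m: "m \<ge> 2" and S[measurable]: "S \<in> sets borel" and SR: "S \<subseteq> Rn n"
  defines "P \<equiv> Pi\<^sub>M {2..m} (\<lambda>_::nat. \<mu>)"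
  shows "(\<lambda>V. emeasure (leb n) (body_inter n m (with_id n V) (\<lambda>_. S))) \<in> borel_measurable P"
    and "(\<integral>\<^sup>+V. emeasure (leb n) (body_inter n m (with_id n V) (\<lambda>_. S)) \<partial>P) =
      (\<integral>\<^sup>+x. indicator S x * hit S x ^ (m - 1) \<partial>leb n)"
proof -
  interpret PP: product_prob_space "\<lambda>_::nat. \<mu>" "{2..m}" by standard
  have "prob_space P" unfolding P_def by (rule prob_space_PiM) (rule prob_space_axioms)
  then interpret P: prob_space P .
  interpret PL: pair_sigma_finite P "leb n" by standard
  define g where "g V x = indicator S x * (\<Prod>i\<in>{2..m}. indicator S (mat_act n (mtr (V i)) x) :: ennreal)"
    for V :: "nat \<Rightarrow> rmat" and x
  have V_orth: "V i \<in> orth_group n" if "V \<in> space P" "i \<in> {2..m}" for V i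
    using that by (auto simp: P_def space_PiM space_eq)
  have [measurable]: "(\<lambda>V. V i) \<in> measurable P \<mu>" if "i \<in> {2..m}" for i
    unfolding P_def using that by (rule measurable_component_singleton)
  have act[measurable]: "(\<lambda>p. mat_act n (mtr (fst p i)) (snd p)) \<in> measurable (P \<Otimes>\<^sub>M leb n) borel" if i: "i \<in> {2..m}" for i
  proof -
    have [measurable]: "(\<lambda>p. fst p i) \<in> measurable (P \<Otimes>\<^sub>M leb n) \<mu>"
      using i by (intro measurable_compose[OF measurable_fst]) measurable
    have [measurable]: "(\<lambda>p. fst p i j k) \<in> borel_measurable (P \<Otimes>\<^sub>M leb n)" for j k
      by (rule measurable_compose[OF _ entry_measurable]) measurable
    have [measurable]: "(\<lambda>p. snd p j) \<in> borel_measurable (P \<Otimes>\<^sub>M leb n)" for j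
      by (rule measurable_compose[OF measurable_snd]) simp
    show ?thesis unfolding measurable_rvec_iff mat_act_def by measurable
  qed
  have [measurable]: "(\<lambda>p. snd p) \<in> measurable (P \<Otimes>\<^sub>M leb n) borel"
    using measurable_snd[of P "leb n"] by (simp add: measurable_cong_sets[OF refl sets_leb])
  have gm: "(\<lambda>p. g (fst p) (snd p)) \<in> borel_measurable (P \<Otimes>\<^sub>M leb n)"
    unfolding g_def by measurable
  have vol: "emeasure (leb n) (body_inter n m (with_id n V) (\<lambda>_. S)) = (\<integral>\<^sup>+x. g V x \<partial>leb n)"
    if V: "V \<in> space P" for V
  proof -
    have U: "with_id n V i \<in> orth_group n" if "i \<in> {1..m}" for i
      using that V_orth[OF V, of i] id_mat_orth by (auto simp: with_id_def)
    have "body_inter n m (with_id n V) (\<lambda>_. S) \<in> sets borel"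
      by (rule sets_body_inter) (use U SR S m in auto)
    then have "emeasure (leb n) (body_inter n m (with_id n V) (\<lambda>_. S)) =
        (\<integral>\<^sup>+x. indicator (body_inter n m (with_id n V) (\<lambda>_. S)) x \<partial>leb n)" by simp
    also have "\<dots> = (\<integral>\<^sup>+x. g V x \<partial>leb n)"
    proof (rule nn_integral_cong_AE, rule AE_mp[OF AE_leb_Rn], rule AE_I2, rule impI)
      fix x assume x: "x \<in> Rn n"
      have "{1..m} = insert 1 {2..m}" using m by auto
      then have "x \<in> body_inter n m (with_id n V) (\<lambda>_. S) \<longleftrightarrow>
          x \<in> mat_act n (with_id n V 1) ` S \<and> (\<forall>i\<in>{2..m}. x \<in> mat_act n (with_id n V i) ` S)"
        by (auto simp: body_inter_def)
      also have "x \<in> mat_act n (with_id n V 1) ` S \<longleftrightarrow> x \<in> S"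
      proof -
        have "mat_act n (id_mat n) ` S = (\<lambda>x. x) ` S"
          by (rule image_cong) (use SR mat_act_id in auto)
        then show ?thesis by (simp add: with_id_def)
      qed
      also have "(\<forall>i\<in>{2..m}. x \<in> mat_act n (with_id n V i) ` S) \<longleftrightarrow> (\<forall>i\<in>{2..m}. mat_act n (mtr (V i)) x \<in> S)"
      proof (rule ball_cong[OF refl])
        fix i assume "i \<in> {2..m}"
        then show "x \<in> mat_act n (with_id n V i) ` S \<longleftrightarrow> mat_act n (mtr (V i)) x \<in> S"
          using mat_act_image_iff[OF V_orth[OF V] SR, of i x] x by (simp add: with_id_def)
      qed
      finally have iff: "x \<in> body_inter n m (with_id n V) (\<lambda>_. S) \<longleftrightarrow>
          x \<in> S \<and> (\<forall>i\<in>{2..m}. mat_act n (mtr (V i)) x \<in> S)" .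
      have "(\<Prod>i\<in>{2..m}. indicator S (mat_act n (mtr (V i)) x) :: ennreal) =
          (if \<forall>i\<in>{2..m}. mat_act n (mtr (V i)) x \<in> S then 1 else 0)"
        by (auto simp: indicator_def)
      then show "indicator (body_inter n m (with_id n V) (\<lambda>_. S)) x = g V x"
        using iff by (simp add: g_def indicator_def)
    qed
    finally show ?thesis .
  qed
  have "(\<lambda>V. \<integral>\<^sup>+x. g V x \<partial>leb n) \<in> borel_measurable P"
    by (rule leb.borel_measurable_nn_integral) (use gm in \<open>simp add: split_beta'\<close>)
  then show "(\<lambda>V. emeasure (leb n) (body_inter n m (with_id n V) (\<lambda>_. S))) \<in> borel_measurable P"
    by (rule measurable_cong[THEN iffD1, rotated]) (simp add: vol)
  have "(\<integral>\<^sup>+V. emeasure (leb n) (body_inter n m (with_id n V) (\<lambda>_. S)) \<partial>P) = (\<integral>\<^sup>+V. \<integral>\<^sup>+x. g V x \<partial>leb n \<partial>P)"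
    by (rule nn_integral_cong) (rule vol)
  also have "\<dots> = (\<integral>\<^sup>+x. \<integral>\<^sup>+V. g V x \<partial>P \<partial>leb n)"
    by (rule PL.Fubini'[symmetric]) (use gm in \<open>simp add: split_beta'\<close>)
  also have "\<dots> = (\<integral>\<^sup>+x. indicator S x * hit S x ^ (m - 1) \<partial>leb n)"
  proof (rule nn_integral_cong)
    fix x
    have "(\<integral>\<^sup>+V. g V x \<partial>P) = indicator S x * (\<integral>\<^sup>+V. (\<Prod>i\<in>{2..m}. indicator S (mat_act n (mtr (V i)) x)) \<partial>P)"
      unfolding g_def
    proof (rule nn_integral_cmult)
      have "(\<lambda>V. mat_act n (mtr (V i)) x) \<in> measurable P borel" if "i \<in> {2..m}" for i
        using that by (intro measurable_compose[OF _ act_measurable]) measurable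
      then show "(\<lambda>V. \<Prod>i\<in>{2..m}. indicator S (mat_act n (mtr (V i)) x) :: ennreal) \<in> borel_measurable P"
        by measurable
    qed
    also have "(\<integral>\<^sup>+V. (\<Prod>i\<in>{2..m}. indicator S (mat_act n (mtr (V i)) x)) \<partial>P) =
        (\<Prod>i\<in>{2..m}. \<integral>\<^sup>+U. indicator S (mat_act n (mtr U) x) \<partial>\<mu>)"
      unfolding P_def by (rule PP.product_nn_integral_prod) measurable
    also have "\<dots> = hit S x ^ (m - 1)"
      unfolding hit_eq_nn_integral[OF S, symmetric] using m by simp
    finally show "(\<integral>\<^sup>+V. g V x \<partial>P) = indicator S x * hit S x ^ (m - 1)" .
  qed
  finally show "(\<integral>\<^sup>+V. emeasure (leb n) (body_inter n m (with_id n V) (\<lambda>_. S)) \<partial>P) =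
      (\<integral>\<^sup>+x. indicator S x * hit S x ^ (m - 1) \<partial>leb n)" .
qed

end

subsection \<open>Expected volume for cubes\<close>

text \<open>The mass outside the interval is bounded below on two adjacent intervals of length
  \<delta> = 1 / (2 sqrt \<Lambda>). At their far ends the exponent is (sqrt \<Lambda> + 1)^2 / 4
  \<le> \<Lambda>/2 + 1/2; then e^(-1/2) \<ge> 1/2 and sqrt pi \<le> 2 give the factor 1/4.\<close>

lemma gauss_Icc_le:
  assumes \<Lambda>: "\<Lambda> > 0"
  shows "(\<integral>\<^sup>+t. indicator {-1/2..1/2} t * ennreal (exp (- \<Lambda> * t\<^sup>2)) \<partial>lborel) \<le>
    ennreal (sqrt (pi / \<Lambda>) * (1 - exp (- \<Lambda> / 2) / 4))"
proof -
  let ?f = "\<lambda>t. ennreal (exp (- \<Lambda> * t\<^sup>2))"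
  let ?J = "\<integral>\<^sup>+t. indicator {-1/2..1/2} t * ?f t \<partial>lborel"
  define \<delta> where "\<delta> = 1 / (2 * sqrt \<Lambda>)"
  define c where "c = exp (- \<Lambda> * (1 / 2 + \<delta>)\<^sup>2)"
  have \<delta>: "\<delta> > 0" using \<Lambda> by (simp add: \<delta>_def)
  have c: "c > 0" by (simp add: c_def)
  have c_le: "ennreal c \<le> ?f t" if "\<bar>t\<bar> \<le> 1 / 2 + \<delta>" for t
  proof -
    have "\<bar>t\<bar>\<^sup>2 \<le> (1 / 2 + \<delta>)\<^sup>2" using that by (intro power_mono) auto
    then show ?thesis using \<Lambda> by (auto simp: c_def intro!: ennreal_leI)
  qed
  let ?A = "{1/2<..1/2 + \<delta>}" and ?B = "{- (1/2 + \<delta>)..<-1/2}"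
  have "?J + (ennreal c * ennreal \<delta> + ennreal c * ennreal \<delta>) =
      ?J + ((\<integral>\<^sup>+t. ennreal c * indicator ?A t \<partial>lborel) + (\<integral>\<^sup>+t. ennreal c * indicator ?B t \<partial>lborel))"
    using \<delta> by (simp add: nn_integral_cmult)
  also have "\<dots> = (\<integral>\<^sup>+t. indicator {-1/2..1/2} t * ?f t + (ennreal c * indicator ?A t + ennreal c * indicator ?B t) \<partial>lborel)"
    by (simp add: nn_integral_add)
  also have "\<dots> \<le> (\<integral>\<^sup>+t. ?f t \<partial>lborel)"
  proof (rule nn_integral_mono)
    fix t
    show "indicator {-1/2..1/2} t * ?f t + (ennreal c * indicator ?A t + ennreal c * indicator ?B t) \<le> ?f t"
      using c_le[of t] by (auto simp: indicator_def abs_if)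
  qed
  also have "\<dots> = ennreal (sqrt (pi / \<Lambda>))" by (rule nn_integral_gauss[OF \<Lambda>])
  finally have "?J + (ennreal c * ennreal \<delta> + ennreal c * ennreal \<delta>) \<le> ennreal (sqrt (pi / \<Lambda>))" .
  also have "ennreal c * ennreal \<delta> + ennreal c * ennreal \<delta> = ennreal (2 * \<delta> * c)"
    using c \<delta> by (simp add: ennreal_mult[symmetric] ennreal_plus[symmetric] del: ennreal_plus)
  finally have J: "?J + ennreal (2 * \<delta> * c) \<le> ennreal (sqrt (pi / \<Lambda>))" .
  have "sqrt (pi / \<Lambda>) * (exp (- \<Lambda> / 2) / 4) \<le> 2 * \<delta> * c"
  proof -
    have eq: "\<Lambda> * (1 / 2 + \<delta>)\<^sup>2 = (sqrt \<Lambda> + 1)\<^sup>2 / 4"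
    proof -
      have "sqrt \<Lambda> * (1 / 2 + \<delta>) = (sqrt \<Lambda> + 1) / 2" using \<Lambda> by (simp add: \<delta>_def field_simps)
      then have "(sqrt \<Lambda> * (1 / 2 + \<delta>))\<^sup>2 = ((sqrt \<Lambda> + 1) / 2)\<^sup>2" by (rule arg_cong)
      then show ?thesis using \<Lambda> by (simp add: power_mult_distrib power_divide)
    qed
    have "(sqrt \<Lambda> + 1)\<^sup>2 \<le> 2 * \<Lambda> + 2"
      using zero_le_power2[of "sqrt \<Lambda> - 1"] \<Lambda> by (simp add: power2_eq_square algebra_simps)
    then have "exp (- \<Lambda> / 2) * exp (- 1 / 2) \<le> c"
      unfolding c_def exp_add[symmetric] by (simp add: eq)
    moreover have "1 / 2 \<le> exp (- 1 / 2 :: real)" using exp_ge_add_one_self[of "- 1 / 2 :: real"] by simp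
    ultimately have c_ge: "exp (- \<Lambda> / 2) * (1 / 2) \<le> c"
      by (meson exp_ge_zero mult_left_mono order_trans)
    have "sqrt pi \<le> 2" using pi_less_4 real_sqrt_le_mono[of pi 4] by simp
    then have "sqrt pi * (exp (- \<Lambda> / 2) / 4) \<le> 2 * (exp (- \<Lambda> / 2) / 4)" by (intro mult_right_mono) auto
    then have "sqrt pi * (exp (- \<Lambda> / 2) / 4) \<le> c" using c_ge by linarith
    then have "sqrt pi * (exp (- \<Lambda> / 2) / 4) * (1 / sqrt \<Lambda>) \<le> c * (1 / sqrt \<Lambda>)"
      using \<Lambda> by (intro mult_right_mono) auto
    then show ?thesis by (simp add: \<delta>_def real_sqrt_divide)
  qed
  then have "?J + ennreal (sqrt (pi / \<Lambda>) * (exp (- \<Lambda> / 2) / 4)) \<le> ennreal (sqrt (pi / \<Lambda>))"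
    using J by (meson add_left_mono ennreal_leI order_trans)
  then have "?J \<le> ennreal (sqrt (pi / \<Lambda>)) - ennreal (sqrt (pi / \<Lambda>) * (exp (- \<Lambda> / 2) / 4))"
    by (simp add: ennreal_le_minus_iff)
  also have "\<dots> = ennreal (sqrt (pi / \<Lambda>) * (1 - exp (- \<Lambda> / 2) / 4))"
    using \<Lambda> by (subst ennreal_minus) (auto simp: algebra_simps)
  finally show ?thesis .
qed

lemma sets_ip_ball [measurable]: "{x::rvec. ip n x x \<le> c} \<in> sets borel"
proof -
  have "{x\<in>space borel. ip n x x \<le> c} \<in> sets (borel :: rvec measure)" unfolding ip_def by measurable
  then show ?thesis by simp
qed

text \<open>By Cauchy-Schwarz the ball lies in an l1 ball with
  \<open>r = sqrt 8 / sqrt \<Lambda>\<close>; the constant is 2 e sqrt 8 \<le> 2 * 3 * 3.\<close>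

lemma vol_ball_le:
  assumes \<Lambda>: "\<Lambda> > 0" and n: "n \<ge> 1"
  shows "emeasure (leb n) {x. ip n x x \<le> 8 * real n / \<Lambda>} \<le> ennreal ((18 / sqrt \<Lambda>) ^ n)"
proof -
  define r where "r = sqrt 8 / sqrt \<Lambda>"
  have r: "r > 0" using \<Lambda> by (simp add: r_def)
  have "emeasure (leb n) {x. ip n x x \<le> 8 * real n / \<Lambda>} \<le> emeasure (leb n) {x. (\<Sum>i<n. \<bar>x i\<bar>) \<le> real n * r}"
  proof (rule emeasure_mono)
    show "{x. ip n x x \<le> 8 * real n / \<Lambda>} \<subseteq> {x::rvec. (\<Sum>i<n. \<bar>x i\<bar>) \<le> real n * r}"
    proof safe
      fix x assume x: "ip n x x \<le> 8 * real n / \<Lambda>"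
      have "(\<Sum>i<n. \<bar>x i\<bar> * 1)\<^sup>2 \<le> (\<Sum>i<n. \<bar>x i\<bar>\<^sup>2) * (\<Sum>i<n. 1\<^sup>2)" by (rule Cauchy_Schwarz_ineq_sum)
      also have "\<dots> = real n * ip n x x" by (simp add: ip_def power2_eq_square)
      also have "\<dots> \<le> real n * (8 * real n / \<Lambda>)" using x by (intro mult_left_mono) auto
      also have "\<dots> = (real n * r)\<^sup>2" using \<Lambda> by (simp add: r_def power_mult_distrib power_divide power2_eq_square)
      finally show "(\<Sum>i<n. \<bar>x i\<bar>) \<le> real n * r"
        using r by (auto intro: power2_le_imp_le)
    qed
  qed (simp add: sets_sum_abs_le)
  also have "\<dots> \<le> ennreal ((2 * exp 1 * r) ^ n)" by (rule vol_l1_ball[OF r])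
  also have "\<dots> \<le> ennreal ((18 / sqrt \<Lambda>) ^ n)"
  proof (intro ennreal_leI power_mono)
    have "sqrt 8 \<le> 3" using real_sqrt_le_mono[of 8 "3\<^sup>2"] by simp
    then have "exp 1 * sqrt 8 \<le> 3 * 3" using exp_le by (intro mult_mono) auto
    then have "2 * (exp 1 * sqrt 8) * (1 / sqrt \<Lambda>) \<le> 18 * (1 / sqrt \<Lambda>)" using \<Lambda> by (intro mult_right_mono) auto
    then show "2 * exp 1 * r \<le> 18 / sqrt \<Lambda>" by (simp add: r_def)
  qed (use r in auto)
  finally show ?thesis .
qed

text \<open>The right side bounds below the share of Gaussian mass kept by the ball in
  \<open>hit_cube_le\<close>; the left side is the half of the gain given up to absorb the lost
  share. With \<open>b = n * exp (- n / 2)\<close> both are compared with \<open>1 - b / 9\<close>: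
  \<Lambda> \<le> n for the left, \<open>sqrt 2 * exp (- 7 / 2) \<le> 1 / 3\<close> for the
  right.\<close>

lemma chernoff_factor:
  assumes n: "n \<ge> 2" and \<Lambda>: "\<Lambda> \<le> real n"
  shows "exp (- (real n * exp (- \<Lambda> / 2) / 8)) \<le> 1 - (sqrt 2 * exp (-4)) ^ n"
proof -
  define b where "b = real n * exp (- real n / 2)"
  have b0: "b > 0" using n by (simp add: b_def)
  have b1: "b \<le> 1"
  proof -
    have "(1 + real n / 4)\<^sup>2 \<le> (exp (real n / 4))\<^sup>2" by (intro power_mono exp_ge_add_one_self) auto
    moreover have "(exp (real n / 4))\<^sup>2 = exp (real n / 2)" by (simp add: power2_eq_square exp_add[symmetric])
    moreover have "real n \<le> (1 + real n / 4)\<^sup>2"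
      using zero_le_power2[of "1 - real n / 4"] by (simp add: power2_eq_square algebra_simps)
    ultimately have "real n \<le> exp (real n / 2)" by linarith
    then show ?thesis by (simp add: b_def exp_minus divide_simps)
  qed
  have "b \<le> real n * exp (- \<Lambda> / 2)" unfolding b_def using \<Lambda> by (intro mult_left_mono) auto
  then have "exp (- (real n * exp (- \<Lambda> / 2) / 8)) \<le> exp (- (b / 8))" by simp
  also have "\<dots> \<le> 1 / (1 + b / 8)"
    using b0 exp_ge_add_one_self[of "b / 8"] by (simp add: exp_minus inverse_eq_divide frac_le)
  also have "\<dots> \<le> 1 - b / 9"
  proof -
    have "b * b \<le> b * 1" using b0 b1 by (intro mult_left_mono) auto
    then have "1 \<le> (1 - b / 9) * (1 + b / 8)" by (simp add: algebra_simps)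
    then show ?thesis using b0 by (simp add: pos_divide_le_eq)
  qed
  also have "\<dots> \<le> 1 - (sqrt 2 * exp (-4)) ^ n"
  proof -
    have "sqrt 2 * exp (- 7 / 2) \<le> 1 / 3"
    proof -
      have "sqrt 2 \<le> 2" using real_sqrt_le_mono[of 2 "2\<^sup>2"] by simp
      moreover have "exp (- 7 / 2 :: real) \<le> 1 / 8"
      proof -
        have "exp (- 7 / 2 :: real) \<le> exp (- (3::real))" by simp
        also have "exp (- (3::real)) = 1 / (exp 1) ^ 3" by (simp add: exp_minus exp_of_nat_mult[symmetric] divide_inverse)
        also have "\<dots> \<le> 1 / 2 ^ 3"
          using exp_ge_add_one_self[of "1::real"] by (intro divide_left_mono power_mono) auto
        finally show ?thesis by simp
      qed
      ultimately have "sqrt 2 * exp (- 7 / 2) \<le> 2 * (1 / 8)" by (intro mult_mono) auto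
      then show ?thesis by simp
    qed
    then have "(sqrt 2 * exp (- 7 / 2)) ^ n \<le> (1 / 3) ^ n" by (intro power_mono) auto
    also have "\<dots> \<le> (1 / 3) ^ 2" using n by (intro power_decreasing) auto
    also have "\<dots> \<le> real n / 9" using n by (simp add: power2_eq_square)
    finally have "(sqrt 2 * exp (- 7 / 2)) ^ n * exp (- real n / 2) \<le> real n / 9 * exp (- real n / 2)"
      by (intro mult_right_mono) auto
    also have "(sqrt 2 * exp (- 7 / 2)) ^ n * exp (- real n / 2) = (sqrt 2 * exp (-4)) ^ n"
    proof -
      have "exp (- real n / 2) = exp (- 1 / 2) ^ n" by (simp add: exp_of_nat_mult[symmetric])
      then show ?thesis
        by (simp add: power_mult_distrib[symmetric] mult.assoc exp_add[symmetric])
    qed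
    finally show ?thesis by (simp add: b_def)
  qed
  finally show ?thesis .
qed

context haar_measure
begin

text \<open>
  Averaging the decreasing radial function \<open>hit\<close> against a Gaussian concentrated in the ball of
  squared radius \<open>8 n / \<Lambda>\<close> compares it with the Gaussian measure of the cube, a product. As \<open>\<Lambda> \<le> n\<close>,
  the mass that the Gaussian leaves outside the ball is negligible.
\<close>

lemma hit_cube_le:
  assumes n: "n \<ge> 2" and \<Lambda>: "0 < \<Lambda>" "\<Lambda> \<le> real n" and x0: "x0 \<in> Rn n" "ip n x0 x0 \<ge> 8 * real n / \<Lambda>"
  shows "hit (cube n) x0 \<le> ennreal (exp (- (real n * exp (- \<Lambda> / 2) / 8)))"
proof -
  define w where "w x = ennreal (exp (- \<Lambda> * ip n x x))" for x
  have ipm[measurable]: "(\<lambda>x. ip n x x) \<in> borel_measurable borel" unfolding ip_def by measurable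
  have [measurable]: "w \<in> borel_measurable borel" unfolding w_def by measurable
  define G where "G = sqrt (pi / \<Lambda>)"
  have G: "G > 0" using \<Lambda> by (simp add: G_def)
  define q where "q = exp (- \<Lambda> / 2) / 4"
  have q: "0 < q" "q \<le> 1" using \<Lambda> by (auto simp: q_def intro: order_trans[of _ 1])
  define z where "z = (sqrt 2 * exp (-4)) ^ n"
  let ?B = "{x. ip n x x \<le> 8 * real n / \<Lambda>}"
  define b where "b = (\<integral>\<^sup>+x. w x * indicator ?B x \<partial>leb n)"
  have Z: "(\<integral>\<^sup>+x. w x \<partial>leb n) = ennreal (G ^ n)"
    unfolding w_def G_def by (rule nn_integral_leb_gauss[OF \<Lambda>(1)])
  \<comment> \<open>Half of the exponent is spent on \<open>\<Lambda> * ip n x x \<ge> 8 * n\<close>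
    outside the ball and yields e^(-4 n); the other half is integrated, and the wider Gaussian costs
    sqrt 2 per coordinate.\<close>
  have tail: "(\<integral>\<^sup>+x. w x * indicator (- ?B) x \<partial>leb n) \<le> ennreal (G ^ n * z)"
  proof -
    have "(\<integral>\<^sup>+x. w x * indicator (- ?B) x \<partial>leb n) \<le>
        (\<integral>\<^sup>+x. ennreal (exp (- 4 * real n)) * ennreal (exp (- (\<Lambda> / 2) * ip n x x)) \<partial>leb n)"
    proof (rule nn_integral_mono)
      fix x
      have "exp (- \<Lambda> * ip n x x) \<le> exp (- 4 * real n) * exp (- (\<Lambda> / 2) * ip n x x)" if "x \<notin> ?B"
      proof -
        have "8 * real n \<le> \<Lambda> * ip n x x" using that \<Lambda>(1) by (simp add: field_simps)
        then show ?thesis unfolding exp_add[symmetric] by simp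
      qed
      then show "w x * indicator (- ?B) x \<le> ennreal (exp (- 4 * real n)) * ennreal (exp (- (\<Lambda> / 2) * ip n x x))"
        by (auto simp: w_def indicator_def ennreal_mult[symmetric] intro!: ennreal_leI)
    qed
    also have "\<dots> = ennreal (exp (- 4 * real n)) * (\<integral>\<^sup>+x. ennreal (exp (- (\<Lambda> / 2) * ip n x x)) \<partial>leb n)"
      using ipm by (intro nn_integral_cmult) simp
    also have "\<dots> = ennreal (exp (- 4 * real n)) * ennreal (sqrt (pi / (\<Lambda> / 2)) ^ n)"
      using \<Lambda> by (subst nn_integral_leb_gauss) auto
    also have "\<dots> = ennreal (G ^ n * z)"
    proof -
      have "sqrt (pi / (\<Lambda> / 2)) = G * sqrt 2" using \<Lambda> by (simp add: G_def real_sqrt_mult[symmetric])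
      moreover have "exp (- 4 * real n) = exp (-4) ^ n" by (simp add: exp_of_nat_mult[symmetric] mult.commute)
      ultimately show ?thesis
        using G by (simp add: z_def ennreal_mult[symmetric] power_mult_distrib mult_ac)
    qed
    finally show ?thesis .
  qed
  have "ennreal (G ^ n) = b + (\<integral>\<^sup>+x. w x * indicator (- ?B) x \<partial>leb n)"
    unfolding b_def Z[symmetric]
    by (subst nn_integral_add[symmetric]) (auto intro!: nn_integral_cong simp: indicator_def)
  also have "\<dots> \<le> b + ennreal (G ^ n * z)" by (intro add_left_mono tail)
  finally have b_ge: "ennreal (G ^ n) \<le> b + ennreal (G ^ n * z)" .
  have "b \<le> (\<integral>\<^sup>+x. w x \<partial>leb n)" unfolding b_def by (intro nn_integral_mono) (auto simp: indicator_def)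
  then obtain b' where b': "b' \<ge> 0" "b = ennreal b'" using Z by (cases b) (auto simp: top_unique)
  have "ennreal (G ^ n) \<le> ennreal (b' + G ^ n * z)"
    using b_ge b' G by (simp add: z_def)
  then have b'_ge: "G ^ n * (1 - z) \<le> b'"
    using b' G by (subst (asm) ennreal_le_iff) (auto simp: z_def algebra_simps)
  obtain h where h: "h \<ge> 0" "hit (cube n) x0 = ennreal h"
    using hit_le_1[of "cube n" x0] by (cases "hit (cube n) x0") (auto simp: top_unique)
  have star: "(\<lambda>i. t * x i) \<in> cube n" if "x \<in> cube n" "0 \<le> t" "t \<le> 1" for x t
    unfolding cube_eq_cbox
  proof safe
    show "(\<lambda>i. t * x i) \<in> Rn n" using that(1) by (simp add: cube_def Rn_iff)
    fix i assume "i < n"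
    then have "\<bar>x i\<bar> \<le> 1 / 2" using that(1) by (simp add: cube_eq_cbox)
    then have "t * \<bar>x i\<bar> \<le> 1 * (1 / 2)" using that by (intro mult_mono) auto
    then show "\<bar>t * x i\<bar> \<le> 1 / 2" using that by (simp add: abs_mult)
  qed
  have "ennreal h * b = (\<integral>\<^sup>+x. hit (cube n) x0 * (w x * indicator ?B x) \<partial>leb n)"
    unfolding b_def h(2)[symmetric]
    by (intro nn_integral_cmult[symmetric] borel_measurable_times_ennreal borel_measurable_indicator)
       (simp_all add: sets_ip_ball)
  also have "\<dots> \<le> (\<integral>\<^sup>+x. w x * hit (cube n) x \<partial>leb n)"
  proof (rule nn_integral_mono_AE, rule AE_mp[OF AE_leb_Rn], rule AE_I2, rule impI)
    fix x assume x: "x \<in> Rn n"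
    have "hit (cube n) x0 \<le> hit (cube n) x" if "x \<in> ?B"
      by (rule hit_antimono[OF sets_cube star x x0(1)]) (use that x0(2) in auto)
    then show "hit (cube n) x0 * (w x * indicator ?B x) \<le> w x * hit (cube n) x"
      by (auto simp: indicator_def mult.commute intro: mult_left_mono)
  qed
  also have "\<dots> = (\<integral>\<^sup>+x. w x * indicator (cube n) x \<partial>leb n)"
    by (rule nn_integral_radial_hit) (auto simp: w_def ip_mat_act_orth)
  also have "\<dots> \<le> (\<integral>\<^sup>+x. (\<Prod>i<n. indicator {-1/2..1/2} (x i) * ennreal (exp (- \<Lambda> * (x i)\<^sup>2))) \<partial>leb n)"
    by (rule nn_integral_mono)
       (auto simp: w_def exp_ip_prod[simplified] prod.distrib prod_indicator[of "\<lambda>_. {-1/2..1/2}", simplified] indicator_def cube_def)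
  also have "\<dots> = (\<Prod>i<n. \<integral>\<^sup>+t. indicator {-1/2..1/2} t * ennreal (exp (- \<Lambda> * t\<^sup>2)) \<partial>lborel)"
    by (rule nn_integral_leb_prod) measurable
  also have "\<dots> \<le> (\<Prod>i<n. ennreal (G * (1 - q)))"
    unfolding G_def q_def by (intro prod_mono_ennreal gauss_Icc_le \<Lambda>)
  also have "\<dots> = ennreal (G ^ n * (1 - q) ^ n)"
    using G q by (simp add: ennreal_power power_mult_distrib)
  finally have "h * b' \<le> G ^ n * (1 - q) ^ n"
    unfolding b'(2) using h b' G q by (simp add: ennreal_mult[symmetric])
  moreover have "h * (G ^ n * (1 - z)) \<le> h * b'" using b'_ge h by (intro mult_left_mono) auto
  ultimately have "G ^ n * (h * (1 - z)) \<le> G ^ n * (1 - q) ^ n" by (simp add: mult_ac)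
  then have "h * (1 - z) \<le> (1 - q) ^ n" using G by (simp add: mult_le_cancel_left_pos)
  also have "\<dots> \<le> exp (- q) ^ n"
    using q exp_ge_add_one_self[of "- q"] by (intro power_mono) auto
  \<comment> \<open>Splitting into two equal factors lets one of them cancel against
    \<open>1 - z\<close>.\<close>
  also have "\<dots> = exp (- (real n * exp (- \<Lambda> / 2) / 8)) * exp (- (real n * exp (- \<Lambda> / 2) / 8))"
    by (simp add: exp_of_nat_mult[symmetric] exp_add[symmetric] q_def)
  finally have "h * (1 - z) \<le> exp (- (real n * exp (- \<Lambda> / 2) / 8)) * exp (- (real n * exp (- \<Lambda> / 2) / 8))" .
  moreover have "h * exp (- (real n * exp (- \<Lambda> / 2) / 8)) \<le> h * (1 - z)"
    unfolding z_def by (intro mult_left_mono chernoff_factor n \<Lambda> h)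
  ultimately have "h * exp (- (real n * exp (- \<Lambda> / 2) / 8)) \<le>
      exp (- (real n * exp (- \<Lambda> / 2) / 8)) * exp (- (real n * exp (- \<Lambda> / 2) / 8))" by linarith
  then have "h \<le> exp (- (real n * exp (- \<Lambda> / 2) / 8))" by (simp add: mult_le_cancel_right)
  then show ?thesis unfolding h(2) by (rule ennreal_leI)
qed

end

text \<open>With \<open>y = exp 1 + real m\<close> and \<open>v = sqrt y\<close>, \<Lambda> \<le> ln
  y gives e^(-\<Lambda>/2) \<ge> 1/v, and e \<le> 3 gives (m - 1) / v \<ge> v - 4. So the n-th root
  of the left side is at most exp(-(v/8 - 1/2)) \<le> 16/v, and \<Lambda> \<le> y finishes.\<close>

lemma hit_power_numeric:
  assumes m: "m \<ge> 2" and n: "n \<ge> 1"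
  shows "exp (- (real n * exp (- Lam m n / 2) / 8)) ^ (m - 1) \<le> (16 / sqrt (Lam m n)) ^ n"
proof -
  define y where "y = exp 1 + real m"
  define \<Lambda> where "\<Lambda> = Lam m n"
  have y1: "y \<ge> 1" using exp_ge_add_one_self[of "1::real"] by (auto simp: y_def)
  have \<Lambda>: "\<Lambda> > 0" "\<Lambda> \<le> ln y" using Lam_pos[OF n, of m] by (auto simp: \<Lambda>_def Lam_def y_def)
  have \<Lambda>y: "\<Lambda> \<le> y" using \<Lambda>(2) ln_le_minus_one[of y] y1 by linarith
  define v where "v = sqrt y"
  have v: "v \<ge> 1" "v * v = y" using y1 by (auto simp: v_def)
  have "1 / v \<le> exp (- \<Lambda> / 2)"
  proof -
    have "exp (ln y / 2) = v"
      using y1 by (simp add: v_def powr_half_sqrt[symmetric] powr_def)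
    then have "exp (- (ln y / 2)) = 1 / v" by (simp add: exp_minus inverse_eq_divide)
    moreover have "exp (- (ln y / 2)) \<le> exp (- \<Lambda> / 2)" using \<Lambda>(2) by simp
    ultimately show ?thesis by simp
  qed
  then have "(real m - 1) * (1 / v) \<le> (real m - 1) * exp (- \<Lambda> / 2)" using m by (intro mult_left_mono) auto
  moreover have "v - 4 \<le> (real m - 1) * (1 / v)"
  proof -
    have "v * v - 4 \<le> real m - 1" using exp_le by (simp add: v y_def)
    moreover have "(v - 4) * v \<le> v * v - 4" using v(1) by (simp add: algebra_simps)
    ultimately show ?thesis using v(1) by (simp add: pos_le_divide_eq)
  qed
  ultimately have "exp (- ((real m - 1) * exp (- \<Lambda> / 2) / 8)) \<le> exp (- (v / 8 - 1 / 2))" by simp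
  also have "\<dots> \<le> 16 / v"
  proof -
    have "v / 16 \<le> exp (v / 8 - 1 / 2)" using exp_ge_add_one_self[of "v / 8 - 1 / 2"] v(1) by linarith
    then have "1 / exp (v / 8 - 1 / 2) \<le> 1 / (v / 16)" using v(1) by (intro divide_left_mono) auto
    then show ?thesis by (simp only: exp_minus inverse_eq_divide divide_divide_eq_right mult_1_left)
  qed
  also have "\<dots> \<le> 16 / sqrt \<Lambda>" unfolding v_def using \<Lambda> \<Lambda>y by (intro divide_left_mono) auto
  finally have "exp (- ((real m - 1) * exp (- \<Lambda> / 2) / 8)) ^ n \<le> (16 / sqrt \<Lambda>) ^ n"
    by (intro power_mono) auto
  moreover have "exp (- (real n * exp (- \<Lambda> / 2) / 8)) ^ (m - 1) = exp (- ((real m - 1) * exp (- \<Lambda> / 2) / 8)) ^ n"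
    using m by (simp add: exp_of_nat_mult[symmetric] of_nat_diff algebra_simps)
  ultimately show ?thesis by (simp add: \<Lambda>_def)
qed

context haar_measure
begin

text \<open>Inside the ball of squared radius 8 n / \<Lambda> the integrand is bounded by 1, outside
  by the power estimate integrated over a cube of volume 1. Two terms of size at most (18 / sqrt
  \<Lambda>)^n give 36, as 2 \<le> 2^n.\<close>

lemma expectation_body_inter_cube_le:
  assumes n: "n \<ge> 2" and m: "m \<ge> 2"
  shows "(\<integral>\<^sup>+V. emeasure (leb n) (body_inter n m (with_id n V) (\<lambda>_. cube n)) \<partial>Pi\<^sub>M {2..m} (\<lambda>_. \<mu>)) \<le>
    ennreal ((36 / sqrt (Lam m n)) ^ n)"
proof -
  let ?\<Lambda> = "Lam m n"
  have \<Lambda>: "?\<Lambda> > 0" "?\<Lambda> \<le> real n" using Lam_pos[of n m] n by (auto simp: Lam_def)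
  let ?B = "{x. ip n x x \<le> 8 * real n / ?\<Lambda>}"
  let ?d = "ennreal ((16 / sqrt ?\<Lambda>) ^ n)"
  have "(\<integral>\<^sup>+V. emeasure (leb n) (body_inter n m (with_id n V) (\<lambda>_. cube n)) \<partial>Pi\<^sub>M {2..m} (\<lambda>_. \<mu>)) =
      (\<integral>\<^sup>+x. indicator (cube n) x * hit (cube n) x ^ (m - 1) \<partial>leb n)"
    by (rule body_inter_expectation(2)) (use m in \<open>auto simp: cube_def\<close>)
  also have "\<dots> \<le> (\<integral>\<^sup>+x. indicator ?B x + ?d * indicator (cube n) x \<partial>leb n)"
  proof (rule nn_integral_mono_AE, rule AE_mp[OF AE_leb_Rn], rule AE_I2, rule impI)
    fix x assume x: "x \<in> Rn n"
    show "indicator (cube n) x * hit (cube n) x ^ (m - 1) \<le> indicator ?B x + ?d * indicator (cube n) x"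
    proof (cases "x \<in> ?B")
      case True
      have "indicator (cube n) x * hit (cube n) x ^ (m - 1) \<le> 1 * 1"
        by (intro mult_mono power_le_one hit_le_1) (auto simp: indicator_def)
      then show ?thesis using True by (simp add: add_increasing2)
    next
      case False
      have "hit (cube n) x ^ (m - 1) \<le> ennreal (exp (- (real n * exp (- ?\<Lambda> / 2) / 8))) ^ (m - 1)"
        by (intro power_mono hit_cube_le n \<Lambda> x) (use False in auto)
      also have "\<dots> \<le> ?d"
        unfolding ennreal_power[OF exp_ge_zero] by (intro ennreal_leI hit_power_numeric m) (use n in auto)
      finally show ?thesis using False by (auto simp: indicator_def)
    qed
  qed
  also have "\<dots> = emeasure (leb n) ?B + ?d"
    by (subst nn_integral_add) (auto simp: nn_integral_cmult emeasure_cube)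
  also have "\<dots> \<le> ennreal ((18 / sqrt ?\<Lambda>) ^ n) + ennreal ((18 / sqrt ?\<Lambda>) ^ n)"
    using n \<Lambda> by (intro add_mono vol_ball_le ennreal_leI power_mono divide_right_mono) auto
  also have "\<dots> = ennreal (2 * (18 / sqrt ?\<Lambda>) ^ n)"
    using \<Lambda> by (subst ennreal_plus[symmetric]) auto
  also have "\<dots> \<le> ennreal (2 ^ n * (18 / sqrt ?\<Lambda>) ^ n)"
    using \<Lambda> n power_increasing[of 1 n "2::real"] by (intro ennreal_leI mult_right_mono) auto
  also have "2 ^ n * (18 / sqrt ?\<Lambda>) ^ n = (36 / sqrt ?\<Lambda>) ^ n"
    by (simp add: power_mult_distrib[symmetric])
  finally show ?thesis .
qed

end

section \<open>The deterministic lower bound, concentration and medians\<close>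

lemma uncond_isotropic_body_facts:
  assumes "convex_body n K" "isotropic n K" "unconditional n K" "n \<ge> 1"
  shows "K \<subseteq> Rn n" "K \<in> sets borel" "emeasure (leb n) K < \<infinity>"
    "{x\<in>Rn n. \<forall>j<n. \<bar>x j\<bar> \<le> 1 / 500} \<subseteq> K"
proof -
  interpret unconditional_convex_body n K using assms by unfold_locales
  show "K \<subseteq> Rn n" "K \<in> sets borel" "emeasure (leb n) K < \<infinity>"
    "{x\<in>Rn n. \<forall>j<n. \<bar>x j\<bar> \<le> 1 / 500} \<subseteq> K"
    using subset_Rn sets_K emeasure_finite contains_cube assms by auto
qed

lemma uncond_isotropic_inter_volume_ge:
  assumes U: "\<And>i. i \<in> {1..m} \<Longrightarrow> U i \<in> orth_group n"
    and K: "\<And>i. i \<in> {1..m} \<Longrightarrow> convex_body n (K i) \<and> isotropic n (K i) \<and> unconditional n (K i)"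
    and m: "m \<ge> 1" and n: "n \<ge> 1"
  shows "exp (-4) / 2000 / sqrt (Lam m n) \<le> vol n (body_inter n m U K) powr (1 / real n)"
proof (rule body_inter_volume_ge[OF U _ _ _ _ m n])
  fix i assume "i \<in> {1..m}"
  then have *: "convex_body n (K i)" "isotropic n (K i)" "unconditional n (K i)" using K by blast+
  show "K i \<subseteq> Rn n" "K i \<in> sets borel" "emeasure (leb n) (K i) < \<infinity>"
    "{x\<in>Rn n. \<forall>j<n. \<bar>x j\<bar> \<le> 1 / 500} \<subseteq> K i"
    by (rule uncond_isotropic_body_facts[OF * n])+
qed

text \<open>A single outcome below the median is enough for a lower bound on it, because the volume
  estimate holds for every sample.\<close>

lemma is_medianD:
  assumes "is_median M X q"
  shows "\<exists>\<omega>\<in>space M. X \<omega> \<le> q"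
proof -
  have "measure M {\<omega>\<in>space M. X \<omega> \<le> q} \<noteq> 0" using assms by (simp add: is_median_def)
  then have "{\<omega>\<in>space M. X \<omega> \<le> q} \<noteq> {}" by (metis measure_empty)
  then show ?thesis by blast
qed

lemma powr_inverse_power: "0 \<le> a \<Longrightarrow> n \<ge> 1 \<Longrightarrow> (a ^ n) powr (1 / real n) = a"
  by (cases "a = 0") (auto simp: powr_realpow[symmetric] powr_powr)

context haar_measure
begin

abbreviation rotations :: "nat \<Rightarrow> (nat \<Rightarrow> rmat) measure" where
  "rotations m \<equiv> Pi\<^sub>M {2..m} (\<lambda>_. \<mu>)"

abbreviation cubes_volume :: "nat \<Rightarrow> (nat \<Rightarrow> rmat) \<Rightarrow> real" where
  "cubes_volume m V \<equiv> vol n (body_inter n m (with_id n V) (\<lambda>_. cube n))"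

lemma prob_space_rotations: "prob_space (rotations m)"
  by (rule prob_space_PiM) (rule prob_space_axioms)

lemma with_id_orth: "V \<in> space (rotations m) \<Longrightarrow> i \<in> {1..m} \<Longrightarrow> with_id n V i \<in> orth_group n"
  using id_mat_orth by (auto simp: with_id_def space_PiM space_eq PiE_iff)

lemma cubes_volume_measurable:
  assumes m: "m \<ge> 2"
  shows "cubes_volume m \<in> borel_measurable (rotations m)"
  unfolding measure_def
  by (rule measurable_compose[OF body_inter_expectation(1)[OF m sets_cube]]) (auto simp: cube_def)

lemma nn_integral_cubes_volume:
  assumes n: "n \<ge> 2" and m: "m \<ge> 2"
  shows "(\<integral>\<^sup>+V. ennreal (cubes_volume m V) \<partial>rotations m) \<le> ennreal ((36 / sqrt (Lam m n)) ^ n)"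
proof -
  have "(\<integral>\<^sup>+V. ennreal (cubes_volume m V) \<partial>rotations m) \<le>
      (\<integral>\<^sup>+V. emeasure (leb n) (body_inter n m (with_id n V) (\<lambda>_. cube n)) \<partial>rotations m)"
    unfolding measure_def by (intro nn_integral_mono) (simp add: ennreal_enn2real_if)
  then show ?thesis using expectation_body_inter_cube_le[OF n m] by (rule order_trans)
qed

lemma integrable_cubes_volume:
  assumes "n \<ge> 2" "m \<ge> 2"
  shows "integrable (rotations m) (cubes_volume m)"
proof (rule integrableI_bounded)
  have "(\<integral>\<^sup>+V. ennreal (norm (cubes_volume m V)) \<partial>rotations m) \<le> ennreal ((36 / sqrt (Lam m n)) ^ n)"
    using nn_integral_cubes_volume[OF assms] by simp
  then show "(\<integral>\<^sup>+V. ennreal (norm (cubes_volume m V)) \<partial>rotations m) < \<infinity>"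
    by (rule le_less_trans) simp
qed (rule cubes_volume_measurable[OF assms(2)])

lemma expectation_cubes_volume:
  assumes n: "n \<ge> 2" and m: "m \<ge> 2"
  shows "(\<integral>V. cubes_volume m V \<partial>rotations m) \<le> (36 / sqrt (Lam m n)) ^ n"
proof -
  have "ennreal (\<integral>V. cubes_volume m V \<partial>rotations m) = (\<integral>\<^sup>+V. ennreal (cubes_volume m V) \<partial>rotations m)"
    by (rule nn_integral_eq_integral[symmetric]) (auto intro: integrable_cubes_volume n m)
  then have "ennreal (\<integral>V. cubes_volume m V \<partial>rotations m) \<le> ennreal ((36 / sqrt (Lam m n)) ^ n)"
    using nn_integral_cubes_volume[OF n m] by simp
  then show ?thesis using Lam_pos[of n m] n by (subst (asm) ennreal_le_iff) auto
qed

text \<open>Markov's inequality at e^n times the bound on the expectation; this is the origin of the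
  constant 36 e and of the rate 1 in the exponent.\<close>

lemma cubes_volume_tail:
  assumes n: "n \<ge> 2" and m: "m \<ge> 2"
  shows "measure (rotations m) {V\<in>space (rotations m). (36 * exp 1 / sqrt (Lam m n)) ^ n \<le> cubes_volume m V} \<le> exp (- real n)"
    (is "measure ?P ?S \<le> _")
proof -
  interpret P: prob_space ?P by (rule prob_space_rotations)
  let ?t = "(36 * exp 1 / sqrt (Lam m n)) ^ n"
  have t: "?t > 0" using Lam_pos[of n m] n by simp
  have [measurable]: "cubes_volume m \<in> borel_measurable ?P" by (rule cubes_volume_measurable[OF m])
  have "?t * measure ?P ?S = (\<integral>V. ?t * indicator ?S V \<partial>?P)" by simp
  also have "\<dots> \<le> (\<integral>V. cubes_volume m V \<partial>?P)"
  proof (rule integral_mono)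
    have "?S \<in> sets ?P" by measurable
    then show "integrable ?P (\<lambda>V. ?t * indicator ?S V)"
      by (intro integrable_mult_right integrable_real_indicator) (simp_all add: less_top[symmetric])
  qed (auto simp: indicator_def integrable_cubes_volume n m)
  also have "\<dots> \<le> (36 / sqrt (Lam m n)) ^ n" by (rule expectation_cubes_volume[OF n m])
  also have "\<dots> = ?t * exp (- real n)"
    by (simp add: power_divide power_mult_distrib exp_of_nat_mult[symmetric] exp_minus)
  finally show ?thesis using t by (simp only: mult_le_cancel_left_pos)
qed

lemma cubes_volume_ge:
  assumes V: "V \<in> space (rotations m)" and n: "n \<ge> 2" and m: "m \<ge> 2"
  shows "exp (-4) / 2000 / sqrt (Lam m n) \<le> cubes_volume m V powr (1 / real n)"
proof (rule body_inter_volume_ge[OF with_id_orth[OF V]])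
  show "cube n \<subseteq> Rn n" by (auto simp: cube_def)
  show "{x\<in>Rn n. \<forall>j<n. \<bar>x j\<bar> \<le> 1 / 500} \<subseteq> cube n"
  proof
    fix x assume x: "x \<in> {x\<in>Rn n. \<forall>j<n. \<bar>x j\<bar> \<le> 1 / 500}"
    have "\<bar>x j\<bar> \<le> 1 / 2" if "j < n" for j
    proof -
      have "\<bar>x j\<bar> \<le> 1 / 500" using x that by simp
      then show ?thesis by linarith
    qed
    then show "x \<in> cube n" using x by (simp add: cube_eq_cbox)
  qed
qed (use n m in \<open>simp_all add: emeasure_cube sets_cube\<close>)

text \<open>The lower inequality holds for every sample, so probability is lost only in the upper
  tail. The constant \<open>c\<close> stays free because the final one is smaller, having to serve
  the medians too.\<close>

lemma cubes_volume_concentration: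
  assumes n: "n \<ge> 2" and m: "m \<ge> 2" and c: "c \<le> exp (-4) / 2000"
  shows "1 - exp (- real n) \<le> measure (rotations m) {V\<in>space (rotations m).
    c / sqrt (Lam m n) \<le> cubes_volume m V powr (1 / real n) \<and>
    cubes_volume m V powr (1 / real n) \<le> 36 * exp 1 / sqrt (Lam m n)}" (is "_ \<le> measure ?P ?G")
proof -
  interpret P: prob_space ?P by (rule prob_space_rotations)
  let ?S = "{V\<in>space ?P. (36 * exp 1 / sqrt (Lam m n)) ^ n \<le> cubes_volume m V}"
  have \<Lambda>: "Lam m n > 0" using Lam_pos[of n m] n by simp
  have [measurable]: "cubes_volume m \<in> borel_measurable ?P" by (rule cubes_volume_measurable[OF m])
  have "space ?P - ?S \<subseteq> ?G"
  proof
    fix V assume V: "V \<in> space ?P - ?S"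
    have "cubes_volume m V powr (1 / real n) \<le> ((36 * exp 1 / sqrt (Lam m n)) ^ n) powr (1 / real n)"
      using V by (intro powr_mono2) auto
    also have "\<dots> = 36 * exp 1 / sqrt (Lam m n)" using \<Lambda> n by (intro powr_inverse_power) auto
    finally have "cubes_volume m V powr (1 / real n) \<le> 36 * exp 1 / sqrt (Lam m n)" .
    moreover have "c / sqrt (Lam m n) \<le> exp (-4) / 2000 / sqrt (Lam m n)"
      using c \<Lambda> by (intro divide_right_mono) auto
    then have "c / sqrt (Lam m n) \<le> cubes_volume m V powr (1 / real n)"
      using cubes_volume_ge[OF _ n m, of V] V by simp
    ultimately show "V \<in> ?G" using V by simp
  qed
  then have "measure ?P (space ?P - ?S) \<le> measure ?P ?G"
    by (rule P.finite_measure_mono) measurable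
  moreover have "measure ?P (space ?P - ?S) = 1 - measure ?P ?S" by (rule P.prob_compl) measurable
  ultimately show ?thesis using cubes_volume_tail[OF n m] by simp
qed

text \<open>The deterministic bound holds at some outcome below \<open>q\<close>. A value
  \<open>r\<close> above 36 e / (sqrt \<Lambda> \<beta>) would put probability 1/2 into the tail
  event, whose probability is at most e^-n < 1/2. The common normalization by \<beta> drops out of
  the ratio.\<close>

lemma median_vrad_ge:
  assumes n: "n \<ge> 2" and m: "m \<ge> 2"
    and K: "\<And>i. i \<in> {1..m} \<Longrightarrow> convex_body n (K i) \<and> isotropic n (K i) \<and> unconditional n (K i)"
    and q: "is_median (rotations m) (\<lambda>V. vrad n (body_inter n m (with_id n V) K)) q"
    and r: "is_median (rotations m) (\<lambda>V. vrad n (body_inter n m (with_id n V) (\<lambda>_. cube n))) r"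
  shows "exp (-4) / 2000 / (36 * exp 1) * r \<le> q"
proof -
  interpret P: prob_space "rotations m" by (rule prob_space_rotations)
  define \<beta> where "\<beta> = vol n (unit_ball n) powr (1 / real n)"
  have \<beta>0: "\<beta> \<ge> 0" by (simp add: \<beta>_def)
  have vrad: "vrad n S = vol n S powr (1 / real n) / \<beta>" for S by (simp add: vrad_def \<beta>_def powr_divide)
  let ?s = "sqrt (Lam m n)"
  have s: "?s > 0" using Lam_pos[of n m] n by simp
  obtain V where V: "V \<in> space (rotations m)" "vrad n (body_inter n m (with_id n V) K) \<le> q"
    using is_medianD[OF q] by blast
  have "exp (-4) / 2000 / ?s \<le> vol n (body_inter n m (with_id n V) K) powr (1 / real n)"
    by (rule uncond_isotropic_inter_volume_ge[OF with_id_orth[OF V(1)] K]) (use n m in auto)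
  then have "exp (-4) / 2000 / ?s / \<beta> \<le> vrad n (body_inter n m (with_id n V) K)"
    unfolding vrad by (intro divide_right_mono) (auto simp: \<beta>_def)
  then have q_ge: "exp (-4) / 2000 / ?s / \<beta> \<le> q" using V(2) by linarith
  have r_le: "r \<le> 36 * exp 1 / ?s / \<beta>"
  proof (rule ccontr)
    assume "\<not> ?thesis"
    then have r': "36 * exp 1 / ?s / \<beta> < r" by simp
    let ?S = "{V\<in>space (rotations m). (36 * exp 1 / ?s) ^ n \<le> cubes_volume m V}"
    have [measurable]: "cubes_volume m \<in> borel_measurable (rotations m)" by (rule cubes_volume_measurable[OF m])
    have "{V\<in>space (rotations m). r \<le> vrad n (body_inter n m (with_id n V) (\<lambda>_. cube n))} \<subseteq> ?S"
    proof safe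
      fix V assume "r \<le> vrad n (body_inter n m (with_id n V) (\<lambda>_. cube n))"
      then have "36 * exp 1 / ?s / \<beta> < cubes_volume m V powr (1 / real n) / \<beta>" using r' by (simp add: vrad)
      then have "36 * exp 1 / ?s < cubes_volume m V powr (1 / real n)"
        by (meson \<beta>0 divide_right_mono not_less)
      then have "(36 * exp 1 / ?s) ^ n \<le> (cubes_volume m V powr (1 / real n)) ^ n"
        using s by (intro power_mono) auto
      also have "\<dots> = cubes_volume m V"
        using n by (cases "cubes_volume m V = 0") (auto simp: powr_realpow[symmetric] powr_powr less_le)
      finally show "(36 * exp 1 / ?s) ^ n \<le> cubes_volume m V" .
    qed
    then have "measure (rotations m) {V\<in>space (rotations m). r \<le> vrad n (body_inter n m (with_id n V) (\<lambda>_. cube n))} \<le>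
        measure (rotations m) ?S"
      by (rule P.finite_measure_mono) measurable
    also have "\<dots> \<le> exp (- real n)" by (rule cubes_volume_tail[OF n m])
    also have "\<dots> \<le> exp (- 2)" using n by simp
    also have "exp (- 2 :: real) < 1 / 2"
      using exp_ge_add_one_self[of "2::real"] by (simp add: exp_minus divide_simps)
    finally show False using r by (simp add: is_median_def)
  qed
  have "exp (-4) / 2000 / (36 * exp 1) * r \<le> exp (-4) / 2000 / (36 * exp 1) * (36 * exp 1 / ?s / \<beta>)"
    by (intro mult_left_mono r_le) auto
  also have "\<dots> = exp (-4) / 2000 / ?s / \<beta>" by simp
  finally show ?thesis using q_ge by linarith
qed

end

theorem theorem1p8:
  shows "\<exists>c C c' :: real. c > 0 \<and> C > 0 \<and> c' > 0 \<and>
    (\<forall>n m :: nat. n \<ge> 2 \<longrightarrow> m \<ge> 2 \<longrightarrow>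
      (\<forall>K U.
         (\<forall>i\<in>{1..m}. convex_body n (K i) \<and> isotropic n (K i) \<and> unconditional n (K i)) \<longrightarrow>
         (\<forall>i\<in>{1..m}. U i \<in> orth_group n) \<longrightarrow>
         vol n (body_inter n m U K) powr (1 / real n) \<ge> c / sqrt (Lam m n)) \<and>
      (\<forall>\<mu>. haar_prob n \<mu> \<longrightarrow>
         (let P = Pi\<^sub>M {2..m} (\<lambda>_. \<mu>);
              Q = (\<lambda>i::nat. cube n)
          in
            integrable P (\<lambda>V. vol n (body_inter n m (with_id n V) Q)) \<and>
            (\<integral>V. vol n (body_inter n m (with_id n V) Q) \<partial>P) \<le> (C / sqrt (Lam m n)) ^ n \<and>
            measure P {V \<in> space P.
                c / sqrt (Lam m n) \<le> vol n (body_inter n m (with_id n V) Q) powr (1 / real n) \<and>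
                vol n (body_inter n m (with_id n V) Q) powr (1 / real n) \<le> C / sqrt (Lam m n)}
              \<ge> 1 - exp (- c' * real n) \<and>
            (\<forall>K. (\<forall>i\<in>{1..m}. convex_body n (K i) \<and> isotropic n (K i) \<and> unconditional n (K i)) \<longrightarrow>
              (\<forall>q r. is_median P (\<lambda>V. vrad n (body_inter n m (with_id n V) K)) q \<longrightarrow>
                     is_median P (\<lambda>V. vrad n (body_inter n m (with_id n V) Q)) r \<longrightarrow>
                     q \<ge> c * r)))))"
proof -
  define c1 :: real where "c1 = exp (-4) / 2000"
  define C :: real where "C = 36 * exp 1"
  \<comment> \<open>One constant has to serve both the volume bound, which allows \<open>c1\<close>,
    and the comparison of medians, which allows the ratio of the lower to the upper constant; the
    ratio is the smaller one.\<close>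
  define c where "c = c1 / C"
  have C: "C \<ge> 36" using exp_ge_add_one_self[of "1::real"] by (simp add: C_def)
  have c: "c > 0" "c \<le> c1" using C by (auto simp: c_def c1_def intro: divide_le_eq[THEN iffD2])
  show ?thesis
    unfolding Let_def
  proof (rule exI[of _ c], rule exI[of _ C], rule exI[of _ 1], intro conjI allI impI)
    show "c > 0" "C > 0" "(1::real) > 0" using c C by simp_all
  next
    fix n m :: nat and K U
    assume nm: "2 \<le> n" "2 \<le> m" and KU: "\<forall>i\<in>{1..m}. convex_body n (K i) \<and> isotropic n (K i) \<and> unconditional n (K i)"
      "\<forall>i\<in>{1..m}. U i \<in> orth_group n"
    have "c / sqrt (Lam m n) \<le> c1 / sqrt (Lam m n)"
      using c Lam_pos[of n m] nm(1) by (intro divide_right_mono) auto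
    also have "\<dots> \<le> vol n (body_inter n m U K) powr (1 / real n)"
      unfolding c1_def by (rule uncond_isotropic_inter_volume_ge) (use nm KU in auto)
    finally show "c / sqrt (Lam m n) \<le> vol n (body_inter n m U K) powr (1 / real n)" .
  next
    fix n m :: nat and \<mu>
    assume nm: "2 \<le> n" "2 \<le> m" and haar: "haar_prob n \<mu>"
    interpret haar_measure n \<mu> using haar by unfold_locales
    show "integrable (rotations m) (cubes_volume m)" by (rule integrable_cubes_volume[OF nm])
    have "(36 / sqrt (Lam m n)) ^ n \<le> (C / sqrt (Lam m n)) ^ n"
      using C Lam_pos[of n m] nm by (intro power_mono divide_right_mono) auto
    then show "(\<integral>V. cubes_volume m V \<partial>rotations m) \<le> (C / sqrt (Lam m n)) ^ n"
      using expectation_cubes_volume[OF nm] by linarith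
    show "1 - exp (- 1 * real n) \<le> measure (rotations m) {V\<in>space (rotations m).
        c / sqrt (Lam m n) \<le> cubes_volume m V powr (1 / real n) \<and>
        cubes_volume m V powr (1 / real n) \<le> C / sqrt (Lam m n)}"
      unfolding C_def using cubes_volume_concentration[OF nm c(2)[unfolded c1_def]] by simp
    fix K q r
    assume "\<forall>i\<in>{1..m}. convex_body n (K i) \<and> isotropic n (K i) \<and> unconditional n (K i)"
      "is_median (rotations m) (\<lambda>V. vrad n (body_inter n m (with_id n V) K)) q"
      "is_median (rotations m) (\<lambda>V. vrad n (body_inter n m (with_id n V) (\<lambda>_. cube n))) r"
    then show "c * r \<le> q"
      unfolding c_def c1_def C_def using median_vrad_ge[OF nm, of K q r] by blast
  qed
qed

end
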